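(* Let $\theta>0$ and let $(\mathbb P_n)_{n\in\mathbb N}$ be any sequence of asymptotically Ewens measures with parameter $\theta$. For a partition of $n$ let $L_{n,k}$ be the length of its $k$th longest part (with $L_{n,k}=0$ if there are fewer than $k$ parts), and let $L_n=(L_{n,1},L_{n,2},\ldots)$. Then, with the partition of $n$ distributed according to $\mathbb P_n$, $L_n/n$ converges in distribution, as random elements of $L^1(\mathbb N)=\ell^1$ with its norm topology, as $n\to\infty$, to $PD(\theta)$, the Poisson-Dirichlet measure with parameter $\theta$.
   Context: Partitions. $\mathcal P_n$ is the set of partitions of $n$, written $\alpha=(\alpha_1,\ldots,\alpha_n)$, where $\alpha_i\ge0$ is the number of parts of size $i$, so $\alpha_1+2\alpha_2+\cdots+n\alpha_n=n$. A vector $(\alpha_1,\ldots,\alpha_m)$ of nonnegative integers is regarded as a partition of $k=\sum_{i\le m} i\alpha_i$ (discarding or appending zeros as needed; $k=0$ gives the empty partition). Ewens measure. For $\theta>0$, $\mathbb P^\theta_n(\alpha)=\frac{n!}{\theta(\theta+1)\cdots(\theta+n-1)}\prod_{i=1}^n\frac{\theta^{\alpha_i}}{i^{\alpha_i}\alpha_i!}$ for $\alpha\in\mathcal P_n$. Perturbed measures. Given a nonnegative function $\eta$ on the set of all partitions of all integers $k\ge0$, let $\mathbb P^{\theta,\eta}_n(\alpha)=\frac{\eta(\alpha)}{Z^{\theta,\eta}_n}\prod_{i=1}^n\frac{\theta^{\alpha_i}}{i^{\alpha_i}\alpha_i!}$ for $\alpha\in\mathcal P_n$, where $Z_n^{\theta,\eta}$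 is the normalising constant (assumed positive for every $n\in\mathbb N$). Thus $\eta$ restricted to $\mathcal P_n$ is a positive constant multiple of the Radon-Nikodym derivative of $\mathbb P^{\theta,\eta}_n$ with respect to $\mathbb P^\theta_n$. Feller coupling. For a binary sequence $\xi=(\xi_1,\xi_2,\ldots)\in\{0,1\}^{\mathbb N}$ with $\xi_1=1$ and $n\in\mathbb N$, define the partition $(\alpha_1(n),\ldots,\alpha_n(n))\in\mathcal P_n$ by $$\alpha_i(n)=\sum_{j=1}^{n-i}\xi_j(1-\xi_{j+1})\cdots(1-\xi_{j+i-1})\xi_{i+j}+\xi_{n-i+1}(1-\xi_{n-i+2})\cdots(1-\xi_n),$$ i.e. the number of maximal runs of exactly $i-1$ zeros between consecutive $1$s in the string $(\xi_1,\ldots,\xi_n,1)$. Let $\mathbb P^\theta_F$ be the probability measure on $\{0,1\}^{\mathbb N}$ under which the $\xi_i$ are independent Bernoulli with success probability $\theta/(\theta+i-1)$ (so $\xi_1=1$ almost surely); the law of $(\alpha_1(n),\dots,\alpha_n(n))$ under $\mathbb P_F^\theta$ is $\mathbb P^\theta_n$. Expectation under $\mathbb P^\theta_F$ is $\mathbb E^\theta_F$. Asymptotically Ewens. Given a nonnegative function $\eta$ on the set of all partitions of all integers $k\ge0$, for $m\le n$ define the random variables (under $\mathbb P^\theta_F$) $\eta_{n,m}=\eta(\alpha_1(n),\ldots,\alpha_m(n))$. A sequence of measures $\mathbb P_n$ on $\mathcal P_n$, $n\in\mathbb N$, is asymptotically Ewens with parameter $\theta$ if it can be written as $\mathbb P_n=\mathbb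 P_n^{\theta,\eta}$ for some nonnegative function $\eta$ on the set of all partitions of all integers $k\ge0$, with $Z_n^{\theta,\eta}>0$ for every $n\in\mathbb N$, such that (1) the limits $\lim_{n\to\infty}\eta_{n,n}$ and $\lim_{m\to\infty}\lim_{n\to\infty}\eta_{n,m}$ exist and agree in $L^1(\mathbb P^\theta_F)$; and (2) the common limit $\eta_\infty$ satisfies $0<\mathbb E^\theta_F[\eta_\infty]<\infty$. Poisson-Dirichlet measure. $PD(\theta)$ is the law of the random sequence $(J_1/S,J_2/S,\ldots)$, where $J_1>J_2>\cdots$ are the points, in decreasing order, of a Poisson point process on $(0,\infty)$ with intensity $\theta x^{-1}e^{-x}\,dx$, and $S=\sum_k J_k$. *)

theory Defs
  imports "HOL-Probability.Probability"
begin

section \<open>The Banach space of absolutely summable sequences\<close>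

typedef ell1 = "{x :: nat \<Rightarrow> real. summable (\<lambda>k. \<bar>x k\<bar>)}"
  morphisms ell1_nth Abs_ell1
  by (rule exI[of _ "\<lambda>_. 0"]) simp

setup_lifting type_definition_ell1

lemma summable_abs_add:
  fixes f g :: "nat \<Rightarrow> real"
  assumes "summable (\<lambda>k. \<bar>f k\<bar>)" "summable (\<lambda>k. \<bar>g k\<bar>)"
  shows "summable (\<lambda>k. \<bar>f k + g k\<bar>)"
  by (rule summable_comparison_test'[OF summable_add[OF assms], of 0]) auto

lemma summable_abs_diff:
  fixes f g :: "nat \<Rightarrow> real"
  assumes "summable (\<lambda>k. \<bar>f k\<bar>)" "summable (\<lambda>k. \<bar>g k\<bar>)"
  shows "summable (\<lambda>k. \<bar>f k - g k\<bar>)"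
  using summable_abs_add[of f "\<lambda>k. - g k"] assms by simp

instantiation ell1 :: real_vector
begin

lift_definition zero_ell1 :: ell1 is "\<lambda>_. 0" by simp
lift_definition plus_ell1 :: "ell1 \<Rightarrow> ell1 \<Rightarrow> ell1" is "\<lambda>x y k. x k + y k"
  by (rule summable_abs_add)
lift_definition minus_ell1 :: "ell1 \<Rightarrow> ell1 \<Rightarrow> ell1" is "\<lambda>x y k. x k - y k"
  by (rule summable_abs_diff)
lift_definition uminus_ell1 :: "ell1 \<Rightarrow> ell1" is "\<lambda>x k. - x k" by simp
lift_definition scaleR_ell1 :: "real \<Rightarrow> ell1 \<Rightarrow> ell1" is "\<lambda>c x k. c * x k"
  by (simp add: abs_mult summable_mult)

instance
  by standard (transfer, simp add: algebra_simps fun_eq_iff)+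

end

instantiation ell1 :: real_normed_vector
begin

lift_definition norm_ell1 :: "ell1 \<Rightarrow> real" is "\<lambda>x. \<Sum>k. \<bar>x k\<bar>" .

definition dist_ell1 :: "ell1 \<Rightarrow> ell1 \<Rightarrow> real"
  where "dist_ell1 x y = norm (x - y)"
definition sgn_ell1 :: "ell1 \<Rightarrow> ell1"
  where "sgn_ell1 x = x /\<^sub>R norm x"
definition uniformity_ell1 :: "(ell1 \<times> ell1) filter"
  where "uniformity_ell1 = (INF e\<in>{0<..}. principal {(x, y). dist x y < e})"
definition open_ell1 :: "ell1 set \<Rightarrow> bool"
  where "open_ell1 U \<longleftrightarrow> (\<forall>x\<in>U. \<forall>\<^sub>F (x', y) in uniformity. x' = x \<longrightarrow> y \<in> U)"

instance
proof
  fix x y :: ell1 and a :: real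
  show "(norm x = 0) = (x = 0)"
    by transfer (auto simp: suminf_eq_zero_iff)
  show "norm (x + y) \<le> norm x + norm y"
  proof transfer
    fix f g :: "nat \<Rightarrow> real"
    assume s: "summable (\<lambda>k. \<bar>f k\<bar>)" "summable (\<lambda>k. \<bar>g k\<bar>)"
    show "(\<Sum>k. \<bar>f k + g k\<bar>) \<le> (\<Sum>k. \<bar>f k\<bar>) + (\<Sum>k. \<bar>g k\<bar>)"
      unfolding suminf_add[OF s]
      by (rule suminf_le) (auto intro: summable_abs_add summable_add s)
  qed
  show "norm (a *\<^sub>R x) = \<bar>a\<bar> * norm x"
    by transfer (simp add: abs_mult suminf_mult)
qed (simp_all add: dist_ell1_def sgn_ell1_def uniformity_ell1_def open_ell1_def)

end


section \<open>Partitions and perturbed Ewens measures\<close>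

text \<open>A partition is encoded by its part counts: \<^term>\<open>\<alpha> i\<close> is the number of parts of size
  \<^term>\<open>i\<close>, and is zero off the range of possible part sizes, so that appending or discarding
  zeros does not change the partition.\<close>

definition partitions :: "nat \<Rightarrow> (nat \<Rightarrow> nat) set" where
  "partitions n = {\<alpha>. (\<forall>i. i \<notin> {1..n} \<longrightarrow> \<alpha> i = 0) \<and> (\<Sum>i=1..n. i * \<alpha> i) = n}"

definition ewens_weight :: "real \<Rightarrow> nat \<Rightarrow> (nat \<Rightarrow> nat) \<Rightarrow> real" where
  "ewens_weight \<theta> n \<alpha> = (\<Prod>i=1..n. \<theta> ^ \<alpha> i / (real i ^ \<alpha> i * fact (\<alpha> i)))"

definition ewens_Z :: "real \<Rightarrow> ((nat \<Rightarrow> nat) \<Rightarrow> real) \<Rightarrow> nat \<Rightarrow> real" where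
  "ewens_Z \<theta> \<eta> n = (\<Sum>\<alpha>\<in>partitions n. \<eta> \<alpha> * ewens_weight \<theta> n \<alpha>)"

definition perturbed_ewens ::
    "real \<Rightarrow> ((nat \<Rightarrow> nat) \<Rightarrow> real) \<Rightarrow> nat \<Rightarrow> (nat \<Rightarrow> nat) \<Rightarrow> real" where
  "perturbed_ewens \<theta> \<eta> n \<alpha> =
     (if \<alpha> \<in> partitions n then \<eta> \<alpha> / ewens_Z \<theta> \<eta> n * ewens_weight \<theta> n \<alpha> else 0)"

text \<open>The following makes the finite sum in \<^const>\<open>ewens_Z\<close> a genuine one.\<close>

lemma finite_partitions: "finite (partitions n)"
proof (rule finite_subset)
  show "partitions n \<subseteq> {\<alpha>. \<forall>i. (i \<in> {1..n} \<longrightarrow> \<alpha> i \<in> {0..n}) \<and> (i \<notin> {1..n} \<longrightarrow> \<alpha> i = 0)}"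
  proof (safe, goal_cases)
    case (1 \<alpha> i)
    then have "i * \<alpha> i \<le> (\<Sum>i=1..n. i * \<alpha> i)"
      by (intro member_le_sum) auto
    also have "\<dots> = n" using 1 by (simp add: partitions_def)
    finally have "i * \<alpha> i \<le> n" .
    moreover have "\<alpha> i \<le> i * \<alpha> i" using 1 by (cases i) auto
    ultimately have "\<alpha> i \<le> n" by (rule order_trans[rotated])
    then show ?case by simp
  qed (auto simp: partitions_def)
  show "finite {\<alpha>. \<forall>i. (i \<in> {1..n} \<longrightarrow> \<alpha> i \<in> {0..n}) \<and> (i \<notin> {1..n} \<longrightarrow> \<alpha> i = (0::nat))}"
    by (rule finite_set_of_finite_funs) auto
qed


section \<open>The Feller coupling\<close>

definition feller_measure :: "real \<Rightarrow> (nat \<Rightarrow> bool) measure" where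
  "feller_measure \<theta> =
     (\<Pi>\<^sub>M i\<in>{1..}. measure_pmf (bernoulli_pmf (\<theta> / (\<theta> + real i - 1))))"

definition feller_count :: "nat \<Rightarrow> (nat \<Rightarrow> bool) \<Rightarrow> nat \<Rightarrow> nat" where
  "feller_count n \<xi> i = (if i \<in> {1..n} then
       (\<Sum>j=1..n-i. of_bool (\<xi> j) * (\<Prod>k=j+1..j+i-1. of_bool (\<not> \<xi> k)) * of_bool (\<xi> (i + j)))
       + of_bool (\<xi> (n-i+1)) * (\<Prod>k=n-i+2..n. of_bool (\<not> \<xi> k))
     else 0)"

text \<open>The random variable \<open>\<eta>\<close> evaluated at the partition
  \<open>(\<alpha>\<^sub>1(n), \<dots>, \<alpha>\<^sub>m(n))\<close>, of a random integer that need not be \<open>n\<close>.\<close>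

definition eta_trunc ::
    "((nat \<Rightarrow> nat) \<Rightarrow> real) \<Rightarrow> nat \<Rightarrow> nat \<Rightarrow> (nat \<Rightarrow> bool) \<Rightarrow> real" where
  "eta_trunc \<eta> n m \<xi> = \<eta> (\<lambda>i. if i \<le> m then feller_count n \<xi> i else 0)"


section \<open>Asymptotically Ewens sequences\<close>

text \<open>Integrability is demanded explicitly because the Bochner integral of a non-integrable
  function is zero by convention.\<close>

definition tendsto_L1 ::
    "'w measure \<Rightarrow> (nat \<Rightarrow> 'w \<Rightarrow> real) \<Rightarrow> ('w \<Rightarrow> real) \<Rightarrow> bool" where
  "tendsto_L1 M f g \<longleftrightarrow>
     (\<forall>\<^sub>F n in sequentially. integrable M (f n)) \<and> integrable M g \<and>
     (\<lambda>n. \<integral>\<omega>. \<bar>f n \<omega> - g \<omega>\<bar> \<partial>M) \<longlonglongrightarrow> 0"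

text \<open>\<^term>\<open>h\<close> is the common limit of the paper's \<open>\<eta>\<^bsub>n,n\<^esub>\<close> and of the inner limits \<^term>\<open>g m\<close>, all taken in \<open>L\<^sup>1\<close>. Indices range over the positive integers; \<^term>\<open>P 0\<close> is unconstrained. Finiteness of the
  expectation of the limit is part of its integrability in \<^const>\<open>tendsto_L1\<close>.\<close>

definition asymptotically_ewens :: "real \<Rightarrow> (nat \<Rightarrow> (nat \<Rightarrow> nat) pmf) \<Rightarrow> bool" where
  "asymptotically_ewens \<theta> P \<longleftrightarrow> (\<exists>\<eta>.
     (\<forall>k. \<forall>\<alpha>\<in>partitions k. 0 \<le> \<eta> \<alpha>) \<and>
     (\<forall>n\<ge>1. 0 < ewens_Z \<theta> \<eta> n) \<and>
     (\<forall>n\<ge>1. \<forall>\<alpha>. pmf (P n) \<alpha> = perturbed_ewens \<theta> \<eta> n \<alpha>) \<and>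
     (\<exists>h g.
        tendsto_L1 (feller_measure \<theta>) (\<lambda>n. eta_trunc \<eta> n n) h \<and>
        (\<forall>m\<ge>1. tendsto_L1 (feller_measure \<theta>) (\<lambda>n. eta_trunc \<eta> n m) (g m)) \<and>
        tendsto_L1 (feller_measure \<theta>) g h \<and>
        0 < (\<integral>\<xi>. h \<xi> \<partial>feller_measure \<theta>)))"


section \<open>The Poisson--Dirichlet measure\<close>

definition point_count :: "(nat \<Rightarrow> 'w \<Rightarrow> 'a) \<Rightarrow> 'a set \<Rightarrow> 'w \<Rightarrow> ennreal" where
  "point_count X A \<omega> = emeasure (count_space UNIV) {k. X k \<omega> \<in> A}"

text \<open>The points \<open>X 0, X 1, \<dots>\<close> form a Poisson point process with intensity \<open>\<Lambda>\<close>: counts of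
  sets of finite intensity are Poisson distributed, and counts of disjoint sets are
  independent. As the points are enumerated by all natural numbers, this is only meant for
  intensities of infinite total mass.\<close>

definition poisson_points :: "'w measure \<Rightarrow> 'a measure \<Rightarrow> (nat \<Rightarrow> 'w \<Rightarrow> 'a) \<Rightarrow> bool" where
  "poisson_points M \<Lambda> X \<longleftrightarrow> prob_space M \<and> (\<forall>k. X k \<in> M \<rightarrow>\<^sub>M \<Lambda>) \<and>
     (\<forall>A\<in>sets \<Lambda>. emeasure \<Lambda> A < \<infinity> \<longrightarrow>
        (\<forall>j::nat. measure M {\<omega>\<in>space M. point_count X A \<omega> = of_nat j}
                  = measure \<Lambda> A ^ j / fact j * exp (- measure \<Lambda> A))) \<and>
     (\<forall>(I::nat set) A. finite I \<longrightarrow> (\<forall>i\<in>I. A i \<in> sets \<Lambda>) \<longrightarrow> disjoint_family_on A I \<longrightarrow>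
        prob_space.indep_vars M (\<lambda>_. borel) (\<lambda>i. point_count X (A i)) I)"

definition pd_intensity :: "real \<Rightarrow> real measure" where
  "pd_intensity \<theta> = density lborel (\<lambda>x. indicator {0<..} x * ennreal (\<theta> * exp (- x) / x))"

text \<open>\<open>(J\<^sub>1/S, J\<^sub>2/S, \<dots>)\<close>, with a dummy value on the null event that \<open>S\<close> diverges.\<close>

definition normalise :: "(nat \<Rightarrow> real) \<Rightarrow> ell1" where
  "normalise J = (if summable (\<lambda>k. \<bar>J k\<bar>) then Abs_ell1 (\<lambda>k. J k / (\<Sum>i. J i)) else 0)"

text \<open>\<open>Q\<close> is the law of the decreasing sequence \<open>J\<^sub>1 > J\<^sub>2 > \<dots>\<close> of points, realised on the canonical
  sequence space; sequences are indexed from \<open>0\<close>.\<close>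

definition poisson_dirichlet :: "real \<Rightarrow> ell1 measure \<Rightarrow> bool" where
  "poisson_dirichlet \<theta> \<mu> \<longleftrightarrow> (\<exists>Q :: (nat \<Rightarrow> real) measure.
     sets Q = sets (\<Pi>\<^sub>M k\<in>UNIV. borel) \<and>
     poisson_points Q (pd_intensity \<theta>) (\<lambda>k J. J k) \<and>
     (AE J in Q. \<forall>k. J (Suc k) < J k \<and> 0 < J k) \<and>
     \<mu> = distr Q borel normalise)"


section \<open>Longest parts and convergence in distribution\<close>

definition parts :: "(nat \<Rightarrow> nat) \<Rightarrow> nat multiset" where
  "parts \<alpha> = (\<Sum>i | \<alpha> i \<noteq> 0. replicate_mset (\<alpha> i) i)"

definition longest_part :: "(nat \<Rightarrow> nat) \<Rightarrow> nat \<Rightarrow> nat" where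
  "longest_part \<alpha> k =
     (let xs = rev (sorted_list_of_multiset (parts \<alpha>))
      in if 1 \<le> k \<and> k \<le> length xs then xs ! (k - 1) else 0)"

definition longest_parts :: "(nat \<Rightarrow> nat) \<Rightarrow> ell1" where
  "longest_parts \<alpha> = Abs_ell1 (\<lambda>k. real (longest_part \<alpha> (Suc k)))"

lemma ell1_nth_longest_parts: "ell1_nth (longest_parts \<alpha>) k = real (longest_part \<alpha> (Suc k))"
proof -
  have "summable (\<lambda>k. \<bar>real (longest_part \<alpha> (Suc k))\<bar>)"
    by (rule summable_finite[of "{..<length (sorted_list_of_multiset (parts \<alpha>))}"])
       (auto simp: longest_part_def Let_def)
  then show ?thesis
    by (simp add: longest_parts_def Abs_ell1_inverse)
qed

text \<open>Weak convergence of Borel measures on an arbitrary topological space; the library's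
  \<^const>\<open>weak_conv_m\<close> is restricted to the real line.\<close>

definition converges_weakly ::
    "(nat \<Rightarrow> 'a::topological_space measure) \<Rightarrow> 'a measure \<Rightarrow> bool" where
  "converges_weakly \<mu> \<nu> \<longleftrightarrow> (\<forall>f :: 'a \<Rightarrow> real. continuous_on UNIV f \<longrightarrow> bounded (range f) \<longrightarrow>
     (\<lambda>n. \<integral>x. f x \<partial>\<mu> n) \<longlonglongrightarrow> (\<integral>x. f x \<partial>\<nu>))"

end

theory Submission
  imports Defs
begin

text \<open>Let \<open>\<xi>\<close> be the Feller coupling and \<open>L\<^sub>n\<close> the sorted parts it produces. Changing the first \<open>K\<close>
  bits moves \<open>L\<^sub>n\<close> by \<open>O(K)\<close> in \<open>\<ell>\<^sup>1\<close>, so \<open>L\<^sub>n / n\<close> is asymptotically independent of every integrable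
  function of \<open>\<xi>\<close>, in particular of the limiting density; this reduces the claim to the Ewens measure.
  There, the points \<open>J\<^sub>k\<close> of the Poisson process are rounded to a grid of mesh \<open>\<epsilon>\<close> in such a way that the
  cell counts are exactly independent Poisson variables with means \<open>\<theta> e\<^sup>-\<^sup>\<epsilon>\<^sup>i / i\<close>, i.e. a mixture of
  Ewens partitions over their size; letting \<open>\<epsilon> \<rightarrow> 0\<close> gives the limit \<open>J / S\<close> for the mixture. Since
  appending bits to \<open>\<xi>\<close> moves \<open>L\<^sub>n\<close> by at most their number, the Ewens expectations vary slowly in \<open>n\<close>,
  and a Tauberian argument removes the mixture.\<close>


section \<open>Young diagrams and the distance of sorted partitions\<close>

text \<open>In conjugate coordinates the distance of two sorted partitions is the
  \<open>\<ell>\<close>1 distance of their column heights, and adding a part translates these by a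
  fixed vector. Adding a common part is therefore an isometry, and estimates on sorted parts become
  inductions over bits that never mention sorting. The obstacle is that the size under the Poisson
  counts does not concentrate: \<epsilon> times the size converges to the random total S, so the
  limit only controls averages of Ewens means over sizes of order 1/\<epsilon>. These averages are
  known for every \<epsilon>, and tilting the weights by exp (- k \<epsilon> n) merely changes
  \<epsilon>; this gives averages against any continuous function of exp (- \<epsilon> n). A bump
  selecting sizes in a window of small relative width around q/\<epsilon> keeps positive mass for
  some q, and nothing more about the law of S enters. The cell means are matched exactly so that,
  given its size, the rounded configuration is exactly an Ewens partition and no error has to be
  controlled as the size grows.\<close>

lemma le_nth_sorted_iff:
  fixes xs :: "nat list"
  assumes "sorted_wrt (\<ge>) xs"
  shows "k < length xs \<and> t \<le> xs ! k \<longleftrightarrow> k < length (filter (\<lambda>x. t \<le> x) xs)"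
  using assms
proof (induction xs arbitrary: k)
  case (Cons x xs)
  show ?case
  proof (cases "t \<le> x")
    case True
    then show ?thesis using Cons by (cases k) auto
  next
    case False
    then have "\<forall>y\<in>set (x # xs). \<not> t \<le> y" using Cons.prems by auto
    moreover from this have "filter (\<lambda>y. t \<le> y) (x # xs) = []" by (simp add: filter_empty_conv)
    ultimately show ?thesis by (metis length_0_conv not_less_zero nth_mem)
  qed
qed simp

text \<open>Column heights of the Young diagram, i.e. the conjugate partition. They depend
  additively on \<open>\<alpha>\<close>, which the sorted parts do not.\<close>

definition tail_count :: "(nat \<Rightarrow> nat) \<Rightarrow> nat \<Rightarrow> nat" where
  "tail_count \<alpha> t = (\<Sum>i | \<alpha> i \<noteq> 0 \<and> t \<le> i. \<alpha> i)"

text \<open>Row k reaches column t iff column t is higher than k; all later facts about sorted parts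
  pass through this adjunction. At t = 0 the default value 0 of missing parts would break
  it.\<close>

lemma le_longest_part_iff:
  assumes "finite {i. \<alpha> i \<noteq> 0}" "1 \<le> t"
  shows "t \<le> longest_part \<alpha> (Suc k) \<longleftrightarrow> k < tail_count \<alpha> t"
proof -
  define xs where "xs = rev (sorted_list_of_multiset (parts \<alpha>))"
  have m: "mset xs = parts \<alpha>" by (simp add: xs_def)
  have s: "sorted_wrt (\<ge>) xs" by (simp add: xs_def sorted_wrt_rev)
  have "length (filter (\<lambda>x. t \<le> x) xs) = size (filter_mset (\<lambda>x. t \<le> x) (parts \<alpha>))"
    by (metis m mset_filter size_mset)
  also have "filter_mset (\<lambda>x. t \<le> x) (parts \<alpha>) = (\<Sum>i | \<alpha> i \<noteq> 0. if t \<le> i then replicate_mset (\<alpha> i) i else {#})"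
    unfolding parts_def using assms(1)
    by (induction rule: finite_induct) (auto simp: multiset_eq_iff)
  also have "\<dots> = (\<Sum>i | \<alpha> i \<noteq> 0 \<and> t \<le> i. replicate_mset (\<alpha> i) i)"
    using assms(1) by (simp add: sum.If_cases Int_def)
  also have "size \<dots> = tail_count \<alpha> t"
    unfolding tail_count_def by (simp add: size_multiset_sum)
  finally have l: "length (filter (\<lambda>x. t \<le> x) xs) = tail_count \<alpha> t" .
  have "longest_part \<alpha> (Suc k) = (if k < length xs then xs ! k else 0)"
    by (auto simp: longest_part_def Let_def xs_def[symmetric])
  then show ?thesis
    using le_nth_sorted_iff[OF s, of k t] l assms(2) by auto
qed

lemma sum_of_bool_le_diff:
  fixes a b m :: nat
  assumes "a \<le> m" "b \<le> m"
  shows "(\<Sum>t=1..m. \<bar>of_bool (t \<le> a) - of_bool (t \<le> b) :: real\<bar>) = \<bar>real a - real b\<bar>"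
proof -
  have *: "(\<Sum>t=1..m. \<bar>of_bool (t \<le> a) - of_bool (t \<le> b) :: real\<bar>) = real b - real a"
    if "a \<le> b" "b \<le> m" for a b :: nat
  proof -
    have "(\<Sum>t=1..m. \<bar>of_bool (t \<le> a) - of_bool (t \<le> b) :: real\<bar>) = (\<Sum>t\<in>{Suc a..b}. 1)"
      using that by (intro sum.mono_neutral_cong_right) auto
    then show ?thesis using that by simp
  qed
  show ?thesis
  proof (cases "a \<le> b")
    case True then show ?thesis using *[of a b] assms by simp
  next
    case False then show ?thesis using *[of b a] assms by (simp add: abs_minus_commute)
  qed
qed

lemma support_le:
  assumes "\<forall>i>m. \<alpha> i = (0::nat)"
  shows "{i. \<alpha> i \<noteq> 0} \<subseteq> {..(m::nat)}"
proof
  fix i assume "i \<in> {i. \<alpha> i \<noteq> 0}"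
  then have "\<not> m < i" using assms by auto
  then show "i \<in> {..m}" by simp
qed

lemma tail_count_eq_sum:
  assumes "\<forall>i>m. \<alpha> i = 0"
  shows "tail_count \<alpha> t = (\<Sum>i=t..m. \<alpha> i)"
  unfolding tail_count_def
proof (intro sum.mono_neutral_left)
  show "{i. \<alpha> i \<noteq> 0 \<and> t \<le> i} \<subseteq> {t..m}" using support_le[OF assms] by auto
qed auto

lemma longest_part_le:
  assumes "\<forall>i>m. \<alpha> i = 0"
  shows "longest_part \<alpha> (Suc k) \<le> m"
proof (rule ccontr)
  assume "\<not> ?thesis"
  then have "Suc m \<le> longest_part \<alpha> (Suc k)" by simp
  moreover have "finite {i. \<alpha> i \<noteq> 0}"
    by (rule finite_subset[of _ "{..m}"]) (use support_le[OF assms] in auto)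
  ultimately have "k < tail_count \<alpha> (Suc m)" using le_longest_part_iff by simp
  then show False using tail_count_eq_sum[OF assms] by simp
qed

text \<open>Both sides count the boxes in the symmetric difference of the two Young diagrams.\<close>

lemma norm_longest_parts_diff:
  assumes "\<forall>i>m. \<alpha> i = 0" "\<forall>i>m. \<beta> i = 0"
  shows "norm (longest_parts \<alpha> - longest_parts \<beta>) =
    (\<Sum>t=1..m. \<bar>real (tail_count \<alpha> t) - real (tail_count \<beta> t)\<bar>)"
proof -
  have fin: "finite {i. \<alpha> i \<noteq> 0}" "finite {i. \<beta> i \<noteq> 0}"
    using finite_subset[OF support_le[OF assms(1)]] finite_subset[OF support_le[OF assms(2)]] by auto
  \<comment> \<open>Bounds the number of rows of both diagrams, so the series over \<open>k\<close>
    is a finite sum.\<close>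
  define M where "M = tail_count \<alpha> 1 + tail_count \<beta> 1"
  have le: "tail_count \<alpha> t \<le> M" "tail_count \<beta> t \<le> M" if "1 \<le> t" for t
  proof -
    have "(\<Sum>i=t..m. \<gamma> i) \<le> (\<Sum>i=1..m. \<gamma> i)" for \<gamma> :: "nat \<Rightarrow> nat"
      by (rule sum_mono2) (use that in auto)
    from this[of \<alpha>] this[of \<beta>] show "tail_count \<alpha> t \<le> M" "tail_count \<beta> t \<le> M"
      unfolding M_def tail_count_eq_sum[OF assms(1)] tail_count_eq_sum[OF assms(2)]
      by linarith+
  qed
  have lp: "t \<le> longest_part \<alpha> (Suc k) \<longleftrightarrow> Suc k \<le> tail_count \<alpha> t"
    "t \<le> longest_part \<beta> (Suc k) \<longleftrightarrow> Suc k \<le> tail_count \<beta> t" if "1 \<le> t" for t k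
    unfolding Suc_le_eq by (rule le_longest_part_iff[OF fin(1) that], rule le_longest_part_iff[OF fin(2) that])
  have z: "longest_part \<alpha> (Suc k) = 0" "longest_part \<beta> (Suc k) = 0" if "M \<le> k" for k
    using lp[of 1 k] le[of 1] that by auto
  have "norm (longest_parts \<alpha> - longest_parts \<beta>) =
      (\<Sum>k. \<bar>real (longest_part \<alpha> (Suc k)) - real (longest_part \<beta> (Suc k))\<bar>)"
    by (simp add: norm_ell1.rep_eq minus_ell1.rep_eq ell1_nth_longest_parts)
  also have "\<dots> = (\<Sum>k<M. \<bar>real (longest_part \<alpha> (Suc k)) - real (longest_part \<beta> (Suc k))\<bar>)"
    by (rule suminf_finite) (use z in auto)
  \<comment> \<open>Each row difference is split into single boxes, so that rows and columns can be
    exchanged.\<close>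
  also have "\<dots> = (\<Sum>k<M. \<Sum>t=1..m. \<bar>of_bool (Suc k \<le> tail_count \<alpha> t) - of_bool (Suc k \<le> tail_count \<beta> t)\<bar>)"
    by (subst sum_of_bool_le_diff[symmetric, of _ m])
       (auto intro!: longest_part_le assms sum.cong simp: lp)
  also have "\<dots> = (\<Sum>t=1..m. \<Sum>k<M. \<bar>of_bool (Suc k \<le> tail_count \<alpha> t) - of_bool (Suc k \<le> tail_count \<beta> t)\<bar>)"
    by (rule sum.swap)
  also have "\<dots> = (\<Sum>t=1..m. \<Sum>k=1..M. \<bar>of_bool (k \<le> tail_count \<alpha> t) - of_bool (k \<le> tail_count \<beta> t)\<bar>)"
    by (intro sum.cong refl sum.reindex_bij_witness[of _ "\<lambda>k. k - 1" Suc]) auto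
  also have "\<dots> = (\<Sum>t=1..m. \<bar>real (tail_count \<alpha> t) - real (tail_count \<beta> t)\<bar>)"
    by (intro sum.cong refl sum_of_bool_le_diff le) auto
  finally show ?thesis .
qed

lemma common_bound:
  assumes "finite {i. \<alpha> i \<noteq> (0::nat)}" "finite {i. \<beta> i \<noteq> (0::nat)}"
  obtains m where "\<forall>i>m. \<alpha> i = 0" "\<forall>i>m. \<beta> i = 0" "(r::nat) \<le> m" "(s::nat) \<le> m"
proof -
  have "finite ({i. \<alpha> i \<noteq> 0} \<union> {i. \<beta> i \<noteq> 0})" using assms by simp
  then obtain m where m: "\<forall>i\<in>{i. \<alpha> i \<noteq> 0} \<union> {i. \<beta> i \<noteq> 0}. i \<le> m"
    by (meson finite_nat_set_iff_bounded_le)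
  show thesis
  proof (rule that[of "m + r + s"])
    have "\<alpha> i = 0 \<and> \<beta> i = 0" if "m + r + s < i" for i
    proof -
      have "\<not> i \<le> m" using that by simp
      then show ?thesis using m by blast
    qed
    then show "\<forall>i>m + r + s. \<alpha> i = 0" "\<forall>i>m + r + s. \<beta> i = 0" by blast+
  qed auto
qed

section \<open>Distances under the addition of a part\<close>

definition add_part :: "nat \<Rightarrow> (nat \<Rightarrow> nat) \<Rightarrow> nat \<Rightarrow> nat" where
  "add_part r \<alpha> = \<alpha>(r := Suc (\<alpha> r))"

lemma tail_count_add_part:
  assumes "finite {i. \<alpha> i \<noteq> 0}"
  shows "tail_count (add_part r \<alpha>) t = tail_count \<alpha> t + of_bool (t \<le> r)"
proof -
  obtain m where m: "\<forall>i>m. \<alpha> i = 0" "r \<le> m"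
    using common_bound[OF assms assms] by metis
  then have m': "\<forall>i>m. add_part r \<alpha> i = 0"
    by (simp add: add_part_def)
  have a: "add_part r \<alpha> i = \<alpha> i + (if i = r then 1 else 0)" for i
    by (simp add: add_part_def)
  have "(\<Sum>i=t..m. if i = r then 1 else (0::nat)) = of_bool (t \<le> r)"
    using m(2) by (subst sum.delta) auto
  then show ?thesis
    unfolding tail_count_eq_sum[OF m(1)] tail_count_eq_sum[OF m'] by (simp add: a sum.distrib)
qed

text \<open>Both families of column heights are shifted by the same vector, so their difference is
  unchanged.\<close>

lemma dist_add_part:
  assumes "finite {i. \<alpha> i \<noteq> 0}" "finite {i. \<beta> i \<noteq> 0}"
  shows "dist (longest_parts (add_part r \<alpha>)) (longest_parts (add_part r \<beta>)) =
     dist (longest_parts \<alpha>) (longest_parts \<beta>)"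
proof -
  obtain m where m: "\<forall>i>m. \<alpha> i = 0" "\<forall>i>m. \<beta> i = 0" "r \<le> m"
    using common_bound[OF assms] by metis
  then have "\<forall>i>m. add_part r \<alpha> i = 0" "\<forall>i>m. add_part r \<beta> i = 0"
    by (auto simp: add_part_def)
  then show ?thesis
    unfolding dist_norm
    by (simp add: norm_longest_parts_diff[of m] m tail_count_add_part[OF assms(1)] tail_count_add_part[OF assms(2)])
qed

lemma dist_add_part_add_part:
  assumes "finite {i. \<alpha> i \<noteq> 0}"
  shows "dist (longest_parts (add_part r \<alpha>)) (longest_parts (add_part s \<alpha>)) = \<bar>real r - real s\<bar>"
proof -
  obtain m where m: "\<forall>i>m. \<alpha> i = 0" "r \<le> m" "s \<le> m"
    using common_bound[OF assms assms] by metis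
  then have "\<forall>i>m. add_part r \<alpha> i = 0" "\<forall>i>m. add_part s \<alpha> i = 0"
    by (auto simp: add_part_def)
  then show ?thesis
    unfolding dist_norm using m sum_of_bool_le_diff[of r m s]
    by (simp add: norm_longest_parts_diff[of m] tail_count_add_part[OF assms])
qed

lemma dist_add_part_self:
  assumes "finite {i. \<alpha> i \<noteq> 0}"
  shows "dist (longest_parts (add_part r \<alpha>)) (longest_parts \<alpha>) = r"
proof -
  obtain m where m: "\<forall>i>m. \<alpha> i = 0" "r \<le> m"
    using common_bound[OF assms assms] by metis
  then have "\<forall>i>m. add_part r \<alpha> i = 0"
    by (auto simp: add_part_def)
  then show ?thesis
    unfolding dist_norm using m sum_of_bool_le_diff[of r m 0]
    by (simp add: norm_longest_parts_diff[of m] tail_count_add_part[OF assms])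
qed

lemma longest_parts_zero: "longest_parts (\<lambda>_. 0) = 0"
  by (simp add: longest_parts_def zero_ell1_def longest_part_def parts_def)

text \<open>Identifies division by n with \<open>sgn\<close>: a normalisation that does not mention
  n, is scale invariant and is continuous away from 0.\<close>

lemma norm_longest_parts:
  assumes "\<alpha> \<in> partitions n"
  shows "norm (longest_parts \<alpha>) = real n"
proof -
  have a: "\<forall>i>n. \<alpha> i = 0" and n: "(\<Sum>i=1..n. i * \<alpha> i) = n"
    using assms by (auto simp: partitions_def)
  have "norm (longest_parts \<alpha>) = (\<Sum>t=1..n. \<bar>real (tail_count \<alpha> t) - real (tail_count (\<lambda>_. 0) t)\<bar>)"
    using norm_longest_parts_diff[OF a, of "\<lambda>_. 0"] by (simp add: longest_parts_zero)
  also have "\<dots> = (\<Sum>t=1..n. \<Sum>i=1..n. if t \<le> i then real (\<alpha> i) else 0)"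
  proof (intro sum.cong refl)
    fix t assume t: "t \<in> {1..n}"
    have "tail_count (\<lambda>_. 0) t = 0" by (simp add: tail_count_def)
    moreover have "(\<Sum>i=1..n. if t \<le> i then real (\<alpha> i) else 0) = (\<Sum>i=t..n. real (\<alpha> i))"
      using t by (intro sum.mono_neutral_cong_right) auto
    ultimately show "\<bar>real (tail_count \<alpha> t) - real (tail_count (\<lambda>_. 0) t)\<bar> = (\<Sum>i=1..n. if t \<le> i then real (\<alpha> i) else 0)"
      by (simp add: tail_count_eq_sum[OF a] sum_nonneg)
  qed
  also have "\<dots> = (\<Sum>i=1..n. \<Sum>t=1..n. if t \<le> i then real (\<alpha> i) else 0)" by (rule sum.swap)
  also have "\<dots> = (\<Sum>i=1..n. real (i * \<alpha> i))"
  proof (intro sum.cong refl)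
    fix i assume "i \<in> {1..n}"
    then have "(\<Sum>t=1..n. if t \<le> i then real (\<alpha> i) else 0) = (\<Sum>t=1..i. real (\<alpha> i))"
      by (intro sum.mono_neutral_cong_right) auto
    then show "(\<Sum>t=1..n. if t \<le> i then real (\<alpha> i) else 0) = real (i * \<alpha> i)" by simp
  qed
  also have "\<dots> = real n" using n by (metis of_nat_sum)
  finally show ?thesis .
qed


section \<open>Run lengths of binary strings\<close>

text \<open>The parts of the string \<open>\<xi>\<^sub>1, \<dots>, \<xi>\<^sub>n\<close> followed by \<open>r\<close> zeros and a final one. Peeling off the last
  bit only changes \<open>r\<close>, so that all properties can be proved by induction on \<open>n\<close>.\<close>

primrec runs :: "(nat \<Rightarrow> bool) \<Rightarrow> nat \<Rightarrow> nat \<Rightarrow> nat \<Rightarrow> nat" where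
  "runs \<xi> 0 r = (if r = 0 then (\<lambda>_. 0) else add_part r (\<lambda>_. 0))"
| "runs \<xi> (Suc n) r =
    (if \<xi> (Suc n) then add_part (Suc r) (runs \<xi> n 0) else runs \<xi> n (Suc r))"

lemma sum_times_add_part:
  assumes "r \<in> {1..n}"
  shows "(\<Sum>i=1..n. i * add_part r \<alpha> i) = (\<Sum>i=1..n. i * \<alpha> i) + r"
proof -
  have "(\<Sum>i=1..n. i * add_part r \<alpha> i) = (\<Sum>i=1..n. i * \<alpha> i + (if i = r then r else 0))"
    by (intro sum.cong) (auto simp: add_part_def)
  then show ?thesis using assms by (simp add: sum.distrib)
qed

lemma partitions_0: "partitions 0 = {\<lambda>_. 0}"
  by (auto simp: partitions_def)

lemma finite_support_partitions:
  assumes "\<alpha> \<in> partitions n" shows "finite {i. \<alpha> i \<noteq> 0}"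
proof (rule finite_subset)
  show "{i. \<alpha> i \<noteq> 0} \<subseteq> {1..n}" using assms by (auto simp: partitions_def)
qed simp

lemma partitions_sum_mono:
  assumes "\<alpha> \<in> partitions n" "n \<le> m" shows "(\<Sum>i=1..m. i * \<alpha> i) = n"
proof -
  have "(\<Sum>i=1..n. i * \<alpha> i) = (\<Sum>i=1..m. i * \<alpha> i)"
    using assms by (intro sum.mono_neutral_left) (auto simp: partitions_def)
  then show ?thesis using assms by (auto simp: partitions_def)
qed

lemma add_part_in_partitions:
  assumes "\<alpha> \<in> partitions n" "0 < r"
  shows "add_part r \<alpha> \<in> partitions (n + r)"
proof -
  have "(\<Sum>i=1..n+r. i * add_part r \<alpha> i) = n + r"
    using sum_times_add_part[of r "n + r" \<alpha>] partitions_sum_mono[OF assms(1), of "n + r"] assms(2)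
    by auto
  then show ?thesis using assms by (auto simp: partitions_def add_part_def)
qed

lemma runs_in_partitions: "runs \<xi> n r \<in> partitions (n + r)"
proof (induction n arbitrary: r)
  case 0
  have "(\<lambda>_. 0) \<in> partitions 0" by (simp add: partitions_0)
  then show ?case using add_part_in_partitions[of "\<lambda>_. 0" 0 r] by (cases "r = 0") auto
next
  case (Suc n)
  show ?case
    using add_part_in_partitions[OF Suc[of 0], of "Suc r"] Suc[of "Suc r"] by auto
qed

lemma finite_support_runs: "finite {i. runs \<xi> n r i \<noteq> 0}"
  using finite_support_partitions runs_in_partitions by blast

lemma finite_support_zero: "finite {i. (\<lambda>_. 0 :: nat) i \<noteq> 0}"
  by simp

lemma runs_cong:
  assumes "\<And>k. k \<in> {1..n} \<Longrightarrow> \<xi> k = \<xi>' k"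
  shows "runs \<xi> n r = runs \<xi>' n r"
  using assms by (induction n arbitrary: r) auto

text \<open>Trailing zeros only lengthen the one run still open at the end of the string, so at most
  one part differs.\<close>

lemma dist_runs_zeros:
  "dist (longest_parts (runs \<xi> n r)) (longest_parts (runs \<xi> n s)) \<le> \<bar>real r - real s\<bar>"
proof (induction n arbitrary: r s)
  case 0
  show ?case
    using dist_add_part_self[OF finite_support_zero, of r] dist_add_part_self[OF finite_support_zero, of s]
      dist_add_part_add_part[OF finite_support_zero, of r s]
    by (auto simp: dist_commute)
next
  case (Suc n)
  show ?case
    using dist_add_part_add_part[OF finite_support_runs, of "Suc r" \<xi> n 0 "Suc s"]
      Suc[of "Suc r" "Suc s"] by auto
qed

text \<open>If the last bit is a one, a part of size r + 1 splits off and costs r + 1; if it is a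
  zero, it is absorbed into r. Either way the total cost is d + r.\<close>

lemma dist_runs_append:
  "dist (longest_parts (runs \<xi> (n + d) r)) (longest_parts (runs \<xi> n 0)) \<le> real (d + r)"
proof (induction d arbitrary: r)
  case 0
  show ?case using dist_runs_zeros[of \<xi> n r 0] by simp
next
  case (Suc d)
  have "dist (longest_parts (add_part (Suc r) (runs \<xi> (n + d) 0))) (longest_parts (runs \<xi> n 0))
    \<le> Suc r + dist (longest_parts (runs \<xi> (n + d) 0)) (longest_parts (runs \<xi> n 0))"
    using dist_add_part_self[OF finite_support_runs, of "Suc r" \<xi> "n + d" 0] dist_triangle by metis
  then show ?case using Suc[of 0] Suc[of "Suc r"] by auto
qed

text \<open>Cost of deleting everything in front of the r zeros. If the last bit is a one, the part
  that splits off is cancelled by \<open>dist_add_part\<close> against the single part r + 1 on the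
  other side; correcting r + 1 to r costs one more.\<close>

lemma dist_runs_prefix:
  "dist (longest_parts (runs \<xi> n r)) (longest_parts (runs \<xi> 0 r)) \<le> 2 * real n"
proof (induction n arbitrary: r)
  case (Suc n)
  have z: "runs \<xi> 0 (Suc r) = add_part (Suc r) (runs \<xi> 0 0)" by simp
  have a: "dist (longest_parts (runs \<xi> 0 (Suc r))) (longest_parts (runs \<xi> 0 r)) \<le> 1"
    using dist_runs_zeros[of \<xi> 0 "Suc r" r] by simp
  have b: "dist (longest_parts (runs \<xi> (Suc n) r)) (longest_parts (runs \<xi> 0 (Suc r))) \<le> 2 * real n"
    using dist_add_part[OF finite_support_runs finite_support_runs, of "Suc r" \<xi> n 0 \<xi> 0 0]
      Suc[of 0] Suc[of "Suc r"] unfolding z by auto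
  show ?case
    using dist_triangle[of "longest_parts (runs \<xi> (Suc n) r)" "longest_parts (runs \<xi> 0 r)"
      "longest_parts (runs \<xi> 0 (Suc r))"] a b by simp
qed simp

text \<open>Bits beyond K act alike on both strings, by adding the same part or by increasing r, so
  the distance does not grow. At the base both prefixes are compared with the deleted one, at 2 K
  each.\<close>

lemma dist_runs_change_prefix:
  assumes "\<And>k. K < k \<Longrightarrow> \<xi> k = \<xi>' k"
  shows "dist (longest_parts (runs \<xi> (K + n) r)) (longest_parts (runs \<xi>' (K + n) r)) \<le> 4 * real K"
proof (induction n arbitrary: r)
  case 0
  have "runs \<xi> 0 r = runs \<xi>' 0 r" by simp
  then show ?case
    using dist_triangle2[of "longest_parts (runs \<xi> K r)" "longest_parts (runs \<xi>' K r)"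
      "longest_parts (runs \<xi> 0 r)"] dist_runs_prefix[of \<xi> K r] dist_runs_prefix[of \<xi>' K r]
    by simp
next
  case (Suc n)
  have "\<xi> (Suc (K + n)) = \<xi>' (Suc (K + n))" by (rule assms) simp
  then show ?case
    using dist_add_part[OF finite_support_runs finite_support_runs, of "Suc r" \<xi> "K + n" 0 \<xi>' "K + n" 0]
      Suc[of 0] Suc[of "Suc r"] by auto
qed

text \<open>The sum counts gaps between consecutive ones, the last term the gap closed by the one
  appended after r zeros. Without a leading one, \<open>runs\<close> would also count the initial
  zeros as a part, which the formula does not see.\<close>

lemma runs_eq:
  assumes "\<xi> 1" "n = 0 \<Longrightarrow> r = 0" "0 < i"
  shows "runs \<xi> n r i =
    (\<Sum>j=1..n-i. of_bool (\<xi> j) * (\<Prod>k=j+1..j+i-1. of_bool (\<not> \<xi> k)) * of_bool (\<xi> (i + j)))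
    + (if r < i \<and> i \<le> n + r then of_bool (\<xi> (n + r + 1 - i)) * (\<Prod>k=n+r+2-i..n. of_bool (\<not> \<xi> k)) else 0)"
  using assms(2)
proof (induction n arbitrary: r)
  case 0
  then show ?case using assms(3) by simp
next
  case (Suc n)
  define S where "S n = (\<Sum>j=1..n-i. of_bool (\<xi> j) * (\<Prod>k=j+1..j+i-1. of_bool (\<not> \<xi> k)) * (of_bool (\<xi> (i + j)) :: nat))" for n
  define L where "L n r = (if r < i \<and> i \<le> n + r then of_bool (\<xi> (n + r + 1 - i)) * (\<Prod>k=n+r+2-i..n. of_bool (\<not> \<xi> k)) else (0::nat))" for n r
  have IH: "runs \<xi> n r i = S n + L n r" if "n = 0 \<Longrightarrow> r = 0" for r
    unfolding S_def L_def by (rule Suc.IH) (rule that)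
  \<comment> \<open>A one at position n + 1 turns the final gap of the shorter string into an
    interior gap.\<close>
  have S_Suc: "S (Suc n) = S n + (if \<xi> (Suc n) then L n 0 else 0)"
  proof (cases "i \<le> n")
    case True
    then have e: "Suc n - i = Suc (n - i)" "Suc (n - i) + i - 1 = n" "i + Suc (n - i) = Suc n"
      "n + 0 + 1 - i = Suc (n - i)" "n + 0 + 2 - i = Suc (n - i) + 1"
      "Suc (Suc n) - i = Suc (Suc (n - i))" by auto
    show ?thesis
      unfolding S_def L_def e(1) sum.nat_ivl_Suc'
      using True assms(3) by (subst sum.nat_ivl_Suc') (auto simp: e)
  next
    case False
    then show ?thesis using assms(3) by (auto simp: S_def L_def)
  qed
  show ?case
  proof (cases "\<xi> (Suc n)")
    case True
    have "L (Suc n) r = of_bool (i = Suc r)"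
    proof (cases "i = Suc r")
      case False
      then have "(\<Prod>k=Suc n+r+2-i..Suc n. of_bool (\<not> \<xi> k)) = (0::nat)" if "r < i"
        using that True by (intro prod_zero) (auto intro!: bexI[of _ "Suc n"])
      then show ?thesis using False by (auto simp: L_def)
    qed (use True in \<open>simp add: L_def\<close>)
    then show ?thesis
      using IH[of 0] True S_Suc unfolding S_def[symmetric] L_def[symmetric] by (auto simp: add_part_def)
  next
    case False
    then have "n \<noteq> 0" using assms(1) by (cases n) auto
    have "L (Suc n) r = L n (Suc r)"
    proof (cases "r < i \<and> i \<noteq> Suc r \<and> i \<le> Suc n + r")
      case True
      have "{Suc n + r + 2 - i..Suc n} = insert (Suc n) {n + Suc r + 2 - i..n}" using True by auto
      then show ?thesis using True False by (auto simp: L_def)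
    next
      case outside: False
      then show ?thesis using False by (auto simp: L_def)
    qed
    then show ?thesis
      using IH[of "Suc r"] False S_Suc \<open>n \<noteq> 0\<close> unfolding S_def[symmetric] L_def[symmetric] by simp
  qed
qed

lemma feller_count_eq_runs:
  assumes "\<xi> 1"
  shows "feller_count n \<xi> = runs \<xi> n 0"
proof
  fix i
  show "feller_count n \<xi> i = runs \<xi> n 0 i"
  proof (cases "i \<in> {1..n}")
    case True
    then have e: "Suc n - i = Suc (n - i)" "Suc (Suc n) - i = Suc (Suc (n - i))" by auto
    show ?thesis
      using True by (subst runs_eq[where \<xi> = \<xi>, OF assms]) (use True e in \<open>simp_all add: feller_count_def\<close>)
  next
    case False
    then show ?thesis
      using runs_in_partitions[of \<xi> n 0] by (auto simp: feller_count_def partitions_def)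
  qed
qed


section \<open>The Ewens sampling formula for the Feller coupling\<close>

lemma ewens_weight_mono:
  assumes "\<alpha> \<in> partitions n" "n \<le> m"
  shows "ewens_weight \<theta> m \<alpha> = ewens_weight \<theta> n \<alpha>"
  unfolding ewens_weight_def
  by (rule prod.mono_neutral_right) (use assms in \<open>auto simp: partitions_def\<close>)

text \<open>The size-biasing relation of the Ewens weights, written as a product. It is what makes
  the contribution of a closing one match in the induction for the sampling formula.\<close>

lemma ewens_weight_add_part:
  assumes "\<beta> \<in> partitions n" "0 < r"
  shows "ewens_weight \<theta> (n + r) (add_part r \<beta>) * (real r * real (add_part r \<beta> r)) = \<theta> * ewens_weight \<theta> n \<beta>"
proof -
  let ?w = "\<lambda>\<gamma> i. \<theta> ^ \<gamma> i / (real i ^ \<gamma> i * fact (\<gamma> i))"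
  have r: "r \<in> {1..n + r}" using assms(2) by auto
  have P: "(\<Prod>i\<in>{1..n + r} - {r}. ?w (add_part r \<beta>) i) = (\<Prod>i\<in>{1..n + r} - {r}. ?w \<beta> i)"
    by (intro prod.cong) (auto simp: add_part_def)
  have Q: "?w (add_part r \<beta>) r * (real r * real (add_part r \<beta> r)) = \<theta> * ?w \<beta> r"
    using assms(2) by (simp add: add_part_def divide_simps)
  have K: "a * p * q = t * (b * p)" if "a * q = t * b" for a b p q t :: real
    using that by (metis mult.assoc mult.commute)
  have R: "ewens_weight \<theta> (n + r) \<gamma> = ?w \<gamma> r * (\<Prod>i\<in>{1..n + r} - {r}. ?w \<gamma> i)" for \<gamma>
    unfolding ewens_weight_def by (rule prod.remove) (use r in auto)
  have "ewens_weight \<theta> (n + r) (add_part r \<beta>) * (real r * real (add_part r \<beta> r))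
      = \<theta> * ewens_weight \<theta> (n + r) \<beta>"
    unfolding R[of \<beta>] R[of "add_part r \<beta>"] P by (rule K[OF Q])
  then show ?thesis using ewens_weight_mono[OF assms(1), of "n + r" \<theta>] by simp
qed

lemma partitions_remove_part:
  assumes "\<alpha> \<in> partitions (n + r)" "\<alpha> r \<noteq> 0"
  obtains \<beta> where "\<beta> \<in> partitions n" "\<alpha> = add_part r \<beta>"
proof -
  define \<beta> where "\<beta> = \<alpha>(r := \<alpha> r - 1)"
  have r: "r \<in> {1..n + r}" using assms by (auto simp: partitions_def)
  have e: "\<alpha> = add_part r \<beta>" using assms(2) by (auto simp: add_part_def \<beta>_def)
  have s: "(\<Sum>i=1..n + r. i * \<beta> i) = n"
    using sum_times_add_part[OF r, of \<beta>] e assms(1) by (auto simp: partitions_def)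
  have z: "\<beta> i = 0" if "i \<notin> {1..n}" for i
  proof (cases "i \<in> {1..n + r}")
    case True
    have "i * \<beta> i \<le> (\<Sum>i=1..n + r. i * \<beta> i)" using True by (intro member_le_sum) auto
    then have "i * \<beta> i \<le> n" using s by simp
    moreover have "n < i" using True that by auto
    ultimately show ?thesis by (cases "\<beta> i") auto
  next
    case False
    then show ?thesis using assms(1) by (auto simp: partitions_def \<beta>_def)
  qed
  have "(\<Sum>i=1..n. i * \<beta> i) = (\<Sum>i=1..n + r. i * \<beta> i)"
    by (intro sum.mono_neutral_left) (use z in auto)
  then have "\<beta> \<in> partitions n" using s z by (auto simp: partitions_def)
  with e that show thesis by blast
qed

lemma partitions_sum_real: "\<alpha> \<in> partitions n \<Longrightarrow> (\<Sum>j=Suc 0..n. real (j * \<alpha> j)) = real n"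
  unfolding of_nat_sum[symmetric] by (simp add: partitions_def)

lemma inj_add_part: "add_part r \<alpha> = add_part r \<beta> \<longleftrightarrow> \<alpha> = \<beta>"
proof
  assume "add_part r \<alpha> = add_part r \<beta>"
  then have "add_part r \<alpha> i = add_part r \<beta> i" for i by simp
  then show "\<alpha> = \<beta>" by (force simp: add_part_def fun_eq_iff split: if_splits)
qed simp

section \<open>Functions of finitely many independent bits\<close>

abbreviation feller_component :: "real \<Rightarrow> nat \<Rightarrow> bool measure" where
  "feller_component \<theta> i \<equiv> measure_pmf (bernoulli_pmf (\<theta> / (\<theta> + real i - 1)))"

interpretation feller: product_prob_space "feller_component \<theta>" "{1..}" for \<theta>
  by unfold_locales

lemma prob_space_feller_measure: "prob_space (feller_measure \<theta>)"
  unfolding feller_measure_def by (rule prob_space_PiM) (rule measure_pmf.prob_space_axioms)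

lemma indep_vars_feller:
  "prob_space.indep_vars (feller_measure \<theta>) (feller_component \<theta>) (\<lambda>i \<xi>. \<xi> i) {1..}"
proof -
  interpret prob_space "feller_measure \<theta>" by (rule prob_space_feller_measure)
  have rv: "random_variable (feller_component \<theta> i) (\<lambda>\<xi>. \<xi> i)" if "i \<in> {1..}" for i
    using that unfolding feller_measure_def by (rule measurable_component_singleton)
  have "distr (feller_measure \<theta>) (\<Pi>\<^sub>M i\<in>{1..}. feller_component \<theta> i) (\<lambda>\<xi>. \<lambda>i\<in>{1..}. \<xi> i) =
      distr (feller_measure \<theta>) (feller_measure \<theta>) (\<lambda>\<xi>. \<xi>)"
    by (intro distr_cong) (auto simp: feller_measure_def space_PiM)
  also have "\<dots> = (\<Pi>\<^sub>M i\<in>{1..}. distr (feller_measure \<theta>) (feller_component \<theta> i) (\<lambda>\<xi>. \<xi> i))"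
    unfolding feller_measure_def
    by (subst distr_id, intro PiM_cong refl) (rule feller.PiM_component[symmetric])
  finally show ?thesis
    by (subst indep_vars_iff_distr_eq_PiM'[OF _ rv]) auto
qed

lemma sets_PiM_feller_component:
  assumes "finite A"
  shows "sets (\<Pi>\<^sub>M i\<in>A. feller_component \<theta> i) = sets (count_space (\<Pi>\<^sub>E i\<in>A. UNIV))"
proof -
  have "sets (\<Pi>\<^sub>M i\<in>A. feller_component \<theta> i) = sets (\<Pi>\<^sub>M i\<in>A. count_space (UNIV :: bool set))"
    by (intro sets_PiM_cong) auto
  also have "(\<Pi>\<^sub>M i\<in>A. count_space (UNIV :: bool set)) = count_space (\<Pi>\<^sub>E i\<in>A. UNIV)"
    using assms by (intro count_space_PiM_finite) auto
  finally show ?thesis .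
qed

text \<open>A pointwise substitute for measurability: on finitely many bits the product
  sigma-algebra is discrete, so such real functions are measurable, bounded and integrable.\<close>

definition depends_on :: "nat set \<Rightarrow> ((nat \<Rightarrow> bool) \<Rightarrow> 'a) \<Rightarrow> bool" where
  "depends_on A f \<longleftrightarrow> (\<forall>\<xi> \<xi>'. (\<forall>k\<in>A. \<xi> k = \<xi>' k) \<longrightarrow> f \<xi> = f \<xi>')"

lemma depends_on_restrict: "depends_on A f \<Longrightarrow> f (restrict \<xi> A) = f \<xi>"
  by (auto simp: depends_on_def)

lemma depends_on_mult:
  assumes "depends_on A f" "depends_on B g"
  shows "depends_on (A \<union> B) (\<lambda>\<xi>. f \<xi> * (g \<xi> :: real))"
  unfolding depends_on_def
proof (intro allI impI)
  fix \<xi> \<xi>' :: "nat \<Rightarrow> bool" assume "\<forall>k\<in>A \<union> B. \<xi> k = \<xi>' k"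
  then have "f \<xi> = f \<xi>'" "g \<xi> = g \<xi>'"
    using assms unfolding depends_on_def by blast+
  then show "f \<xi> * g \<xi> = f \<xi>' * g \<xi>'" by simp
qed

lemma measurable_PiM_feller_component:
  "finite A \<Longrightarrow> (f :: _ \<Rightarrow> real) \<in> borel_measurable (\<Pi>\<^sub>M i\<in>A. feller_component \<theta> i)"
  by (subst measurable_cong_sets[OF sets_PiM_feller_component refl]) auto

lemma measurable_depends_on:
  assumes "finite A" "A \<subseteq> {1..}" "depends_on A (f :: _ \<Rightarrow> real)"
  shows "f \<in> borel_measurable (feller_measure \<theta>)"
proof -
  have "(\<lambda>\<xi>. restrict \<xi> A) \<in> feller_measure \<theta> \<rightarrow>\<^sub>M (\<Pi>\<^sub>M i\<in>A. feller_component \<theta> i)"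
    unfolding feller_measure_def using assms(2) by (rule measurable_restrict_subset)
  from measurable_compose[OF this measurable_PiM_feller_component[OF assms(1), of f]]
  show ?thesis by (simp add: depends_on_restrict[OF assms(3)])
qed

lemma integrable_depends_on:
  assumes "finite A" "A \<subseteq> {1..}" "depends_on A (f :: _ \<Rightarrow> real)"
  shows "integrable (feller_measure \<theta>) f"
proof -
  interpret prob_space "feller_measure \<theta>" by (rule prob_space_feller_measure)
  have "finite (f ` (\<Pi>\<^sub>E i\<in>A. UNIV))" using assms(1) by (intro finite_imageI finite_PiE) auto
  then obtain C where C: "\<And>x. x \<in> f ` (\<Pi>\<^sub>E i\<in>A. UNIV) \<Longrightarrow> norm x \<le> C"
    using finite_imp_bounded bounded_iff by metis
  have "norm (f (restrict \<xi> A)) \<le> C" for \<xi> by (intro C imageI) auto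
  then have "norm (f \<xi>) \<le> C" for \<xi> by (simp only: depends_on_restrict[OF assms(3)])
  then show ?thesis
    by (intro integrable_const_bound[where B=C] measurable_depends_on[OF assms]) auto
qed

lemma integral_mult_depends_on:
  assumes A: "finite A" "A \<subseteq> {1..}" "depends_on A (f :: _ \<Rightarrow> real)"
    and B: "finite B" "B \<subseteq> {1..}" "depends_on B (g :: _ \<Rightarrow> real)"
    and "A \<inter> B = {}"
  shows "(\<integral>\<xi>. f \<xi> * g \<xi> \<partial>feller_measure \<theta>) = (\<integral>\<xi>. f \<xi> \<partial>feller_measure \<theta>) * (\<integral>\<xi>. g \<xi> \<partial>feller_measure \<theta>)"
proof -
  interpret prob_space "feller_measure \<theta>" by (rule prob_space_feller_measure)
  have "indep_var borel (f \<circ> (\<lambda>\<xi>. restrict (\<lambda>i. \<xi> i) A)) borel (g \<circ> (\<lambda>\<xi>. restrict (\<lambda>i. \<xi> i) B))"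
    by (intro indep_var_compose[OF indep_var_restrict[OF indep_vars_feller assms(7) A(2) B(2)]]
        measurable_PiM_feller_component A B)
  then have "indep_var borel f borel g"
    by (simp add: o_def depends_on_restrict[OF A(3)] depends_on_restrict[OF B(3)])
  then show ?thesis
    by (intro indep_var_lebesgue_integral integrable_depends_on[OF A] integrable_depends_on[OF B])
qed

lemma integral_feller_bit:
  fixes f :: "bool \<Rightarrow> real"
  assumes "0 < \<theta>" "1 \<le> i"
  shows "(\<integral>\<xi>. f (\<xi> i) \<partial>feller_measure \<theta>) =
     f True * (\<theta> / (\<theta> + real i - 1)) + f False * ((real i - 1) / (\<theta> + real i - 1))"
proof -
  have d: "\<theta> + real i - 1 \<noteq> 0" and p: "0 \<le> \<theta> / (\<theta> + real i - 1)" "\<theta> / (\<theta> + real i - 1) \<le> 1"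
    using assms by (auto simp: divide_simps)
  have "(\<integral>b. f b \<partial>distr (feller_measure \<theta>) (feller_component \<theta> i) (\<lambda>\<xi>. \<xi> i)) = (\<integral>\<xi>. f (\<xi> i) \<partial>feller_measure \<theta>)"
    unfolding feller_measure_def
    by (rule integral_distr[OF measurable_component_singleton]) (use assms in auto)
  moreover have "distr (feller_measure \<theta>) (feller_component \<theta> i) (\<lambda>\<xi>. \<xi> i) = feller_component \<theta> i"
    unfolding feller_measure_def using assms by (intro feller.PiM_component) auto
  ultimately have "(\<integral>\<xi>. f (\<xi> i) \<partial>feller_measure \<theta>) = (\<integral>b. f b \<partial>feller_component \<theta> i)" by simp
  also have "\<dots> = f True * (\<theta> / (\<theta> + real i - 1)) + f False * (1 - \<theta> / (\<theta> + real i - 1))"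
    using p by (subst integral_measure_pmf[of UNIV]) (auto simp: UNIV_bool algebra_simps)
  also have "1 - \<theta> / (\<theta> + real i - 1) = (real i - 1) / (\<theta> + real i - 1)"
    using d by (simp add: field_simps)
  finally show ?thesis .
qed

lemma AE_feller_first: "0 < \<theta> \<Longrightarrow> AE \<xi> in feller_measure \<theta>. \<xi> 1"
  unfolding feller_measure_def
  by (rule feller.AE_component[where P = "\<lambda>b. b"]) (auto simp: AE_measure_pmf_iff set_pmf_iff intro: ccontr)

lemma depends_on_runs: "depends_on {1..n} (\<lambda>\<xi>. f (runs \<xi> n r))"
  unfolding depends_on_def by (metis runs_cong)

text \<open>For \<open>r = 0\<close> this is the Ewens sampling formula; the general \<open>r\<close> makes the induction work.\<close>

lemma feller_runs_law:
  assumes "0 < \<theta>" "\<alpha> \<in> partitions (Suc n + r)"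
  shows "(\<integral>\<xi>. of_bool (runs \<xi> (Suc n) r = \<alpha>) \<partial>feller_measure \<theta>) =
    fact n / pochhammer \<theta> (Suc n) * ewens_weight \<theta> (Suc n + r) \<alpha> * (\<Sum>j=Suc r..Suc n + r. real (j * \<alpha> j))"
  using assms(2)
proof (induction n arbitrary: r \<alpha>)
  case 0
  interpret prob_space "feller_measure \<theta>" by (rule prob_space_feller_measure)
  \<comment> \<open>The first bit is almost surely a one, so a single bit followed by r zeros yields
    just the part r + 1.\<close>
  have "AE \<xi> in feller_measure \<theta>. of_bool (runs \<xi> (Suc 0) r = \<alpha>) = (of_bool (\<alpha> = add_part (Suc r) (\<lambda>_. 0)) :: real)"
    using AE_feller_first[OF assms(1)] by eventually_elim auto
  then have "(\<integral>\<xi>. of_bool (runs \<xi> (Suc 0) r = \<alpha>) \<partial>feller_measure \<theta>) =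
      (\<integral>\<xi>. (of_bool (\<alpha> = add_part (Suc r) (\<lambda>_. 0)) :: real) \<partial>feller_measure \<theta>)"
    by (intro integral_cong_AE measurable_depends_on[OF _ _ depends_on_runs[of "Suc 0" _ r]]) auto
  also have "\<dots> = of_bool (\<alpha> = add_part (Suc r) (\<lambda>_. 0))" by (simp add: prob_space)
  also have "\<dots> = 1 / \<theta> * (ewens_weight \<theta> (Suc r) \<alpha> * (real (Suc r) * real (\<alpha> (Suc r))))"
  proof (cases "\<alpha> (Suc r) = 0")
    case True
    then show ?thesis by (auto simp: add_part_def)
  next
    case False
    then obtain \<beta> where \<beta>: "\<beta> \<in> partitions 0" "\<alpha> = add_part (Suc r) \<beta>"
      using partitions_remove_part[of \<alpha> 0 "Suc r"] "0.prems" by auto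
    then show ?thesis
      using ewens_weight_add_part[OF \<beta>(1), of "Suc r" \<theta>] assms(1) by (simp add: partitions_0 ewens_weight_def)
  qed
  finally show ?case by (simp add: algebra_simps)
next
  case (Suc n)
  define N where "N = Suc n"
  have \<alpha>: "\<alpha> \<in> partitions (N + Suc r)" using Suc.prems by (simp add: N_def)
  let ?E = "\<lambda>f. \<integral>\<xi>. (f \<xi> :: real) \<partial>feller_measure \<theta>"
  let ?p = "fact n / pochhammer \<theta> N"
  have gen: "\<theta> / (\<theta> + N) * (p * N / \<theta> * (w * x)) + N / (\<theta> + N) * (p * w * y) = (p * N / (\<theta> + N)) * w * (x + y)"
    for p w x y :: real
  proof -
    have "\<theta> / (\<theta> + N) * (p * N / \<theta> * (w * x)) = p * N / (\<theta> + N) * w * x"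
      using assms(1) by simp
    then show ?thesis by (simp add: distrib_left)
  qed
  have bit: "depends_on {Suc N} (\<lambda>\<xi>. of_bool (\<xi> (Suc N)) :: real)" "depends_on {Suc N} (\<lambda>\<xi>. of_bool (\<not> \<xi> (Suc N)) :: real)"
    by (auto simp: depends_on_def)
  have cnt: "depends_on {1..N} (\<lambda>\<xi>. of_bool (add_part (Suc r) (runs \<xi> N 0) = \<alpha>) :: real)"
    "depends_on {1..N} (\<lambda>\<xi>. of_bool (runs \<xi> N (Suc r) = \<alpha>) :: real)"
    by (rule depends_on_runs)+
  have int: "integrable (feller_measure \<theta>) (\<lambda>\<xi>. of_bool (\<xi> (Suc N)) * of_bool (add_part (Suc r) (runs \<xi> N 0) = \<alpha>) :: real)"
    "integrable (feller_measure \<theta>) (\<lambda>\<xi>. of_bool (\<not> \<xi> (Suc N)) * of_bool (runs \<xi> N (Suc r) = \<alpha>) :: real)"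
    using integrable_depends_on[OF _ _ depends_on_mult[OF bit(1) cnt(1)]]
      integrable_depends_on[OF _ _ depends_on_mult[OF bit(2) cnt(2)]] by auto
  \<comment> \<open>Conditioning on the last bit: a one closes a part of size r + 1 and resets r to
    0, a zero increases r.\<close>
  have "?E (\<lambda>\<xi>. of_bool (runs \<xi> (Suc N) r = \<alpha>)) =
      ?E (\<lambda>\<xi>. of_bool (\<xi> (Suc N)) * of_bool (add_part (Suc r) (runs \<xi> N 0) = \<alpha>) +
        of_bool (\<not> \<xi> (Suc N)) * of_bool (runs \<xi> N (Suc r) = \<alpha>))"
    by (intro Bochner_Integration.integral_cong) auto
  also have "\<dots> = ?E (\<lambda>\<xi>. of_bool (\<xi> (Suc N))) * ?E (\<lambda>\<xi>. of_bool (add_part (Suc r) (runs \<xi> N 0) = \<alpha>)) +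
      ?E (\<lambda>\<xi>. of_bool (\<not> \<xi> (Suc N))) * ?E (\<lambda>\<xi>. of_bool (runs \<xi> N (Suc r) = \<alpha>))"
    using int by (simp add: integral_mult_depends_on[OF _ _ bit(1) _ _ cnt(1)]
        integral_mult_depends_on[OF _ _ bit(2) _ _ cnt(2)])
  also have "?E (\<lambda>\<xi>. of_bool (runs \<xi> N (Suc r) = \<alpha>)) =
      ?p * ewens_weight \<theta> (N + Suc r) \<alpha> * (\<Sum>j=Suc (Suc r)..N + Suc r. real (j * \<alpha> j))"
    unfolding N_def by (rule Suc.IH) (use \<alpha> in \<open>simp add: N_def\<close>)
  also have "?E (\<lambda>\<xi>. of_bool (\<xi> (Suc N))) = \<theta> / (\<theta> + N)"
    using integral_feller_bit[OF assms(1), of "Suc N" of_bool] by simp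
  also have "?E (\<lambda>\<xi>. of_bool (\<not> \<xi> (Suc N))) = N / (\<theta> + N)"
    using integral_feller_bit[OF assms(1), of "Suc N" "\<lambda>b. of_bool (\<not> b)"] by simp
  also have "?E (\<lambda>\<xi>. of_bool (add_part (Suc r) (runs \<xi> N 0) = \<alpha>)) =
      ?p * N / \<theta> * (ewens_weight \<theta> (N + Suc r) \<alpha> * real (Suc r * \<alpha> (Suc r)))"
  proof (cases "\<alpha> (Suc r) = 0")
    case True
    then have "add_part (Suc r) (runs \<xi> N 0) \<noteq> \<alpha>" for \<xi> by (auto simp: add_part_def)
    then show ?thesis using True by simp
  next
    case False
    obtain \<beta> where \<beta>: "\<beta> \<in> partitions N" "\<alpha> = add_part (Suc r) \<beta>"
      using partitions_remove_part[OF \<alpha> False] by blast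
    have "?E (\<lambda>\<xi>. of_bool (runs \<xi> N 0 = \<beta>)) =
        ?p * ewens_weight \<theta> (N + 0) \<beta> * (\<Sum>j=Suc 0..N + 0. real (j * \<beta> j))"
      unfolding N_def by (rule Suc.IH) (use \<beta> in \<open>simp add: N_def\<close>)
    \<comment> \<open>With r = 0 the sum in the induction hypothesis is the whole size N. This
      supplies the factor N which the zero branch gets from the probability N / (\<theta> +
      N).\<close>
    also have "(\<Sum>j=Suc 0..N + 0. real (j * \<beta> j)) = N"
      using partitions_sum_real[OF \<beta>(1)] by simp
    finally show ?thesis
      using ewens_weight_add_part[OF \<beta>(1), of "Suc r" \<theta>] assms(1)
      by (simp add: \<beta>(2) inj_add_part field_simps)
  qed
  also have "\<theta> / (\<theta> + N) * (?p * N / \<theta> * (ewens_weight \<theta> (N + Suc r) \<alpha> * real (Suc r * \<alpha> (Suc r)))) +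
      N / (\<theta> + N) * (?p * ewens_weight \<theta> (N + Suc r) \<alpha> * (\<Sum>j=Suc (Suc r)..N + Suc r. real (j * \<alpha> j))) =
      (?p * N / (\<theta> + N)) * ewens_weight \<theta> (N + Suc r) \<alpha> *
       (real (Suc r * \<alpha> (Suc r)) + (\<Sum>j=Suc (Suc r)..N + Suc r. real (j * \<alpha> j)))"
    by (rule gen)
  \<comment> \<open>The branch of a one gives the term j = r + 1, the branch of a zero all larger
    j.\<close>
  also have "real (Suc r * \<alpha> (Suc r)) + (\<Sum>j=Suc (Suc r)..N + Suc r. real (j * \<alpha> j)) =
      (\<Sum>j=Suc r..N + Suc r. real (j * \<alpha> j))"
    by (subst (2) sum.atLeast_Suc_atMost) auto
  also have "?p * N / (\<theta> + N) = fact (Suc n) / pochhammer \<theta> (Suc N)"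
    by (simp add: N_def pochhammer_rec' mult_ac)
  finally show ?case by (simp add: N_def)
qed

lemma integral_runs:
  fixes g :: "(nat \<Rightarrow> nat) \<Rightarrow> real"
  assumes "0 < \<theta>" "1 \<le> n"
  shows "(\<integral>\<xi>. g (runs \<xi> n 0) \<partial>feller_measure \<theta>) =
    fact n / pochhammer \<theta> n * (\<Sum>\<alpha>\<in>partitions n. g \<alpha> * ewens_weight \<theta> n \<alpha>)"
proof -
  obtain m where n: "n = Suc m" using assms(2) by (cases n) auto
  have "(\<integral>\<xi>. g (runs \<xi> n 0) \<partial>feller_measure \<theta>) =
      (\<integral>\<xi>. (\<Sum>\<alpha>\<in>partitions n. g \<alpha> * of_bool (runs \<xi> n 0 = \<alpha>)) \<partial>feller_measure \<theta>)"
  proof (intro Bochner_Integration.integral_cong refl)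
    fix \<xi>
    have "(\<Sum>\<alpha>\<in>partitions n. g \<alpha> * of_bool (runs \<xi> n 0 = \<alpha>)) =
        (\<Sum>\<alpha>\<in>partitions n. if runs \<xi> n 0 = \<alpha> then g \<alpha> else 0)"
      by (intro sum.cong) auto
    then show "g (runs \<xi> n 0) = (\<Sum>\<alpha>\<in>partitions n. g \<alpha> * of_bool (runs \<xi> n 0 = \<alpha>))"
      using runs_in_partitions[of \<xi> n 0] finite_partitions by simp
  qed
  also have "\<dots> = (\<Sum>\<alpha>\<in>partitions n. g \<alpha> * (\<integral>\<xi>. of_bool (runs \<xi> n 0 = \<alpha>) \<partial>feller_measure \<theta>))"
    by (subst Bochner_Integration.integral_sum)
       (auto intro!: integrable_mult_right integrable_depends_on[OF _ _ depends_on_runs[of n _ 0]])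
  also have "\<dots> = (\<Sum>\<alpha>\<in>partitions n. g \<alpha> * (fact n / pochhammer \<theta> n * ewens_weight \<theta> n \<alpha>))"
  proof (intro sum.cong refl)
    fix \<alpha> assume \<alpha>: "\<alpha> \<in> partitions n"
    have "(\<Sum>j=Suc 0..n. real (j * \<alpha> j)) = n"
      by (rule partitions_sum_real[OF \<alpha>])
    then show "g \<alpha> * (\<integral>\<xi>. of_bool (runs \<xi> n 0 = \<alpha>) \<partial>feller_measure \<theta>) =
        g \<alpha> * (fact n / pochhammer \<theta> n * ewens_weight \<theta> n \<alpha>)"
      using feller_runs_law[OF assms(1), of \<alpha> m 0] \<alpha> by (simp add: n)
  qed
  also have "\<dots> = fact n / pochhammer \<theta> n * (\<Sum>\<alpha>\<in>partitions n. g \<alpha> * ewens_weight \<theta> n \<alpha>)"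
    by (simp add: sum_distrib_left mult_ac)
  finally show ?thesis .
qed


section \<open>Asymptotic independence from finitely many bits\<close>

lemma dist_divideR:
  fixes x y :: "'a :: real_normed_vector"
  shows "0 < c \<Longrightarrow> dist (x /\<^sub>R c) (y /\<^sub>R c) = dist x y / c"
  by (simp add: dist_norm scaleR_diff_right[symmetric] divide_inverse mult.commute)

lemma depends_onD: "depends_on A f \<Longrightarrow> \<forall>k\<in>A. \<xi> k = \<xi>' k \<Longrightarrow> f \<xi> = f \<xi>'"
  unfolding depends_on_def by blast

lemma integrable_mult_bounded:
  fixes g F :: "'a \<Rightarrow> real"
  assumes "integrable M g" "F \<in> borel_measurable M" "\<And>\<omega>. \<bar>F \<omega>\<bar> \<le> B"
  shows "integrable M (\<lambda>\<omega>. g \<omega> * F \<omega>)"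
proof (rule Bochner_Integration.integrable_bound)
  show "integrable M (\<lambda>\<omega>. B * g \<omega>)" using assms(1) by simp
  have "\<bar>g \<omega> * F \<omega>\<bar> \<le> \<bar>B * g \<omega>\<bar>" for \<omega>
    using mult_right_mono[OF order_trans[OF assms(3) abs_ge_self], of "\<bar>g \<omega>\<bar>" \<omega>]
    by (simp add: abs_mult mult.commute)
  then show "AE \<omega> in M. norm (g \<omega> * F \<omega>) \<le> norm (B * g \<omega>)" by simp
qed (use assms in auto)

section \<open>Mixing in the sense of Renyi for bounded functions\<close>

context prob_space
begin

text \<open>Replacing \<open>h\<close> by \<open>hk k\<close> changes the two sides together by at
  most B + |a| times their mean distance, uniformly in n, because the \<open>F n\<close> share the
  bound B.\<close>

lemma mixing_L1_closure:
  fixes h :: "'a \<Rightarrow> real"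
  assumes F: "\<And>n. F n \<in> borel_measurable M" "\<And>n \<omega>. \<bar>F n \<omega>\<bar> \<le> B"
    and h: "integrable M h" "\<And>k. integrable M (hk k)"
    and conv: "(\<lambda>k. \<integral>\<omega>. \<bar>h \<omega> - hk k \<omega>\<bar> \<partial>M) \<longlonglongrightarrow> 0"
    and lim: "\<And>k. (\<lambda>n. \<integral>\<omega>. hk k \<omega> * F n \<omega> \<partial>M) \<longlonglongrightarrow> (\<integral>\<omega>. hk k \<omega> \<partial>M) * a"
  shows "(\<lambda>n. \<integral>\<omega>. h \<omega> * F n \<omega> \<partial>M) \<longlonglongrightarrow> (\<integral>\<omega>. h \<omega> \<partial>M) * a"
proof (rule LIMSEQ_I)
  fix e :: real assume "0 < e"
  have B: "0 \<le> B" using F(2)[of undefined undefined] by linarith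
  have int: "integrable M (\<lambda>\<omega>. g \<omega> * F n \<omega>)" if "integrable M g" for g n
    using that F by (rule integrable_mult_bounded)
  define d where "d k = (\<integral>\<omega>. \<bar>h \<omega> - hk k \<omega>\<bar> \<partial>M)" for k
  have "(\<lambda>k. (B + \<bar>a\<bar>) * d k) \<longlonglongrightarrow> 0" using tendsto_mult_right_zero[OF conv, of "B + \<bar>a\<bar>"] by (simp add: d_def)
  then have "\<forall>\<^sub>F k in sequentially. (B + \<bar>a\<bar>) * d k < e / 2"
    using \<open>0 < e\<close> by (intro order_tendstoD) auto
  then obtain k where k: "(B + \<bar>a\<bar>) * d k < e / 2" using eventually_happens'[OF sequentially_bot] by blast
  obtain N where N: "\<And>n. N \<le> n \<Longrightarrow> \<bar>(\<integral>\<omega>. hk k \<omega> * F n \<omega> \<partial>M) - (\<integral>\<omega>. hk k \<omega> \<partial>M) * a\<bar> < e / 2"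
    using LIMSEQ_D[OF lim[of k], of "e / 2"] \<open>0 < e\<close> by auto
  show "\<exists>N. \<forall>n\<ge>N. norm ((\<integral>\<omega>. h \<omega> * F n \<omega> \<partial>M) - (\<integral>\<omega>. h \<omega> \<partial>M) * a) < e"
  proof (intro exI[of _ N] allI impI)
    fix n assume "N \<le> n"
    have "\<bar>(\<integral>\<omega>. h \<omega> * F n \<omega> \<partial>M) - (\<integral>\<omega>. hk k \<omega> * F n \<omega> \<partial>M)\<bar> = \<bar>\<integral>\<omega>. (h \<omega> - hk k \<omega>) * F n \<omega> \<partial>M\<bar>"
      by (subst Bochner_Integration.integral_diff[symmetric]) (auto simp: left_diff_distrib intro!: int h)
    also have "\<dots> \<le> (\<integral>\<omega>. \<bar>(h \<omega> - hk k \<omega>) * F n \<omega>\<bar> \<partial>M)" by (rule integral_abs_bound)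
    also have "\<dots> \<le> (\<integral>\<omega>. B * \<bar>h \<omega> - hk k \<omega>\<bar> \<partial>M)"
      using h F by (intro integral_mono integrable_abs int integrable_mult_right)
        (auto simp: abs_mult mult.commute intro!: mult_right_mono)
    also have "\<dots> = B * d k" by (simp add: d_def)
    finally have 1: "\<bar>(\<integral>\<omega>. h \<omega> * F n \<omega> \<partial>M) - (\<integral>\<omega>. hk k \<omega> * F n \<omega> \<partial>M)\<bar> \<le> B * d k" .
    have "\<bar>(\<integral>\<omega>. h \<omega> \<partial>M) - (\<integral>\<omega>. hk k \<omega> \<partial>M)\<bar> \<le> d k"
      unfolding d_def by (subst Bochner_Integration.integral_diff[symmetric]) (auto intro!: integral_abs_bound h)
    then have "\<bar>(\<integral>\<omega>. h \<omega> \<partial>M) * a - (\<integral>\<omega>. hk k \<omega> \<partial>M) * a\<bar> \<le> \<bar>a\<bar> * d k"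
      unfolding left_diff_distrib[symmetric] abs_mult
      by (subst mult.commute) (rule mult_left_mono, auto)
    with 1 N[OF \<open>N \<le> n\<close>] k show "norm ((\<integral>\<omega>. h \<omega> * F n \<omega> \<partial>M) - (\<integral>\<omega>. h \<omega> \<partial>M) * a) < e"
      unfolding real_norm_def distrib_right by linarith
  qed
qed

text \<open>Dynkin's argument. The limit over the whole space handles complements; countable
  disjoint unions follow from \<open>mixing_L1_closure\<close>, as indicators of partial unions
  converge in mean.\<close>

lemma mixing_sets:
  fixes F :: "nat \<Rightarrow> 'a \<Rightarrow> real"
  assumes F: "\<And>n. F n \<in> borel_measurable M" "\<And>n \<omega>. \<bar>F n \<omega>\<bar> \<le> B"
    and G: "Int_stable G" "G \<subseteq> Pow (space M)" "sets M = sigma_sets (space M) G"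
    and lim: "(\<lambda>n. \<integral>\<omega>. F n \<omega> \<partial>M) \<longlonglongrightarrow> a"
      "\<And>A. A \<in> G \<Longrightarrow> (\<lambda>n. \<integral>\<omega>. indicator A \<omega> * F n \<omega> \<partial>M) \<longlonglongrightarrow> prob A * a"
    and "A \<in> sets M"
  shows "(\<lambda>n. \<integral>\<omega>. indicator A \<omega> * F n \<omega> \<partial>M) \<longlonglongrightarrow> prob A * a"
proof -
  have int: "integrable M (F n)" "integrable M (\<lambda>\<omega>. indicator A \<omega> * F n \<omega>)" if "A \<in> sets M" for A n
    using F that by (auto intro!: integrable_const_bound[where B=B] simp: abs_mult indicator_def order_trans[OF abs_ge_zero F(2)])
  show ?thesis
    using G(1,2) \<open>A \<in> sets M\<close>[unfolded G(3)]
  proof (induction rule: sigma_sets_induct_disjoint)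
    case (basic A)
    then show ?case by (rule lim(2))
  next
    case empty
    show ?case by simp
  next
    case (compl A)
    then have A: "A \<in> sets M" using G(3) by simp
    have "(\<integral>\<omega>. indicator (space M - A) \<omega> * F n \<omega> \<partial>M) = (\<integral>\<omega>. F n \<omega> \<partial>M) - (\<integral>\<omega>. indicator A \<omega> * F n \<omega> \<partial>M)" for n
    proof -
      have "(\<integral>\<omega>. indicator (space M - A) \<omega> * F n \<omega> \<partial>M) = (\<integral>\<omega>. F n \<omega> - indicator A \<omega> * F n \<omega> \<partial>M)"
        by (intro Bochner_Integration.integral_cong) (auto simp: indicator_def)
      then show ?thesis using int[OF A, of n] by simp
    qed
    moreover have "prob (space M - A) * a = a - prob A * a"
      using A by (simp add: prob_compl left_diff_distrib)
    ultimately show ?case using tendsto_diff[OF lim(1) compl(2)] by simp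
  next
    case (union A)
    then have A: "A i \<in> sets M" for i using G(3) by auto
    define U where "U k = (\<Union>i<k. A i)" for k
    have U: "U k \<in> sets M" "\<Union> (range A) \<in> sets M" for k using A by (auto simp: U_def)
    have ind: "indicator (U k) \<omega> = (\<Sum>i<k. indicator (A i) \<omega> :: real)" for k \<omega>
    proof -
      have "disjoint_family_on A {..<k}" using union(1) by (rule disjoint_family_on_mono[rotated]) simp
      then show ?thesis unfolding U_def by (intro indicator_UN_disjoint) auto
    qed
    have "(\<lambda>n. \<integral>\<omega>. indicator (\<Union> (range A)) \<omega> * F n \<omega> \<partial>M) \<longlonglongrightarrow> (\<integral>\<omega>. indicator (\<Union> (range A)) \<omega> \<partial>M) * a"
    proof (rule mixing_L1_closure[OF F, where hk = "\<lambda>k. indicator (U k)"])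
      have d: "\<bar>indicator (\<Union> (range A)) \<omega> - indicator (U k) \<omega>\<bar> = (indicator (\<Union> (range A)) \<omega> - indicator (U k) \<omega> :: real)" for \<omega> k
        by (auto simp: U_def indicator_def)
      have "(\<Union>k. U k) = \<Union> (range A)" by (auto simp: U_def)
      moreover have "(\<lambda>k. prob (U k)) \<longlonglongrightarrow> prob (\<Union>k. U k)"
      proof (rule finite_Lim_measure_incseq)
        show "incseq U" unfolding U_def by (intro monoI UN_mono) auto
      qed (use U(1) in auto)
      ultimately have "(\<lambda>k. prob (U k)) \<longlonglongrightarrow> prob (\<Union> (range A))" by simp
      from tendsto_diff[OF tendsto_const[of "prob (\<Union> (range A))"] this]
      have "(\<lambda>k. prob (\<Union> (range A)) - prob (U k)) \<longlonglongrightarrow> 0" by simp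
      then show "(\<lambda>k. \<integral>\<omega>. \<bar>indicator (\<Union> (range A)) \<omega> - indicator (U k) \<omega>\<bar> \<partial>M) \<longlonglongrightarrow> (0::real)"
        unfolding d using U by (subst Bochner_Integration.integral_diff) (auto simp: emeasure_eq_measure)
      fix k
      have "(\<lambda>n. \<Sum>i<k. \<integral>\<omega>. indicator (A i) \<omega> * F n \<omega> \<partial>M) \<longlonglongrightarrow> (\<Sum>i<k. prob (A i) * a)"
        by (intro tendsto_sum union)
      moreover have "(\<Sum>i<k. \<integral>\<omega>. indicator (A i) \<omega> * F n \<omega> \<partial>M) = (\<integral>\<omega>. indicator (U k) \<omega> * F n \<omega> \<partial>M)" for n
        unfolding ind sum_distrib_right using int(2)[OF A] by (subst Bochner_Integration.integral_sum) auto
      moreover have "(\<Sum>i<k. prob (A i) * a) = (\<integral>\<omega>. indicator (U k) \<omega> \<partial>M) * a"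
        unfolding ind using A by (subst Bochner_Integration.integral_sum) (auto simp: emeasure_eq_measure sum_distrib_right)
      ultimately show "(\<lambda>n. \<integral>\<omega>. indicator (U k) \<omega> * F n \<omega> \<partial>M) \<longlonglongrightarrow> (\<integral>\<omega>. indicator (U k) \<omega> \<partial>M) * a" by simp
    qed (use U in \<open>auto simp: emeasure_eq_measure\<close>)
    then show ?case using U(2) by simp
  qed
qed

text \<open>Weak star convergence of \<open>F n\<close> to the constant a in the dual of the
  integrable functions, deduced from a generating class of events.\<close>

lemma mixing:
  fixes F :: "nat \<Rightarrow> 'a \<Rightarrow> real"
  assumes F: "\<And>n. F n \<in> borel_measurable M" "\<And>n \<omega>. \<bar>F n \<omega>\<bar> \<le> B"
    and G: "Int_stable G" "G \<subseteq> Pow (space M)" "sets M = sigma_sets (space M) G"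
    and lim: "(\<lambda>n. \<integral>\<omega>. F n \<omega> \<partial>M) \<longlonglongrightarrow> a"
      "\<And>A. A \<in> G \<Longrightarrow> (\<lambda>n. \<integral>\<omega>. indicator A \<omega> * F n \<omega> \<partial>M) \<longlonglongrightarrow> prob A * a"
    and h: "integrable M h"
  shows "(\<lambda>n. \<integral>\<omega>. h \<omega> * F n \<omega> \<partial>M) \<longlonglongrightarrow> (\<integral>\<omega>. h \<omega> \<partial>M) * a"
  using h
proof (induction rule: integrable_induct)
  case (base A c)
  have "(\<lambda>n. c * (\<integral>\<omega>. indicator A \<omega> * F n \<omega> \<partial>M)) \<longlonglongrightarrow> c * (prob A * a)"
    by (intro tendsto_mult_left mixing_sets[OF F G lim] base)
  then show ?case using base by (simp add: mult_ac)
next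
  case (add f g)
  have int: "integrable M (\<lambda>\<omega>. g \<omega> * F n \<omega>)" if "integrable M g" for g n
    using that F by (rule integrable_mult_bounded)
  show ?case using tendsto_add[OF add(3,4)] add(1,2)
    by (simp add: distrib_right int)
next
  case (lim f s)
  show ?case
  proof (rule mixing_L1_closure[OF F lim(4) lim(1) _ lim(5)])
    show "(\<lambda>k. \<integral>\<omega>. \<bar>f \<omega> - s k \<omega>\<bar> \<partial>M) \<longlonglongrightarrow> 0"
    proof (rule tendsto_eq_rhs[OF integral_dominated_convergence[where w = "\<lambda>\<omega>. 3 * \<bar>f \<omega>\<bar>" and f = "\<lambda>_. 0"]])
      show "AE \<omega> in M. (\<lambda>k. \<bar>f \<omega> - s k \<omega>\<bar>) \<longlonglongrightarrow> 0"
      proof (rule AE_I2)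
        fix \<omega> assume "\<omega> \<in> space M"
        then have "(\<lambda>k. f \<omega> - s k \<omega>) \<longlonglongrightarrow> f \<omega> - f \<omega>" by (intro tendsto_diff tendsto_const lim(2))
        then show "(\<lambda>k. \<bar>f \<omega> - s k \<omega>\<bar>) \<longlonglongrightarrow> 0" by (intro tendsto_rabs_zero) simp
      qed
      \<comment> \<open>The simple functions satisfy |s k| \<le> 2 |f|, hence the factor 3.\<close>
      show "AE \<omega> in M. norm \<bar>f \<omega> - s k \<omega>\<bar> \<le> 3 * \<bar>f \<omega>\<bar>" for k
      proof (rule AE_I2)
        fix \<omega> assume "\<omega> \<in> space M"
        then have "\<bar>s k \<omega>\<bar> \<le> 2 * \<bar>f \<omega>\<bar>" using lim(3)[of \<omega> k] by simp
        then show "norm \<bar>f \<omega> - s k \<omega>\<bar> \<le> 3 * \<bar>f \<omega>\<bar>" by simp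
      qed
    qed (use lim(1,4) in auto)
  qed
qed

end

text \<open>Overwriting the first K bits makes the sorted parts independent of any event in those
  bits and moves \<open>f\<close> by O(K/n) only. Such events generate the sigma-algebra, so
  \<open>mixing\<close> applies.\<close>

lemma mixing_feller:
  fixes f :: "ell1 \<Rightarrow> real"
  assumes "0 < \<theta>" and f: "\<And>x y. \<bar>f x - f y\<bar> \<le> C * dist x y" "\<And>x. \<bar>f x\<bar> \<le> B"
    and lim: "(\<lambda>n. \<integral>\<xi>. f (longest_parts (runs \<xi> n 0) /\<^sub>R real n) \<partial>feller_measure \<theta>) \<longlonglongrightarrow> a"
    and h: "integrable (feller_measure \<theta>) h"
  shows "(\<lambda>n. \<integral>\<xi>. h \<xi> * f (longest_parts (runs \<xi> n 0) /\<^sub>R real n) \<partial>feller_measure \<theta>)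
    \<longlonglongrightarrow> (\<integral>\<xi>. h \<xi> \<partial>feller_measure \<theta>) * a"
proof -
  let ?M = "feller_measure \<theta>"
  interpret prob_space "feller_measure \<theta>" by (rule prob_space_feller_measure)
  define F where "F n \<xi> = f (longest_parts (runs \<xi> n 0) /\<^sub>R real n)" for n \<xi>
  have dep: "depends_on {1..n} (F n)" for n
    unfolding F_def by (rule depends_on_runs)
  have F: "F n \<in> borel_measurable ?M" "\<bar>F n \<xi>\<bar> \<le> B" for n \<xi>
    using measurable_depends_on[OF _ _ dep] f(2) by (auto simp: F_def)
  have lim: "(\<lambda>n. expectation (F n)) \<longlonglongrightarrow> a" using lim by (simp add: F_def[abs_def])
  \<comment> \<open>The sign of the Lipschitz constant follows by testing it on some nonzero
    vector.\<close>
  have C: "0 \<le> C"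
  proof -
    obtain x :: ell1 where "x \<noteq> 0"
    proof -
      have "norm (longest_parts (add_part 1 (\<lambda>_. 0))) = 1"
        using dist_add_part_self[OF finite_support_zero, of 1] by (simp add: longest_parts_zero)
      then show thesis by (intro that[of "longest_parts (add_part 1 (\<lambda>_. 0))"]) auto
    qed
    then have "0 < dist x 0" by simp
    moreover have "0 \<le> C * dist x 0" using f(1)[of x 0] by linarith
    ultimately show ?thesis by (simp add: zero_le_mult_iff)
  qed
  have cyl: "(\<lambda>n. \<integral>\<xi>. of_bool (\<phi> \<xi>) * F n \<xi> \<partial>?M) \<longlonglongrightarrow> (\<integral>\<xi>. of_bool (\<phi> \<xi>) \<partial>?M) * a"
    if \<phi>: "depends_on {1..K} \<phi>" for \<phi> K
  proof -
    \<comment> \<open>With the first \<open>K\<close> bits set to zero only the bits in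
      \<open>{Suc K..n}\<close> matter, so independence of \<open>\<phi>\<close> is available. The
      string may lose its leading one, but \<open>runs\<close> and its distance bounds cover such
      strings.\<close>
    define F' where "F' n \<xi> = F n (\<lambda>k. if k \<le> K then False else \<xi> k)" for n \<xi>
    have \<phi>': "depends_on {1..K} (\<lambda>\<xi>. of_bool (\<phi> \<xi>) :: real)"
      unfolding depends_on_def by (intro allI impI arg_cong[where f = of_bool]) (rule depends_onD[OF \<phi>])
    have dep': "depends_on {Suc K..n} (F' n)" for n
      unfolding depends_on_def
    proof (intro allI impI)
      fix \<xi> \<xi>' :: "nat \<Rightarrow> bool" assume "\<forall>k\<in>{Suc K..n}. \<xi> k = \<xi>' k"
      then have "\<forall>k\<in>{1..n}. (if k \<le> K then False else \<xi> k) = (if k \<le> K then False else \<xi>' k)" by auto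
      then show "F' n \<xi> = F' n \<xi>'" unfolding F'_def by (rule depends_onD[OF dep])
    qed
    have int: "integrable ?M (\<lambda>\<xi>. of_bool (\<phi> \<xi>) * F n \<xi>)" "integrable ?M (F n)"
      "integrable ?M (\<lambda>\<xi>. of_bool (\<phi> \<xi>) * F' n \<xi>)" "integrable ?M (F' n)" for n
    proof -
      have "F' n \<in> borel_measurable ?M" by (rule measurable_depends_on[OF _ _ dep']) auto
      moreover have "(\<lambda>\<xi>. of_bool (\<phi> \<xi>) :: real) \<in> borel_measurable ?M"
        by (rule measurable_depends_on[OF _ _ \<phi>']) auto
      moreover have "\<bar>F' n \<xi>\<bar> \<le> B" for \<xi> using F(2) by (simp add: F'_def)
      moreover have "0 \<le> B" using F(2)[of undefined undefined] by linarith
      ultimately show "integrable ?M (\<lambda>\<xi>. of_bool (\<phi> \<xi>) * F n \<xi>)" "integrable ?M (F n)"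
        "integrable ?M (\<lambda>\<xi>. of_bool (\<phi> \<xi>) * F' n \<xi>)" "integrable ?M (F' n)"
        using F by (auto intro!: integrable_const_bound[where B=B] simp: abs_mult)
    qed
    have close: "\<bar>F n \<xi> - F' n \<xi>\<bar> \<le> C * (4 * real K / real n)" if "K \<le> n" "0 < n" for n \<xi>
    proof -
      let ?\<xi> = "\<lambda>k. if k \<le> K then False else \<xi> k"
      have "dist (longest_parts (runs \<xi> n 0)) (longest_parts (runs ?\<xi> n 0)) \<le> 4 * real K"
        using dist_runs_change_prefix[of K \<xi> ?\<xi> "n - K" 0] that by simp
      then have "dist (longest_parts (runs \<xi> n 0) /\<^sub>R real n) (longest_parts (runs ?\<xi> n 0) /\<^sub>R real n) \<le> 4 * real K / real n"
        using that by (simp add: dist_divideR divide_right_mono)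
      then show ?thesis
        unfolding F_def F'_def by (rule order_trans[OF f(1) mult_left_mono[OF _ C]])
    qed
    have "(\<lambda>n. (\<integral>\<xi>. of_bool (\<phi> \<xi>) * F n \<xi> \<partial>?M) - (\<integral>\<xi>. of_bool (\<phi> \<xi>) \<partial>?M) * expectation (F n)) \<longlonglongrightarrow> 0"
    proof (rule Lim_null_comparison)
      \<comment> \<open>One error from replacing \<open>F\<close> by \<open>F'\<close> in the joint
        expectation, one from replacing it back after factorising.\<close>
      show "(\<lambda>n. 2 * (C * (4 * real K / real n))) \<longlonglongrightarrow> 0"
        using tendsto_mult_right_zero[OF lim_const_over_n[of "4 * real K"], of "2 * C"] by (simp add: mult_ac)
      show "\<forall>\<^sub>F n in sequentially. norm ((\<integral>\<xi>. of_bool (\<phi> \<xi>) * F n \<xi> \<partial>?M) -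
          (\<integral>\<xi>. of_bool (\<phi> \<xi>) \<partial>?M) * expectation (F n)) \<le> 2 * (C * (4 * real K / real n))"
        using eventually_ge_at_top[of "Suc K"]
      proof eventually_elim
        case (elim n)
        let ?\<phi> = "\<lambda>\<xi>. of_bool (\<phi> \<xi>) :: real" and ?e = "C * (4 * real K / real n)"
        have b: "\<bar>(\<integral>\<xi>. g \<xi> * (F n \<xi> - F' n \<xi>) \<partial>?M)\<bar> \<le> ?e"
          if "\<And>\<xi>. \<bar>g \<xi>\<bar> \<le> 1" "integrable ?M (\<lambda>\<xi>. g \<xi> * (F n \<xi> - F' n \<xi>))" for g :: "_ \<Rightarrow> real"
        proof -
          have "\<bar>g \<xi> * (F n \<xi> - F' n \<xi>)\<bar> \<le> ?e" for \<xi>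
            using mult_mono[OF that(1) close[of n \<xi>]] elim by (simp add: abs_mult)
          then have "(\<integral>\<xi>. \<bar>g \<xi> * (F n \<xi> - F' n \<xi>)\<bar> \<partial>?M) \<le> (\<integral>\<xi>. ?e \<partial>?M)"
            using that(2) by (intro integral_mono) auto
          then show ?thesis
            by (intro order_trans[OF integral_abs_bound]) (simp add: prob_space)
        qed
        have d: "integrable ?M (\<lambda>\<xi>. ?\<phi> \<xi> * (F n \<xi> - F' n \<xi>))"
          "(\<integral>\<xi>. ?\<phi> \<xi> * (F n \<xi> - F' n \<xi>) \<partial>?M) = (\<integral>\<xi>. ?\<phi> \<xi> * F n \<xi> \<partial>?M) - (\<integral>\<xi>. ?\<phi> \<xi> * F' n \<xi> \<partial>?M)"
          unfolding right_diff_distrib using int by (auto intro!: Bochner_Integration.integral_diff)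
        have "\<bar>(\<integral>\<xi>. ?\<phi> \<xi> * F n \<xi> \<partial>?M) - (\<integral>\<xi>. ?\<phi> \<xi> * F' n \<xi> \<partial>?M)\<bar> \<le> ?e"
          using b[OF _ d(1)] d(2) by simp
        moreover have "\<bar>expectation (F n) - expectation (F' n)\<bar> \<le> ?e"
          using b[of "\<lambda>_. 1"] int by simp
        moreover have "\<bar>expectation ?\<phi>\<bar> \<le> 1"
        proof -
          have "expectation ?\<phi> \<le> expectation (\<lambda>_. 1)"
            by (intro integral_mono integrable_depends_on[OF _ _ \<phi>']) auto
          moreover have "0 \<le> expectation ?\<phi>" by simp
          ultimately show ?thesis by (simp add: prob_space)
        qed
        moreover have "(\<integral>\<xi>. ?\<phi> \<xi> * F' n \<xi> \<partial>?M) = expectation ?\<phi> * expectation (F' n)"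
          by (rule integral_mult_depends_on[OF _ _ \<phi>' _ _ dep']) auto
        ultimately have "\<bar>expectation ?\<phi> * (expectation (F n) - expectation (F' n))\<bar> \<le> 1 * ?e"
          unfolding abs_mult by (intro mult_mono) auto
        then show ?case
          using \<open>\<bar>_ - (\<integral>\<xi>. ?\<phi> \<xi> * F' n \<xi> \<partial>?M)\<bar> \<le> ?e\<close>
            \<open>(\<integral>\<xi>. ?\<phi> \<xi> * F' n \<xi> \<partial>?M) = _\<close> by (simp add: right_diff_distrib)
      qed
    qed
    from tendsto_add[OF this tendsto_mult_left[OF lim, of "\<integral>\<xi>. of_bool (\<phi> \<xi>) \<partial>?M"]]
    show ?thesis by simp
  qed
  show ?thesis
    unfolding F_def[symmetric]
  proof (rule mixing[OF F _ _ _ lim _ h])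
    show "Int_stable (prod_algebra {1..} (feller_component \<theta>))" by (rule Int_stable_prod_algebra)
    show "prod_algebra {1..} (feller_component \<theta>) \<subseteq> Pow (space ?M)"
      using prod_algebra_sets_into_space unfolding feller_measure_def space_PiM by blast
    show "sets ?M = sigma_sets (space ?M) (prod_algebra {1..} (feller_component \<theta>))"
      unfolding feller_measure_def space_PiM by (rule sets_PiM)
    fix A assume "A \<in> prod_algebra {1..} (feller_component \<theta>)"
    then obtain J E where J: "A = prod_emb {1..} (feller_component \<theta>) J (Pi\<^sub>E J E)" "finite J" "J \<subseteq> {1..}"
      by (rule prod_algebraE) auto
    have A: "indicator A \<xi> = (of_bool (\<forall>i\<in>J. \<xi> i \<in> E i) :: real)" if "\<xi> \<in> space ?M" for \<xi>
      using that J(3) unfolding J(1) by (auto simp: prod_emb_def feller_measure_def space_PiM indicator_def)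
    have "A \<in> sets ?M"
      using \<open>A \<in> prod_algebra _ _\<close> unfolding feller_measure_def sets_PiM by auto
    then have "prob A = expectation (indicator A)"
      using sets.sets_into_space[of A "?M"] by (simp add: Int_absorb2)
    also have "\<dots> = expectation (\<lambda>\<xi>. of_bool (\<forall>i\<in>J. \<xi> i \<in> E i))"
      by (intro Bochner_Integration.integral_cong refl A)
    finally have pA: "prob A = expectation (\<lambda>\<xi>. of_bool (\<forall>i\<in>J. \<xi> i \<in> E i))" .
    obtain K where "J \<subseteq> {..K}" using J(2) finite_nat_iff_bounded_le by blast
    with J(3) have "depends_on {1..K} (\<lambda>\<xi>. \<forall>i\<in>J. \<xi> i \<in> E i)"
      unfolding depends_on_def by (auto simp: subset_eq)
    from cyl[OF this] show "(\<lambda>n. \<integral>\<xi>. indicator A \<xi> * F n \<xi> \<partial>?M) \<longlonglongrightarrow> prob A * a"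
      unfolding pA by (simp add: A cong: Bochner_Integration.integral_cong)
  qed
qed


section \<open>The intensity of the Poisson\<endash>Dirichlet process\<close>

lemma sets_pd_intensity [simp]: "sets (pd_intensity \<theta>) = sets borel"
  by (simp add: pd_intensity_def)

lemma emeasure_pd_intensity_Ioc:
  assumes "0 < \<theta>" "0 < a" "a \<le> b"
  shows "emeasure (pd_intensity \<theta>) {a<..b} \<le> ennreal (\<theta> * (b - a) * exp (- a) / a)"
    and "ennreal (\<theta> * (b - a) * exp (- b) / b) \<le> emeasure (pd_intensity \<theta>) {a<..b}"
proof -
  let ?g = "\<lambda>x. \<theta> * exp (- x) / x"
  have e: "emeasure (pd_intensity \<theta>) {a<..b} = (\<integral>\<^sup>+x. indicator {0<..} x * ennreal (?g x) * indicator {a<..b} x \<partial>lborel)"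
    unfolding pd_intensity_def by (rule emeasure_density) auto
  have g: "?g y \<le> ?g x" if "0 < x" "x \<le> y" for x y
    using that assms(1) by (intro frac_le mult_left_mono) auto
  have "emeasure (pd_intensity \<theta>) {a<..b} \<le> (\<integral>\<^sup>+x. ennreal (?g a) * indicator {a<..b} x \<partial>lborel)"
    unfolding e using assms by (intro nn_integral_mono) (auto simp: indicator_def intro!: ennreal_leI g)
  also have "\<dots> = ennreal (?g a) * ennreal (b - a)"
    using assms by (subst nn_integral_cmult_indicator) auto
  also have "\<dots> = ennreal (\<theta> * (b - a) * exp (- a) / a)"
    using assms by (subst ennreal_mult[symmetric]) (auto simp: mult_ac)
  finally show "emeasure (pd_intensity \<theta>) {a<..b} \<le> ennreal (\<theta> * (b - a) * exp (- a) / a)" .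
  have "ennreal (\<theta> * (b - a) * exp (- b) / b) = ennreal (?g b) * ennreal (b - a)"
    using assms by (subst ennreal_mult[symmetric]) (auto simp: mult_ac)
  also have "\<dots> = (\<integral>\<^sup>+x. ennreal (?g b) * indicator {a<..b} x \<partial>lborel)"
    using assms by (subst nn_integral_cmult_indicator) auto
  also have "\<dots> \<le> emeasure (pd_intensity \<theta>) {a<..b}"
    unfolding e using assms by (intro nn_integral_mono) (auto simp: indicator_def intro!: ennreal_leI g)
  finally show "ennreal (\<theta> * (b - a) * exp (- b) / b) \<le> emeasure (pd_intensity \<theta>) {a<..b}" .
qed

text \<open>The density of the intensity at the grid point \<epsilon> i, multiplied by the mesh
  \<epsilon>.\<close>

definition cycle_rate :: "real \<Rightarrow> real \<Rightarrow> nat \<Rightarrow> real" where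
  "cycle_rate \<theta> \<epsilon> i = \<theta> * exp (- \<epsilon> * real i) / real i"

text \<open>Sums the rates of indices strictly above \<open>i\<close>. At \<open>i = 0\<close> and
  for \<epsilon> > 0 it is - \<theta> ln (1 - exp (- \<epsilon>)), so its negative exponential is
  the normalisation of a negative binomial law.\<close>

definition cycle_rate_tail :: "real \<Rightarrow> real \<Rightarrow> nat \<Rightarrow> real" where
  "cycle_rate_tail \<theta> \<epsilon> i = (\<Sum>j. cycle_rate \<theta> \<epsilon> (Suc (i + j)))"

lemma cycle_rate_nonneg: "0 < \<theta> \<Longrightarrow> 0 \<le> cycle_rate \<theta> \<epsilon> i"
  by (simp add: cycle_rate_def)

lemma summable_cycle_rate:
  assumes "0 < \<theta>" "0 < \<epsilon>"
  shows "summable (\<lambda>j. cycle_rate \<theta> \<epsilon> (i + j))"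
proof (rule summable_comparison_test')
  have "summable (\<lambda>j. exp (- \<epsilon>) ^ j)" using assms by (intro summable_geometric) auto
  then show "summable (\<lambda>j. \<theta> * exp (- \<epsilon>) ^ j)" by (rule summable_mult)
  fix j :: nat
  show "norm (cycle_rate \<theta> \<epsilon> (i + j)) \<le> \<theta> * exp (- \<epsilon>) ^ j"
  proof (cases "i + j = 0")
    case False
    have "exp (- \<epsilon> * real (i + j)) \<le> exp (- \<epsilon> * real j)" using assms by simp
    also have "\<dots> = exp (- \<epsilon>) ^ j" by (simp add: exp_of_nat_mult[symmetric] mult.commute)
    finally have "\<theta> * exp (- \<epsilon> * real (i + j)) / real (i + j) \<le> \<theta> * exp (- \<epsilon>) ^ j / 1"
      using assms False by (intro frac_le mult_left_mono) auto
    then show ?thesis using assms by (simp add: cycle_rate_def)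
  qed (use assms in \<open>simp add: cycle_rate_def\<close>)
qed

lemma cycle_rate_tail_Suc:
  assumes "0 < \<theta>" "0 < \<epsilon>"
  shows "cycle_rate_tail \<theta> \<epsilon> i = cycle_rate \<theta> \<epsilon> (Suc i) + cycle_rate_tail \<theta> \<epsilon> (Suc i)"
  using suminf_split_head[OF summable_cycle_rate[OF assms, of "Suc i"]]
  by (simp add: cycle_rate_tail_def)

lemma cycle_rate_tail_nonneg:
  "0 < \<theta> \<Longrightarrow> 0 < \<epsilon> \<Longrightarrow> 0 \<le> cycle_rate_tail \<theta> \<epsilon> i"
  unfolding cycle_rate_tail_def using summable_cycle_rate[of \<theta> \<epsilon> "Suc i"]
  by (intro suminf_nonneg) (auto intro: cycle_rate_nonneg)

lemma cycle_rate_tail_antimono: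
  assumes "0 < \<theta>" "0 < \<epsilon>" "\<epsilon> \<le> \<epsilon>'"
  shows "cycle_rate_tail \<theta> \<epsilon>' i \<le> cycle_rate_tail \<theta> \<epsilon> i"
  unfolding cycle_rate_tail_def
proof (rule suminf_le)
  show "cycle_rate \<theta> \<epsilon>' (Suc (i + j)) \<le> cycle_rate \<theta> \<epsilon> (Suc (i + j))" for j
    using assms unfolding cycle_rate_def
    by (intro divide_right_mono mult_left_mono) (auto intro!: mult_right_mono)
qed (use summable_cycle_rate[of \<theta> _ "Suc i"] assms in auto)

lemma emeasure_pd_intensity_grid:
  assumes "0 < \<theta>" "0 < \<epsilon>" "1 \<le> i"
  shows "emeasure (pd_intensity \<theta>) {\<epsilon> * real i<..\<epsilon> * real (Suc i)} \<le> ennreal (cycle_rate \<theta> \<epsilon> i)"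
    and "ennreal (cycle_rate \<theta> \<epsilon> (Suc i)) \<le> emeasure (pd_intensity \<theta>) {\<epsilon> * real i<..\<epsilon> * real (Suc i)}"
proof -
  have "\<theta> * (\<epsilon> * real (Suc i) - \<epsilon> * real i) * exp (- (\<epsilon> * real i)) / (\<epsilon> * real i) = cycle_rate \<theta> \<epsilon> i"
    using assms by (simp add: cycle_rate_def field_simps)
  moreover have "\<theta> * (\<epsilon> * real (Suc i) - \<epsilon> * real i) * exp (- (\<epsilon> * real (Suc i))) / (\<epsilon> * real (Suc i)) = cycle_rate \<theta> \<epsilon> (Suc i)"
    using assms(2) by (simp add: cycle_rate_def right_diff_distrib[symmetric] del: of_nat_Suc)
  moreover have "0 < \<epsilon> * real i" "\<epsilon> * real i \<le> \<epsilon> * real (Suc i)" using assms by auto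
  ultimately show "emeasure (pd_intensity \<theta>) {\<epsilon> * real i<..\<epsilon> * real (Suc i)} \<le> ennreal (cycle_rate \<theta> \<epsilon> i)"
    "ennreal (cycle_rate \<theta> \<epsilon> (Suc i)) \<le> emeasure (pd_intensity \<theta>) {\<epsilon> * real i<..\<epsilon> * real (Suc i)}"
    using emeasure_pd_intensity_Ioc[OF assms(1)] by metis+
qed

text \<open>The density decreases, so discrete and continuous tails interlace on the grid. By
  continuity the intensity tail then takes the value
  \<open>cycle_rate_tail \<theta> \<epsilon> i\<close> between \<epsilon> i and \<epsilon> (i + 1),
  for i \<ge> 1.\<close>

lemma emeasure_pd_intensity_Ioi:
  assumes "0 < \<theta>" "0 < \<epsilon>" "1 \<le> i"
  shows "emeasure (pd_intensity \<theta>) {\<epsilon> * real i<..} \<le> ennreal (cycle_rate_tail \<theta> \<epsilon> (i - 1))"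
    and "ennreal (cycle_rate_tail \<theta> \<epsilon> i) \<le> emeasure (pd_intensity \<theta>) {\<epsilon> * real i<..}"
proof -
  let ?I = "\<lambda>j. {\<epsilon> * real (i + j)<..\<epsilon> * real (Suc (i + j))}"
  have disj: "disjoint_family ?I"
    unfolding disjoint_family_on_def
  proof (intro ballI impI)
    have "?I m \<inter> ?I n = {}" if "m < n" for m n
    proof -
      have "\<epsilon> * real (Suc (i + m)) \<le> \<epsilon> * real (i + n)" using that assms by (intro mult_left_mono) auto
      then show ?thesis by auto
    qed
    then show "?I m \<inter> ?I n = {}" if "m \<noteq> n" for m n using that by (metis Int_commute nat_neq_iff)
  qed
  have un: "(\<Union>j. ?I j) = {\<epsilon> * real i<..}"
  proof (intro equalityI subsetI)
    fix x assume "x \<in> (\<Union>j. ?I j)"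
    then obtain j where "\<epsilon> * real (i + j) < x" by auto
    moreover have "\<epsilon> * real i \<le> \<epsilon> * real (i + j)" using assms by (intro mult_left_mono) auto
    ultimately show "x \<in> {\<epsilon> * real i<..}" by auto
  next
    fix x assume x: "x \<in> {\<epsilon> * real i<..}"
    have "\<exists>n. x \<le> \<epsilon> * real n"
      using reals_Archimedean3[OF assms(2), rule_format, of x] by (auto intro: less_imp_le simp: mult.commute)
    define n where "n = (LEAST n. x \<le> \<epsilon> * real n)"
    have n: "x \<le> \<epsilon> * real n" unfolding n_def using \<open>\<exists>n. _\<close> by (rule LeastI_ex)
    have less: "\<epsilon> * real m < x" if "m < n" for m
      using not_less_Least[of m "\<lambda>n. x \<le> \<epsilon> * real n"] that unfolding n_def by auto
    have "i < n"
    proof (rule ccontr)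
      assume "\<not> i < n"
      then have "\<epsilon> * real n \<le> \<epsilon> * real i" using assms by (intro mult_left_mono) auto
      then show False using n x by auto
    qed
    then have "x \<in> ?I (n - Suc i)" using n less[of "n - 1"] by auto
    then show "x \<in> (\<Union>j. ?I j)" by blast
  qed
  have s: "emeasure (pd_intensity \<theta>) {\<epsilon> * real i<..} = (\<Sum>j. emeasure (pd_intensity \<theta>) (?I j))"
    unfolding un[symmetric] by (rule suminf_emeasure[symmetric]) (use disj in auto)
  have t: "(\<Sum>j. ennreal (cycle_rate \<theta> \<epsilon> (k + j))) = ennreal (\<Sum>j. cycle_rate \<theta> \<epsilon> (k + j))" for k
    by (intro suminf_ennreal2 cycle_rate_nonneg summable_cycle_rate assms)
  have "(\<Sum>j. emeasure (pd_intensity \<theta>) (?I j)) \<le> (\<Sum>j. ennreal (cycle_rate \<theta> \<epsilon> (i + j)))"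
    using assms by (intro suminf_le emeasure_pd_intensity_grid) auto
  then show "emeasure (pd_intensity \<theta>) {\<epsilon> * real i<..} \<le> ennreal (cycle_rate_tail \<theta> \<epsilon> (i - 1))"
    unfolding s t cycle_rate_tail_def using assms(3) by simp
  have "(\<Sum>j. ennreal (cycle_rate \<theta> \<epsilon> (Suc i + j))) \<le> (\<Sum>j. emeasure (pd_intensity \<theta>) (?I j))"
  proof (rule suminf_le)
    show "ennreal (cycle_rate \<theta> \<epsilon> (Suc i + j)) \<le> emeasure (pd_intensity \<theta>) (?I j)" for j
      using emeasure_pd_intensity_grid(2)[OF assms(1,2), of "i + j"] assms(3) by simp
  qed auto
  then show "ennreal (cycle_rate_tail \<theta> \<epsilon> i) \<le> emeasure (pd_intensity \<theta>) {\<epsilon> * real i<..}"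
    unfolding s t cycle_rate_tail_def by simp
qed

lemma emeasure_pd_intensity_Ioi_finite:
  assumes "0 < \<theta>" "0 < t"
  shows "emeasure (pd_intensity \<theta>) {t<..} < \<infinity>"
  using emeasure_pd_intensity_Ioi(1)[OF assms, of 1] by (auto simp: less_top[symmetric] top_unique)

lemma measure_pd_intensity_Ioc:
  assumes "0 < \<theta>" "0 < a" "a \<le> b"
  shows "measure (pd_intensity \<theta>) {a<..b} = measure (pd_intensity \<theta>) {a<..} - measure (pd_intensity \<theta>) {b<..}"
proof -
  have "{a<..b} = {a<..} - {b<..}" by auto
  then show ?thesis
    using assms emeasure_pd_intensity_Ioi_finite[OF assms(1), of a]
    by (simp, subst measure_Diff) auto
qed

lemma continuous_on_pd_tail:
  assumes "0 < \<theta>" "0 < a"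
  shows "continuous_on {a..b} (\<lambda>t. measure (pd_intensity \<theta>) {t<..})"
proof -
  have le: "measure (pd_intensity \<theta>) {x<..} - measure (pd_intensity \<theta>) {y<..} \<in> {0..\<theta> / a * (y - x)}"
    if "a \<le> x" "x \<le> y" for x y
  proof -
    have "emeasure (pd_intensity \<theta>) {x<..y} \<le> ennreal (\<theta> * (y - x) * exp (- x) / x)"
      using assms that by (intro emeasure_pd_intensity_Ioc) auto
    also have "\<dots> \<le> ennreal (\<theta> * (y - x) * 1 / a)"
      using assms that by (intro ennreal_leI frac_le mult_left_mono mult_nonneg_nonneg) auto
    finally have "measure (pd_intensity \<theta>) {x<..y} \<le> \<theta> * (y - x) * 1 / a"
      using assms that unfolding measure_def by (intro enn2real_leI) auto
    moreover have "0 \<le> measure (pd_intensity \<theta>) {x<..y}" by simp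
    ultimately show ?thesis
      unfolding measure_pd_intensity_Ioc[OF assms(1) less_le_trans[OF assms(2) that(1)] that(2)] by simp
  qed
  have "(\<theta> / a)-lipschitz_on {a..b} (\<lambda>t. measure (pd_intensity \<theta>) {t<..})"
  proof (rule lipschitz_onI)
    fix x y assume "x \<in> {a..b}" "y \<in> {a..b}"
    then show "dist (measure (pd_intensity \<theta>) {x<..}) (measure (pd_intensity \<theta>) {y<..}) \<le> \<theta> / a * dist x y"
      using le[of x y] le[of y x] by (cases "x \<le> y") (auto simp: dist_real_def)
  qed (use assms in auto)
  then show ?thesis by (rule lipschitz_on_continuous_on)
qed

text \<open>Cutting \<open>(0, \<infinity>)\<close> at these thresholds makes the cell counts independent Poisson variables whose
  means are exactly those of the Ewens cycle counts with geometric weight \<open>e\<^sup>-\<^sup>\<epsilon>\<close>, while each cell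
  stays close to the grid point \<open>\<epsilon> i\<close>.\<close>

definition thresholds :: "real \<Rightarrow> real \<Rightarrow> (nat \<Rightarrow> real) \<Rightarrow> bool" where
  "thresholds \<theta> \<epsilon> \<tau> \<longleftrightarrow> \<epsilon> / 4 \<le> \<tau> 0 \<and>
     (\<forall>i. \<epsilon> * real i \<le> \<tau> i \<and> \<tau> i \<le> \<epsilon> * real (Suc i) \<and>
       measure (pd_intensity \<theta>) {\<tau> i<..} = cycle_rate_tail \<theta> \<epsilon> i)"

lemma thresholds_exist:
  assumes "0 < \<theta>" "0 < \<epsilon>"
  obtains \<tau> where "thresholds \<theta> \<epsilon> \<tau>"
proof -
  let ?G = "\<lambda>t. measure (pd_intensity \<theta>) {t<..}" and ?R = "cycle_rate_tail \<theta> \<epsilon>"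
  have em: "emeasure (pd_intensity \<theta>) {t<..} = ennreal (?G t)" if "0 < t" for t
    using emeasure_pd_intensity_Ioi_finite[OF assms(1) that] by (simp add: emeasure_eq_ennreal_measure)
  have up: "?G (\<epsilon> * real (Suc i)) \<le> ?R i" for i
    using emeasure_pd_intensity_Ioi(1)[OF assms, of "Suc i"] em[of "\<epsilon> * real (Suc i)"] assms
      cycle_rate_tail_nonneg[OF assms, of i] by (simp add: ennreal_le_iff del: of_nat_Suc)
  have low: "?R i \<le> ?G (\<epsilon> * real i)" if "1 \<le> i" for i
    using emeasure_pd_intensity_Ioi(2)[OF assms, of i] em[of "\<epsilon> * real i"] assms that
    by (simp add: ennreal_le_iff)
  have low0: "?R 0 \<le> ?G (\<epsilon> / 4)"
  proof -
    \<comment> \<open>For i = 0 the left grid point is 0, where the tail is infinite, and a positive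
      lower end is wanted. The two dyadic intervals below \<epsilon> carry mass at least \<theta>
      exp (- \<epsilon>) / 2 each, together at least the first rate; hence \<epsilon> / 4.\<close>
    have half: "\<theta> * exp (- \<epsilon>) / 2 \<le> ?G (b / 2) - ?G b" if "0 < b" "b \<le> \<epsilon>" for b
    proof -
      have "\<theta> * exp (- \<epsilon>) / 2 \<le> \<theta> * (b - b / 2) * exp (- b) / b"
        using that assms by simp
      then have "ennreal (\<theta> * exp (- \<epsilon>) / 2) \<le> ennreal (\<theta> * (b - b / 2) * exp (- b) / b)"
        by (rule ennreal_leI)
      also have "\<dots> \<le> emeasure (pd_intensity \<theta>) {b / 2<..b}"
        using that by (intro emeasure_pd_intensity_Ioc(2)[OF assms(1)]) auto
      finally have "ennreal (\<theta> * exp (- \<epsilon>) / 2) \<le> emeasure (pd_intensity \<theta>) {b / 2<..b}" .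
      moreover have "emeasure (pd_intensity \<theta>) {b / 2<..b} < \<infinity>"
      proof (rule le_less_trans[OF emeasure_mono])
        show "{b / 2<..b} \<subseteq> {b / 2<..}" by auto
      qed (use emeasure_pd_intensity_Ioi_finite[OF assms(1), of "b / 2"] that in auto)
      ultimately have "\<theta> * exp (- \<epsilon>) / 2 \<le> measure (pd_intensity \<theta>) {b / 2<..b}"
        by (simp add: emeasure_eq_ennreal_measure)
      then show ?thesis using that by (subst (asm) measure_pd_intensity_Ioc[OF assms(1)]) auto
    qed
    have "?R 0 = \<theta> * exp (- \<epsilon>) + ?R 1"
      using cycle_rate_tail_Suc[OF assms, of 0] by (simp add: cycle_rate_def)
    also have "\<dots> \<le> \<theta> * exp (- \<epsilon>) + ?G \<epsilon>" using low[of 1] by simp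
    also have "\<dots> \<le> ?G (\<epsilon> / 4)" using half[of \<epsilon>] half[of "\<epsilon> / 2"] assms(2) by simp
    finally show ?thesis .
  qed
  have "\<exists>t. (if i = 0 then \<epsilon> / 4 else \<epsilon> * real i) \<le> t \<and> t \<le> \<epsilon> * real (Suc i) \<and> ?G t = ?R i" for i
  proof (rule IVT2')
    show "?R i \<le> ?G (if i = 0 then \<epsilon> / 4 else \<epsilon> * real i)" using low[of i] low0 by auto
    show "continuous_on {if i = 0 then \<epsilon> / 4 else \<epsilon> * real i..\<epsilon> * real (Suc i)} ?G"
      using assms by (intro continuous_on_pd_tail) auto
  qed (use up[of i] assms in auto)
  then obtain \<tau> where \<tau>: "\<And>i. (if i = 0 then \<epsilon> / 4 else \<epsilon> * real i) \<le> \<tau> i \<and> \<tau> i \<le> \<epsilon> * real (Suc i) \<and> ?G (\<tau> i) = ?R i"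
    by metis
  have "\<epsilon> * real i \<le> \<tau> i" for i using \<tau>[of i] assms by (cases "i = 0") auto
  then have "thresholds \<theta> \<epsilon> \<tau>" unfolding thresholds_def using \<tau> \<tau>[of 0] by auto
  then show thesis by (rule that)
qed

lemma
  assumes "thresholds \<theta> \<epsilon> \<tau>" "0 < \<theta>" "0 < \<epsilon>"
  shows thresholds_pos: "0 < \<tau> i"
    and thresholds_mono: "\<tau> i \<le> \<tau> (Suc i)"
    and measure_threshold_cell: "measure (pd_intensity \<theta>) {\<tau> i<..\<tau> (Suc i)} = cycle_rate \<theta> \<epsilon> (Suc i)"
proof -
  have t: "\<epsilon> / 4 \<le> \<tau> 0" "\<epsilon> * real i \<le> \<tau> i" "\<tau> i \<le> \<epsilon> * real (Suc i)" "\<epsilon> * real (Suc i) \<le> \<tau> (Suc i)"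
    "\<And>i. measure (pd_intensity \<theta>) {\<tau> i<..} = cycle_rate_tail \<theta> \<epsilon> i"
    using assms(1) unfolding thresholds_def by blast+
  show pos: "0 < \<tau> i"
  proof (cases "i = 0")
    case False
    then have "0 < \<epsilon> * real i" using assms by simp
    then show ?thesis using t(2) by linarith
  qed (use t(1) assms(3) in auto)
  show le: "\<tau> i \<le> \<tau> (Suc i)" using t(3,4) by linarith
  show "measure (pd_intensity \<theta>) {\<tau> i<..\<tau> (Suc i)} = cycle_rate \<theta> \<epsilon> (Suc i)"
    using measure_pd_intensity_Ioc[OF assms(2) pos le] cycle_rate_tail_Suc[OF assms(2,3), of i] by (simp add: t(5))
qed


section \<open>Counting points in cells\<close>

lemma down_closed_eq_lessThan:
  fixes S :: "nat set"
  assumes "finite S" "\<And>i j. j \<in> S \<Longrightarrow> i \<le> j \<Longrightarrow> i \<in> S"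
  shows "S = {..<card S}"
proof -
  define n where "n = (LEAST n. n \<notin> S)"
  have "\<exists>n. n \<notin> S" using assms(1) ex_new_if_finite infinite_UNIV_nat by blast
  then have "n \<notin> S" unfolding n_def by (rule LeastI_ex)
  then have "S \<subseteq> {..<n}" using assms(2)[of _ n] by (metis lessThan_iff not_le subsetI)
  moreover have "{..<n} \<subseteq> S" using not_less_Least unfolding n_def by blast
  ultimately have "S = {..<n}" by blast
  then show ?thesis by simp
qed

text \<open>Counts the thresholds below x, so cell i + 1 is the interval from \<tau> i, excluded, to
  \<tau> (i + 1), included; points up to \<tau> 0 fall into cell 0.\<close>

definition cell :: "(nat \<Rightarrow> real) \<Rightarrow> real \<Rightarrow> nat" where
  "cell \<tau> x = card {t. \<tau> t < x}"

text \<open>Cell 0 is discarded: it collects all but finitely many points, and a partition has no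
  parts of size 0.\<close>

definition cell_counts :: "(nat \<Rightarrow> real) \<Rightarrow> (nat \<Rightarrow> real) \<Rightarrow> nat \<Rightarrow> nat" where
  "cell_counts \<tau> J i = (if i = 0 then 0 else card {k. cell \<tau> (J k) = i})"

definition good_points :: "(nat \<Rightarrow> real) \<Rightarrow> bool" where
  "good_points J \<longleftrightarrow> (\<forall>k. J (Suc k) < J k \<and> 0 < J k) \<and> summable J"

lemma good_points_antimono: "good_points J \<Longrightarrow> j \<le> k \<Longrightarrow> J k \<le> J j"
  by (rule lift_Suc_antimono_le[of J]) (auto simp: good_points_def less_imp_le)

lemma finite_good_points_above:
  assumes "good_points J" "0 < x"
  shows "finite {k. x < J k}"
proof -
  have "J \<longlonglongrightarrow> 0" using assms(1) by (auto simp: good_points_def intro: summable_LIMSEQ_zero)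
  then have "\<forall>\<^sub>F k in sequentially. J k < x" using assms(2) by (rule order_tendstoD)
  then obtain K where K: "\<And>k. K \<le> k \<Longrightarrow> J k < x" unfolding eventually_sequentially by blast
  have "{k. x < J k} \<subseteq> {..<K}"
  proof
    fix k assume "k \<in> {k. x < J k}"
    then have "\<not> K \<le> k" using K[of k] by auto
    then show "k \<in> {..<K}" by simp
  qed
  then show ?thesis by (rule finite_subset) simp
qed

context
  fixes \<theta> \<epsilon> :: real and \<tau> :: "nat \<Rightarrow> real"
  assumes th: "thresholds \<theta> \<epsilon> \<tau>" and pos: "0 < \<theta>" "0 < \<epsilon>"
begin

lemma thresholds_monoD: "s \<le> t \<Longrightarrow> \<tau> s \<le> \<tau> t"
  by (rule lift_Suc_mono_le[of \<tau>]) (rule thresholds_mono[OF th pos])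

lemma less_cell_iff: "t < cell \<tau> x \<longleftrightarrow> \<tau> t < x"
proof -
  have "{t. \<tau> t < x} \<subseteq> {..nat \<lceil>x / \<epsilon>\<rceil>}"
  proof
    fix t assume "t \<in> {t. \<tau> t < x}"
    moreover have "\<epsilon> * real t \<le> \<tau> t" using th by (simp add: thresholds_def)
    ultimately have "real t \<le> x / \<epsilon>" using pos by (simp add: field_simps)
    then show "t \<in> {..nat \<lceil>x / \<epsilon>\<rceil>}" by (simp add: le_nat_iff) linarith
  qed
  then have "finite {t. \<tau> t < x}" by (rule finite_subset) simp
  then have "{t. \<tau> t < x} = {..<cell \<tau> x}"
    unfolding cell_def by (rule down_closed_eq_lessThan) (use thresholds_monoD in \<open>fastforce intro: le_less_trans\<close>)
  then show ?thesis by blast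
qed

lemma cell_eq_Suc_iff: "cell \<tau> x = Suc i \<longleftrightarrow> \<tau> i < x \<and> x \<le> \<tau> (Suc i)"
proof -
  have "cell \<tau> x = Suc i \<longleftrightarrow> i < cell \<tau> x \<and> \<not> Suc i < cell \<tau> x" by auto
  then show ?thesis unfolding less_cell_iff by auto
qed

text \<open>The first bound gives convergence of each point as the mesh shrinks; the second, which
  uses \<epsilon> / 4 \<le> \<tau> 0, gives a summable majorant over all points, as an error
  \<epsilon> per point could not.\<close>

lemma cell_approx:
  assumes "0 < x"
  shows "\<bar>\<epsilon> * real (cell \<tau> x) - x\<bar> \<le> \<epsilon>" "\<epsilon> * real (cell \<tau> x) \<le> 4 * x"
proof -
  have t: "\<epsilon> / 4 \<le> \<tau> 0" "\<epsilon> * real i \<le> \<tau> i" "\<tau> i \<le> \<epsilon> * real (Suc i)" for i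
    using th by (auto simp: thresholds_def)
  have up: "x \<le> \<tau> (cell \<tau> x)" using less_cell_iff[of "cell \<tau> x" x] by simp
  have "\<bar>\<epsilon> * real (cell \<tau> x) - x\<bar> \<le> \<epsilon> \<and> \<epsilon> * real (cell \<tau> x) \<le> 4 * x"
  proof (cases "cell \<tau> x")
    case 0
    then show ?thesis using up t(3)[of 0] assms by simp
  next
    case (Suc i)
    then have low: "\<tau> i < x" using cell_eq_Suc_iff by blast
    have 1: "\<epsilon> * real i < x" using low t(2)[of i] by linarith
    have 2: "x \<le> \<epsilon> * real (Suc (Suc i))" using up t(3)[of "Suc i"] Suc by simp
    have "\<epsilon> * real (Suc i) \<le> 4 * x"
    proof (cases i)
      case 0
      then show ?thesis using low t(1) by simp
    next
      case (Suc j)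
      have "\<epsilon> * real (Suc i) \<le> \<epsilon> * (2 * real i)" using pos Suc by (intro mult_left_mono) auto
      then show ?thesis using 1 assms by linarith
    qed
    then show ?thesis using 1 2 Suc by (auto simp: algebra_simps abs_le_iff)
  qed
  then show "\<bar>\<epsilon> * real (cell \<tau> x) - x\<bar> \<le> \<epsilon>" "\<epsilon> * real (cell \<tau> x) \<le> 4 * x" by auto
qed

context
  fixes J assumes J: "good_points J"
begin

lemma finite_cell_ge: "finite {k. Suc t \<le> cell \<tau> (J k)}"
  unfolding Suc_le_eq less_cell_iff
  by (rule finite_good_points_above[OF J]) (rule thresholds_pos[OF th pos])

lemma finite_cell_eq: "finite {k. cell \<tau> (J k) = Suc i}"
  by (rule finite_subset[OF _ finite_cell_ge[of 0]]) auto

lemma finite_support_cell_counts: "finite {i. cell_counts \<tau> J i \<noteq> 0}"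
proof (rule finite_subset)
  show "{i. cell_counts \<tau> J i \<noteq> 0} \<subseteq> (\<lambda>k. cell \<tau> (J k)) ` {k. Suc 0 \<le> cell \<tau> (J k)}"
  proof
    fix i assume "i \<in> {i. cell_counts \<tau> J i \<noteq> 0}"
    then have i: "i \<noteq> 0" "card {k. cell \<tau> (J k) = i} \<noteq> 0" by (auto simp: cell_counts_def split: if_splits)
    then have "{k. cell \<tau> (J k) = i} \<noteq> {}" by (metis card.empty)
    with i(1) show "i \<in> (\<lambda>k. cell \<tau> (J k)) ` {k. Suc 0 \<le> cell \<tau> (J k)}" by auto
  qed
qed (rule finite_imageI[OF finite_cell_ge])

lemma tail_count_cell_counts: "tail_count (cell_counts \<tau> J) (Suc t) = card {k. \<tau> t < J k}"
proof -
  let ?S = "{i. cell_counts \<tau> J i \<noteq> 0 \<and> Suc t \<le> i}"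
  have "tail_count (cell_counts \<tau> J) (Suc t) = (\<Sum>i\<in>?S. card {k. cell \<tau> (J k) = i})"
    unfolding tail_count_def by (intro sum.cong) (auto simp: cell_counts_def)
  also have "\<dots> = card (\<Union>i\<in>?S. {k. cell \<tau> (J k) = i})"
  proof (rule card_UN_disjoint[symmetric])
    show "finite ?S" by (rule finite_subset[OF _ finite_support_cell_counts]) auto
    show "\<forall>i\<in>?S. finite {k. cell \<tau> (J k) = i}"
    proof
      fix i assume "i \<in> ?S"
      then obtain j where "i = Suc j" by (cases i) auto
      then show "finite {k. cell \<tau> (J k) = i}" using finite_cell_eq by simp
    qed
  qed auto
  also have "(\<Union>i\<in>?S. {k. cell \<tau> (J k) = i}) = {k. Suc t \<le> cell \<tau> (J k)}"
  proof (intro equalityI subsetI)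
    fix k assume k: "k \<in> {k. Suc t \<le> cell \<tau> (J k)}"
    define i where "i = cell \<tau> (J k)"
    obtain j where j: "i = Suc j" using k unfolding i_def by (cases "cell \<tau> (J k)") auto
    have "k \<in> {k. cell \<tau> (J k) = i}" by (simp add: i_def)
    then have "cell_counts \<tau> J i \<noteq> 0"
      using finite_cell_eq[of j] j by (auto simp: cell_counts_def)
    then show "k \<in> (\<Union>i\<in>?S. {k. cell \<tau> (J k) = i})" using k by (auto simp: i_def)
  qed auto
  also have "\<dots> = {k. \<tau> t < J k}" unfolding Suc_le_eq less_cell_iff ..
  finally show ?thesis .
qed

text \<open>No sorting takes place: the points decrease, so those above a threshold are exactly the
  first ones, and their number is the column height of the partition.\<close>

lemma longest_part_cell_counts: "longest_part (cell_counts \<tau> J) (Suc k) = cell \<tau> (J k)"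
proof -
  have "Suc t \<le> longest_part (cell_counts \<tau> J) (Suc k) \<longleftrightarrow> Suc t \<le> cell \<tau> (J k)" for t
  proof -
    have "{k. \<tau> t < J k} = {..<card {k. \<tau> t < J k}}"
    proof (rule down_closed_eq_lessThan)
      show "finite {k. \<tau> t < J k}"
        by (rule finite_good_points_above[OF J]) (rule thresholds_pos[OF th pos])
      fix i j assume "j \<in> {k. \<tau> t < J k}" "i \<le> j"
      then show "i \<in> {k. \<tau> t < J k}" using good_points_antimono[OF J, of i j] by auto
    qed
    then have "k < card {k. \<tau> t < J k} \<longleftrightarrow> \<tau> t < J k" by blast
    then show ?thesis
      using le_longest_part_iff[OF finite_support_cell_counts, of "Suc t" k]
      by (simp add: tail_count_cell_counts Suc_le_eq[of t "cell \<tau> (J k)"] less_cell_iff)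
  qed
  then have "t \<le> longest_part (cell_counts \<tau> J) (Suc k) \<longleftrightarrow> t \<le> cell \<tau> (J k)" for t
    by (cases t) auto
  then show ?thesis by (meson order_antisym order_refl)
qed

lemma cell_counts_in_partitions: "\<exists>n. cell_counts \<tau> J \<in> partitions n"
proof -
  obtain m where m: "\<forall>i>m. cell_counts \<tau> J i = 0"
    using common_bound[OF finite_support_cell_counts finite_support_cell_counts] by metis
  let ?n = "\<Sum>i=1..m. i * cell_counts \<tau> J i"
  have z: "cell_counts \<tau> J i = 0" if "i \<notin> {1..?n}" for i
  proof (rule ccontr)
    assume nz: "cell_counts \<tau> J i \<noteq> 0"
    then have "i \<noteq> 0" by (auto simp: cell_counts_def split: if_splits)
    moreover have "i \<le> m" using m nz by (metis not_le)
    ultimately have "i * cell_counts \<tau> J i \<le> ?n" by (intro member_le_sum) auto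
    moreover have "i \<le> i * cell_counts \<tau> J i" using nz by simp
    ultimately have "i \<le> ?n" by (rule order_trans[rotated])
    then show False using that \<open>i \<noteq> 0\<close> by auto
  qed
  have "(\<Sum>i=1..?n. i * cell_counts \<tau> J i) = (\<Sum>i\<in>{1..?n} \<union> {1..m}. i * cell_counts \<tau> J i)"
    by (intro sum.mono_neutral_left) (use z in auto)
  also have "\<dots> = ?n" by (intro sum.mono_neutral_right) (use m in auto)
  finally have "cell_counts \<tau> J \<in> partitions ?n" unfolding partitions_def using z by blast
  then show ?thesis by blast
qed

lemma point_count_cell:
  "point_count (\<lambda>k J. J k) {\<tau> i<..\<tau> (Suc i)} J = of_nat (cell_counts \<tau> J (Suc i))"
  unfolding point_count_def greaterThanAtMost_iff cell_eq_Suc_iff[symmetric]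
  using finite_cell_eq by (simp add: emeasure_count_space_finite cell_counts_def)

lemma point_count_above:
  "point_count (\<lambda>k J. J k) {\<tau> i<..} J = 0 \<longleftrightarrow> (\<forall>j>i. cell_counts \<tau> J j = 0)"
proof -
  have "point_count (\<lambda>k J. J k) {\<tau> i<..} J = of_nat (tail_count (cell_counts \<tau> J) (Suc i))"
    unfolding point_count_def greaterThan_iff tail_count_cell_counts
    using finite_good_points_above[OF J thresholds_pos[OF th pos]] by (simp add: emeasure_count_space_finite)
  also have "\<dots> = 0 \<longleftrightarrow> (\<forall>j>i. cell_counts \<tau> J j = 0)"
    unfolding tail_count_def using finite_support_cell_counts by (auto simp: Suc_le_eq)
  finally show ?thesis .
qed

text \<open>Confines the event to n + 1 disjoint sets of finite intensity; the unbounded last one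
  rules out all parts larger than n at once.\<close>

lemma cell_counts_eq_iff:
  assumes "\<alpha> \<in> partitions n"
  shows "cell_counts \<tau> J = \<alpha> \<longleftrightarrow>
    (\<forall>i<n. point_count (\<lambda>k J. J k) {\<tau> i<..\<tau> (Suc i)} J = of_nat (\<alpha> (Suc i))) \<and>
    point_count (\<lambda>k J. J k) {\<tau> n<..} J = 0"
proof -
  have \<alpha>: "\<alpha> i = 0" if "i \<notin> {1..n}" for i using assms that by (auto simp: partitions_def)
  have "cell_counts \<tau> J = \<alpha> \<longleftrightarrow> (\<forall>i<n. cell_counts \<tau> J (Suc i) = \<alpha> (Suc i)) \<and> (\<forall>j>n. cell_counts \<tau> J j = 0)"
  proof (intro iffI conjI ext; (elim conjE)?)
    fix i assume *: "\<forall>i<n. cell_counts \<tau> J (Suc i) = \<alpha> (Suc i)" "\<forall>j>n. cell_counts \<tau> J j = 0"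
    show "cell_counts \<tau> J i = \<alpha> i"
    proof (cases i)
      case 0
      then show ?thesis using \<alpha>[of 0] by (simp add: cell_counts_def)
    next
      case (Suc j)
      then show ?thesis using * \<alpha>[of i] by (cases "j < n") auto
    qed
  qed (use \<alpha> in auto)
  then show ?thesis unfolding point_count_cell point_count_above by simp
qed

end
end

lemma ell1_nth_cell_counts:
  assumes "thresholds \<theta> \<epsilon> \<tau>" "0 < \<theta>" "0 < \<epsilon>" "good_points J"
  shows "ell1_nth (longest_parts (cell_counts \<tau> J)) k = real (cell \<tau> (J k))"
  using longest_part_cell_counts[OF assms] by (simp add: ell1_nth_longest_parts)


section \<open>Summability of the points\<close>

lemma poisson_weights_sums: "(\<lambda>j. l ^ j / fact j * exp (- l)) sums (1::real)"
proof -
  have "exp l * exp (- l) = 1" by (simp add: mult_exp_exp)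
  then show ?thesis
    using sums_mult2[OF exp_converges[of l], of "exp (- l)"] by (simp add: divide_inverse mult.commute)
qed

lemma poisson_mean_sums: "(\<lambda>j. real j * (l ^ j / fact j * exp (- l))) sums l"
proof -
  have "real (Suc j) * (l ^ Suc j / fact (Suc j) * exp (- l)) = l * (l ^ j / fact j * exp (- l))" for j
    by (simp del: of_nat_Suc)
  then have "(\<lambda>j. real (Suc j) * (l ^ Suc j / fact (Suc j) * exp (- l))) sums l"
    using sums_mult[OF poisson_weights_sums[of l], of l] by (simp only: mult_1_right)
  then show ?thesis by (subst (asm) sums_Suc_iff) simp
qed

locale pd_points = prob_space Q for Q :: "(nat \<Rightarrow> real) measure" +
  fixes \<theta> :: real
  assumes theta_pos: "0 < \<theta>"
    and sets_Q: "sets Q = sets (\<Pi>\<^sub>M k\<in>UNIV. borel)"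
    and points: "poisson_points Q (pd_intensity \<theta>) (\<lambda>k J. J k)"
    and decreasing: "AE J in Q. \<forall>k. J (Suc k) < J k \<and> 0 < J k"
begin

abbreviation count :: "real set \<Rightarrow> (nat \<Rightarrow> real) \<Rightarrow> ennreal" where
  "count \<equiv> point_count (\<lambda>k J. J k)"

lemma space_Q: "space Q = UNIV"
  using sets_eq_imp_space_eq[OF sets_Q] by (simp add: space_PiM)

lemma indep_counts:
  fixes I :: "nat set"
  assumes "finite I" "\<And>i. i \<in> I \<Longrightarrow> A i \<in> sets borel" "disjoint_family_on A I"
  shows "indep_vars (\<lambda>_. borel) (\<lambda>i. count (A i)) I"
  using points assms unfolding poisson_points_def by simp

lemma measurable_count [measurable]:
  assumes "A \<in> sets borel" shows "count A \<in> borel_measurable Q"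
  using indep_counts[of "{0}" "\<lambda>_. A"] assms by (auto simp: indep_vars_def disjoint_family_on_def)

lemma prob_count:
  assumes "A \<in> sets borel" "emeasure (pd_intensity \<theta>) A < \<infinity>"
  shows "prob {J. count A J = of_nat j} =
    measure (pd_intensity \<theta>) A ^ j / fact j * exp (- measure (pd_intensity \<theta>) A)"
  using points assms unfolding poisson_points_def by (simp add: space_Q)

lemma events_count: "A \<in> sets borel \<Longrightarrow> {J. count A J = c} \<in> events"
  using borel_measurable_eq[OF measurable_count measurable_const, of A c] by (simp add: space_Q)

text \<open>The Poisson probabilities of the natural values already add up to one, which excludes
  the value infinity.\<close>

lemma AE_count_nat:
  assumes "A \<in> sets borel" "emeasure (pd_intensity \<theta>) A < \<infinity>"
  shows "AE J in Q. \<exists>j. count A J = of_nat j"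
proof -
  let ?l = "measure (pd_intensity \<theta>) A"
  have "(\<lambda>j. prob {J. count A J = of_nat j}) sums prob (\<Union>j. {J. count A J = of_nat j})"
    by (intro finite_measure_UNION) (auto intro: events_count assms simp: disjoint_family_on_def)
  then have "prob (\<Union>j. {J. count A J = of_nat j}) = 1"
    unfolding prob_count[OF assms] using sums_unique2 poisson_weights_sums by blast
  moreover have "(\<Union>j. {J. count A J = of_nat j}) \<in> events" using events_count[OF assms(1)] by auto
  ultimately have "AE J in Q. J \<in> (\<Union>j. {J. count A J = of_nat j})" by (intro AE_prob_1)
  then show ?thesis by auto
qed

lemma nn_integral_count:
  assumes "A \<in> sets borel" "emeasure (pd_intensity \<theta>) A < \<infinity>"
  shows "(\<integral>\<^sup>+J. count A J \<partial>Q) = emeasure (pd_intensity \<theta>) A"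
proof -
  let ?l = "measure (pd_intensity \<theta>) A"
  let ?E = "\<lambda>j. {J. count A J = of_nat j}"
  let ?p = "\<lambda>j. ?l ^ j / fact j * exp (- ?l)"
  have s: "(\<lambda>j. real j * ?p j) sums ?l" by (rule poisson_mean_sums)
  have "(\<integral>\<^sup>+J. count A J \<partial>Q) = (\<integral>\<^sup>+J. (\<Sum>j. of_nat j * indicator (?E j) J) \<partial>Q)"
  proof (rule nn_integral_cong_AE)
    show "AE J in Q. count A J = (\<Sum>j. of_nat j * indicator (?E j) J)"
      using AE_count_nat[OF assms]
    proof eventually_elim
      case (elim J)
      then obtain i where i: "count A J = of_nat i" by blast
      have "(\<Sum>j. of_nat j * indicator (?E j) J :: ennreal) = (\<Sum>j\<in>{i}. of_nat j * indicator (?E j) J)"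
        by (rule suminf_finite) (auto simp: i)
      then show ?case by (simp add: i)
    qed
  qed
  also have "\<dots> = (\<Sum>j. \<integral>\<^sup>+J. of_nat j * indicator (?E j) J \<partial>Q)"
    using events_count[OF assms(1)] by (intro nn_integral_suminf) auto
  also have "\<dots> = (\<Sum>j. ennreal (real j * ?p j))"
  proof (intro suminf_cong)
    fix j
    have "(\<integral>\<^sup>+J. of_nat j * indicator (?E j) J \<partial>Q) = of_nat j * ennreal (?p j)"
      using events_count[OF assms(1)]
      by (subst nn_integral_cmult_indicator) (simp_all add: emeasure_eq_measure prob_count[OF assms])
    then show "(\<integral>\<^sup>+J. of_nat j * indicator (?E j) J \<partial>Q) = ennreal (real j * ?p j)"
      by (subst ennreal_mult) (auto simp: ennreal_of_nat_eq_real_of_nat)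
  qed
  also have "\<dots> = ennreal ?l"
    using s by (subst suminf_ennreal2) (auto simp: sums_iff)
  also have "\<dots> = emeasure (pd_intensity \<theta>) A"
    using assms(2) by (intro emeasure_eq_ennreal_measure[symmetric]) auto
  finally show ?thesis .
qed

text \<open>Each dyadic shell of points between (1/2)^(j+1) and (1/2)^j has intensity at most
  \<theta>. Rounding the points up to the outer radius, the expected sum of those up to 1 is at most
  2 \<theta>.\<close>

lemma AE_summable: "AE J in Q. summable J"
proof -
  let ?I = "\<lambda>j::nat. {(1/2) ^ Suc j<..(1/2) ^ j :: real}"
  have fin: "emeasure (pd_intensity \<theta>) (?I j) \<le> ennreal \<theta>" for j
  proof -
    have "emeasure (pd_intensity \<theta>) (?I j) \<le> ennreal (\<theta> * ((1/2) ^ j - (1/2) ^ Suc j) * exp (- ((1/2) ^ Suc j)) / (1/2) ^ Suc j)"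
      using theta_pos by (intro emeasure_pd_intensity_Ioc) (auto intro: power_decreasing)
    also have "\<theta> * ((1/2) ^ j - (1/2) ^ Suc j) * exp (- ((1/2) ^ Suc j)) / (1/2) ^ Suc j = \<theta> * exp (- ((1/2) ^ Suc j))"
      by (simp add: field_simps)
    also have "ennreal \<dots> \<le> ennreal (\<theta> * 1)"
      using theta_pos by (intro ennreal_leI mult_left_mono) auto
    finally show ?thesis by simp
  qed
  have "(\<integral>\<^sup>+J. (\<Sum>j. ennreal ((1/2) ^ j) * count (?I j) J) \<partial>Q) = (\<Sum>j. ennreal ((1/2) ^ j) * emeasure (pd_intensity \<theta>) (?I j))"
    using fin[THEN le_less_trans] by (subst nn_integral_suminf) (auto simp: nn_integral_cmult nn_integral_count)
  also have "\<dots> \<le> (\<Sum>j. ennreal ((1/2) ^ j * \<theta>))"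
  proof (rule suminf_le)
    show "ennreal ((1/2) ^ j) * emeasure (pd_intensity \<theta>) (?I j) \<le> ennreal ((1/2) ^ j * \<theta>)" for j
      using theta_pos mult_left_mono[OF fin[of j], of "ennreal ((1/2) ^ j)"]
      by (subst ennreal_mult) auto
  qed auto
  also have "\<dots> = ennreal (\<Sum>j. (1/2) ^ j * \<theta>)"
    using theta_pos by (intro suminf_ennreal2 summable_mult2 summable_geometric) auto
  also have "\<dots> < \<infinity>" by simp
  finally have "AE J in Q. (\<Sum>j. ennreal ((1/2) ^ j) * count (?I j) J) \<noteq> \<infinity>"
    by (intro nn_integral_noteq_infinite) auto
  moreover have "AE J in Q. \<exists>j. count {1<..} J = of_nat j"
    using emeasure_pd_intensity_Ioi_finite[OF theta_pos, of 1] by (intro AE_count_nat) auto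
  ultimately show ?thesis
    using decreasing
  proof eventually_elim
    case (elim J)
    have pos: "0 < J k" for k using elim(3) by blast
    \<comment> \<open>Only finitely many points exceed 1, so it suffices to sum the others.\<close>
    have "finite {k. 1 < J k}"
      using elim(2) by (auto simp: point_count_def emeasure_count_space split: if_splits)
    then obtain K where K: "{k. 1 < J k} \<subseteq> {..<K}" by (auto simp: finite_nat_iff_bounded)
    have "(\<integral>\<^sup>+k. ennreal (J k * of_bool (J k \<le> 1)) \<partial>count_space UNIV) \<le>
        (\<integral>\<^sup>+k. (\<Sum>j. ennreal ((1/2) ^ j) * indicator {k. J k \<in> ?I j} k) \<partial>count_space UNIV)"
    proof (rule nn_integral_mono)
      fix k
      show "ennreal (J k * of_bool (J k \<le> 1)) \<le> (\<Sum>j. ennreal ((1/2) ^ j) * indicator {k. J k \<in> ?I j} k)"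
      proof (cases "J k \<le> 1")
        case True
        have ex: "\<exists>j. (1/2) ^ Suc j < J k"
        proof -
          obtain i where "(1/2) ^ i < J k" using real_arch_pow_inv[OF pos[of k], of "1/2"] by auto
          moreover have "(1/2) ^ Suc i \<le> ((1/2) ^ i :: real)" by simp
          ultimately show ?thesis by (blast intro: le_less_trans)
        qed
        define j where "j = (LEAST j. (1/2) ^ Suc j < J k)"
        have j1: "(1/2) ^ Suc j < J k" unfolding j_def using ex by (rule LeastI_ex)
        have j2: "J k \<le> (1/2) ^ j"
        proof (cases j)
          case (Suc i)
          then have "\<not> (1/2) ^ Suc i < J k" using not_less_Least[of i "\<lambda>j. (1/2) ^ Suc j < J k"] by (simp add: j_def)
          then show ?thesis using Suc by simp
        qed (use True in simp)
        have "ennreal (J k * of_bool (J k \<le> 1)) \<le> (\<Sum>j\<in>{j}. ennreal ((1/2) ^ j) * indicator {k. J k \<in> ?I j} k)"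
          using j1 j2 True by (auto intro: ennreal_leI)
        also have "\<dots> \<le> (\<Sum>j. ennreal ((1/2) ^ j) * indicator {k. J k \<in> ?I j} k)"
          by (intro sum_le_suminf) auto
        finally show ?thesis .
      qed simp
    qed
    also have "\<dots> = (\<Sum>j. ennreal ((1/2) ^ j) * count (?I j) J)"
      by (subst nn_integral_suminf) (auto simp: nn_integral_cmult_indicator point_count_def)
    also have "\<dots> < \<infinity>" using elim(1) by (simp add: less_top)
    finally have "integrable (count_space UNIV) (\<lambda>k. J k * of_bool (J k \<le> 1))"
      using pos by (intro integrableI_nonneg) (auto intro: less_imp_le)
    then have "summable (\<lambda>k. J k * of_bool (J k \<le> 1))"
      by (simp add: integrable_count_space_nat_iff summable_norm_cancel)
    moreover have "\<forall>\<^sub>F k in sequentially. J k * of_bool (J k \<le> 1) = J k"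
      using eventually_ge_at_top[of K]
    proof eventually_elim
      case (elim k)
      then have "k \<notin> {k. 1 < J k}" using K by auto
      then show ?case by simp
    qed
    ultimately show "summable J" using summable_cong by fast
  qed
qed

lemma AE_good_points: "AE J in Q. good_points J"
  using AE_summable decreasing by eventually_elim (simp add: good_points_def)

end


section \<open>The law of the cell counts\<close>

lemma partitions_disjoint:
  assumes "\<alpha> \<in> partitions n" "\<alpha> \<in> partitions m" shows "n = m"
  using partitions_sum_mono[OF assms(1), of "max n m"] partitions_sum_mono[OF assms(2), of "max n m"] by simp

lemma cycle_rate_tail_eq:
  assumes "0 < \<theta>" "0 < \<epsilon>"
  shows "(\<Sum>i<n. cycle_rate \<theta> \<epsilon> (Suc i)) + cycle_rate_tail \<theta> \<epsilon> n = cycle_rate_tail \<theta> \<epsilon> 0"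
  by (induction n) (simp_all add: cycle_rate_tail_Suc[OF assms, symmetric] add.assoc)

text \<open>The factors exp (- \<epsilon> i) collect to exp (- \<epsilon> n), which depends on the
  size alone; hence the conditional law given the size is exactly Ewens.\<close>

lemma prod_cycle_rate:
  assumes "\<alpha> \<in> partitions n"
  shows "(\<Prod>i<n. cycle_rate \<theta> \<epsilon> (Suc i) ^ \<alpha> (Suc i) / fact (\<alpha> (Suc i))) = exp (- \<epsilon> * real n) * ewens_weight \<theta> n \<alpha>"
proof -
  have "(\<Prod>i<n. cycle_rate \<theta> \<epsilon> (Suc i) ^ \<alpha> (Suc i) / fact (\<alpha> (Suc i))) =
      (\<Prod>i=1..n. cycle_rate \<theta> \<epsilon> i ^ \<alpha> i / fact (\<alpha> i))"
    by (simp add: prod.atLeast1_atMost_eq)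
  also have "\<dots> = (\<Prod>i=1..n. exp (- \<epsilon> * real (i * \<alpha> i)) * (\<theta> ^ \<alpha> i / (real i ^ \<alpha> i * fact (\<alpha> i))))"
  proof (intro prod.cong refl)
    fix i
    have "exp (- \<epsilon> * real i) ^ \<alpha> i = exp (- \<epsilon> * real (i * \<alpha> i))"
      by (simp add: exp_of_nat_mult[symmetric] mult_ac)
    then show "cycle_rate \<theta> \<epsilon> i ^ \<alpha> i / fact (\<alpha> i) = exp (- \<epsilon> * real (i * \<alpha> i)) * (\<theta> ^ \<alpha> i / (real i ^ \<alpha> i * fact (\<alpha> i)))"
      by (simp add: cycle_rate_def power_divide power_mult_distrib)
  qed
  also have "\<dots> = exp (\<Sum>i=1..n. - \<epsilon> * real (i * \<alpha> i)) * ewens_weight \<theta> n \<alpha>"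
    by (simp only: prod.distrib ewens_weight_def exp_sum[OF finite_atLeastAtMost])
  also have "(\<Sum>i=1..n. - \<epsilon> * real (i * \<alpha> i)) = - \<epsilon> * real n"
    using partitions_sum_real[OF assms] by (simp add: sum_distrib_left[symmetric] sum_negf)
  finally show ?thesis .
qed

definition ewens_mixture :: "real \<Rightarrow> real \<Rightarrow> ((nat \<Rightarrow> nat) \<Rightarrow> real) \<Rightarrow> nat \<Rightarrow> real" where
  "ewens_mixture \<theta> \<epsilon> \<phi> n =
     exp (- cycle_rate_tail \<theta> \<epsilon> 0) * exp (- \<epsilon> * real n) * (\<Sum>\<alpha>\<in>partitions n. \<phi> \<alpha> * ewens_weight \<theta> n \<alpha>)"

text \<open>Measurable set of full measure on which all pointwise statements about good points hold;
  integrands carry \<open>indicator G\<close> because the cell counts are controlled only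
  there.\<close>

locale pd_points_good = pd_points +
  fixes G :: "(nat \<Rightarrow> real) set"
  assumes events_G: "G \<in> events" and AE_G: "AE J in Q. J \<in> G" and good_G: "\<And>J. J \<in> G \<Longrightarrow> good_points J"
begin

context
  fixes \<epsilon> :: real and \<tau> :: "nat \<Rightarrow> real"
  assumes th: "thresholds \<theta> \<epsilon> \<tau>" and eps_pos: "0 < \<epsilon>"
begin

text \<open>Phrased by point counts rather than by \<open>cell_counts\<close>, which gives
  measurability and probability directly; on \<open>G\<close> the two descriptions agree.\<close>

definition counts_event :: "nat \<Rightarrow> (nat \<Rightarrow> nat) \<Rightarrow> (nat \<Rightarrow> real) set" where
  "counts_event n \<alpha> = {J. (\<forall>i<n. count {\<tau> i<..\<tau> (Suc i)} J = of_nat (\<alpha> (Suc i))) \<and> count {\<tau> n<..} J = 0}"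

lemma counts_event:
  assumes "\<alpha> \<in> partitions n"
  shows counts_event_sets: "counts_event n \<alpha> \<in> events"
    and prob_counts_event: "prob (counts_event n \<alpha>) =
      exp (- cycle_rate_tail \<theta> \<epsilon> 0) * exp (- \<epsilon> * real n) * ewens_weight \<theta> n \<alpha>"
proof -
  \<comment> \<open>The n bounded cells and the unbounded remainder as one family, so that
    independence is applied once.\<close>
  define A where "A i = (if i < n then {\<tau> i<..\<tau> (Suc i)} else {\<tau> i<..})" for i
  define b where "b i = (if i < n then \<alpha> (Suc i) else 0)" for i
  note pos = thresholds_pos[OF th theta_pos eps_pos]
  have A: "A i \<in> sets borel" for i by (simp add: A_def)
  have fin: "emeasure (pd_intensity \<theta>) (A i) < \<infinity>" for i
    by (rule le_less_trans[OF emeasure_mono emeasure_pd_intensity_Ioi_finite[OF theta_pos pos[of i]]])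
       (auto simp: A_def)
  have disj: "disjoint_family_on A {..n}"
    unfolding disjoint_family_on_def
  proof (intro ballI impI)
    have "A i \<inter> A j = {}" if "i < j" "j \<le> n" for i j
    proof -
      have "\<tau> (Suc i) \<le> \<tau> j" using that by (intro thresholds_monoD[OF th theta_pos eps_pos]) auto
      then show ?thesis using that by (auto simp: A_def)
    qed
    then show "A i \<inter> A j = {}" if "i \<in> {..n}" "j \<in> {..n}" "i \<noteq> j" for i j
      using that by (metis Int_commute atMost_iff nat_neq_iff)
  qed
  have eq: "counts_event n \<alpha> = (\<Inter>i\<in>{..n}. count (A i) -` {of_nat (b i)} \<inter> space Q)"
  proof -
    have "(\<forall>i\<le>n. count (A i) J = of_nat (b i)) \<longleftrightarrow>
        (\<forall>i<n. count {\<tau> i<..\<tau> (Suc i)} J = of_nat (\<alpha> (Suc i))) \<and> count {\<tau> n<..} J = 0" for J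
      unfolding A_def b_def by (auto simp: le_less)
    then show ?thesis by (auto simp: counts_event_def space_Q)
  qed
  show "counts_event n \<alpha> \<in> events"
    unfolding eq using measurable_count[OF A] by (intro sets.finite_INT measurable_sets) auto
  have "prob (counts_event n \<alpha>) = (\<Prod>i\<in>{..n}. prob (count (A i) -` {of_nat (b i)} \<inter> space Q))"
    unfolding eq by (rule indep_varsD[OF indep_counts[OF _ A disj]]) auto
  also have "\<dots> = (\<Prod>i\<le>n. measure (pd_intensity \<theta>) (A i) ^ b i / fact (b i) * exp (- measure (pd_intensity \<theta>) (A i)))"
    by (intro prod.cong refl, subst prob_count[OF A fin, symmetric]) (simp add: space_Q vimage_def)
  also have "\<dots> = (\<Prod>i<n. cycle_rate \<theta> \<epsilon> (Suc i) ^ \<alpha> (Suc i) / fact (\<alpha> (Suc i)) * exp (- cycle_rate \<theta> \<epsilon> (Suc i))) *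
      exp (- cycle_rate_tail \<theta> \<epsilon> n)"
  proof -
    have "measure (pd_intensity \<theta>) {\<tau> n<..} = cycle_rate_tail \<theta> \<epsilon> n" using th by (simp add: thresholds_def)
    then show ?thesis
      unfolding lessThan_Suc_atMost[symmetric] prod.lessThan_Suc
      by (simp add: A_def b_def measure_threshold_cell[OF th theta_pos eps_pos])
  qed
  also have "\<dots> = exp (- \<epsilon> * real n) * ewens_weight \<theta> n \<alpha> *
      (exp (\<Sum>i<n. - cycle_rate \<theta> \<epsilon> (Suc i)) * exp (- cycle_rate_tail \<theta> \<epsilon> n))"
    by (simp only: prod.distrib prod_cycle_rate[OF assms] exp_sum[OF finite_lessThan] mult.assoc)
  also have "exp (\<Sum>i<n. - cycle_rate \<theta> \<epsilon> (Suc i)) * exp (- cycle_rate_tail \<theta> \<epsilon> n) = exp (- cycle_rate_tail \<theta> \<epsilon> 0)"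
    using cycle_rate_tail_eq[OF theta_pos eps_pos, of n] by (simp add: mult_exp_exp sum_negf)
  finally show "prob (counts_event n \<alpha>) =
      exp (- cycle_rate_tail \<theta> \<epsilon> 0) * exp (- \<epsilon> * real n) * ewens_weight \<theta> n \<alpha>" by (simp add: mult_ac)
qed

lemma counts_event_iff:
  "J \<in> G \<Longrightarrow> \<alpha> \<in> partitions n \<Longrightarrow> J \<in> counts_event n \<alpha> \<longleftrightarrow> cell_counts \<tau> J = \<alpha>"
  using cell_counts_eq_iff[OF th theta_pos eps_pos good_G] by (simp add: counts_event_def)

lemma
  fixes \<phi> :: "(nat \<Rightarrow> nat) \<Rightarrow> real"
  assumes \<phi>: "\<And>\<alpha>. \<bar>\<phi> \<alpha>\<bar> \<le> B"
  shows measurable_cell_counts: "(\<lambda>J. indicator G J * \<phi> (cell_counts \<tau> J)) \<in> borel_measurable Q" (is "?m")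
    and integral_cell_counts: "ewens_mixture \<theta> \<epsilon> \<phi> sums (\<integral>J. indicator G J * \<phi> (cell_counts \<tau> J) \<partial>Q)" (is "?s")
proof -
  \<comment> \<open>Truncation to sizes below N: on \<open>G\<close> it equals the integrand if the
    size is below N and 0 otherwise, so it is dominated by B and its integral is a partial sum of
    the mixture.\<close>
  define S where "S N J = indicator G J * (\<Sum>n<N. \<Sum>\<alpha>\<in>partitions n. \<phi> \<alpha> * indicator (counts_event n \<alpha>) J)" for N J
  have S_meas: "S N \<in> borel_measurable Q" for N
    unfolding S_def using counts_event_sets events_G by (intro borel_measurable_times borel_measurable_sum) auto
  have S_eq: "S N J = (if n < N then \<phi> (cell_counts \<tau> J) else 0)"
    if "J \<in> G" "cell_counts \<tau> J \<in> partitions n" for N n J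
  proof -
    have "(\<Sum>\<alpha>\<in>partitions m. \<phi> \<alpha> * indicator (counts_event m \<alpha>) J) = (if m = n then \<phi> (cell_counts \<tau> J) else 0)" for m
    proof -
      have "(\<Sum>\<alpha>\<in>partitions m. \<phi> \<alpha> * indicator (counts_event m \<alpha>) J) =
          (\<Sum>\<alpha>\<in>partitions m. if cell_counts \<tau> J = \<alpha> then \<phi> \<alpha> else 0)"
        using that(1) by (intro sum.cong) (auto simp: counts_event_iff indicator_def)
      also have "\<dots> = (if cell_counts \<tau> J \<in> partitions m then \<phi> (cell_counts \<tau> J) else 0)"
        by (rule sum.delta'[OF finite_partitions])
      finally show ?thesis using that(2) partitions_disjoint by auto
    qed
    then show ?thesis using that(1) by (simp add: S_def)
  qed
  have lim: "(\<lambda>N. S N J) \<longlonglongrightarrow> indicator G J * \<phi> (cell_counts \<tau> J)" for J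
  proof (cases "J \<in> G")
    case True
    obtain n where n: "cell_counts \<tau> J \<in> partitions n"
      using cell_counts_in_partitions[OF th theta_pos eps_pos good_G[OF True]] by blast
    have "\<forall>\<^sub>F N in sequentially. S N J = indicator G J * \<phi> (cell_counts \<tau> J)"
      using eventually_gt_at_top[of n] by eventually_elim (simp add: S_eq[OF True n] True)
    then show ?thesis by (rule tendsto_eventually)
  qed (simp add: S_def)
  have S_le: "\<bar>S N J\<bar> \<le> B" for N J
  proof (cases "J \<in> G")
    case True
    obtain n where n: "cell_counts \<tau> J \<in> partitions n"
      using cell_counts_in_partitions[OF th theta_pos eps_pos good_G[OF True]] by blast
    show ?thesis using S_eq[OF True n, of N] \<phi>[of "cell_counts \<tau> J"] by auto
  qed (use \<phi>[of undefined] in \<open>simp add: S_def\<close>)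
  show ?m by (rule borel_measurable_LIMSEQ_real[OF lim S_meas])
  have "(\<lambda>N. \<integral>J. S N J \<partial>Q) \<longlonglongrightarrow> (\<integral>J. indicator G J * \<phi> (cell_counts \<tau> J) \<partial>Q)"
    by (rule integral_dominated_convergence[where w = "\<lambda>_. B"]) (use \<open>?m\<close> S_meas S_le lim in auto)
  moreover have "(\<integral>J. S N J \<partial>Q) = (\<Sum>n<N. ewens_mixture \<theta> \<epsilon> \<phi> n)" for N
  proof -
    have "(\<integral>J. S N J \<partial>Q) = (\<integral>J. (\<Sum>n<N. \<Sum>\<alpha>\<in>partitions n. \<phi> \<alpha> * indicator (counts_event n \<alpha>) J) \<partial>Q)"
    proof (rule integral_cong_AE)
      show "AE J in Q. S N J = (\<Sum>n<N. \<Sum>\<alpha>\<in>partitions n. \<phi> \<alpha> * indicator (counts_event n \<alpha>) J)"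
        using AE_G by eventually_elim (simp add: S_def)
      show "(\<lambda>J. \<Sum>n<N. \<Sum>\<alpha>\<in>partitions n. \<phi> \<alpha> * indicator (counts_event n \<alpha>) J) \<in> borel_measurable Q"
        using counts_event_sets by (intro borel_measurable_sum) auto
    qed (rule S_meas)
    also have "\<dots> = (\<Sum>n<N. \<Sum>\<alpha>\<in>partitions n. \<phi> \<alpha> * prob (counts_event n \<alpha>))"
    proof -
      have i: "integrable Q (\<lambda>J. \<phi> \<alpha> * indicator (counts_event n \<alpha>) J)" if "\<alpha> \<in> partitions n" for n \<alpha>
        using counts_event_sets[OF that] by (auto simp: emeasure_eq_measure)
      have "(\<integral>J. (\<Sum>\<alpha>\<in>partitions n. \<phi> \<alpha> * indicator (counts_event n \<alpha>) J) \<partial>Q) =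
          (\<Sum>\<alpha>\<in>partitions n. \<phi> \<alpha> * prob (counts_event n \<alpha>))" for n
        using i counts_event_sets by (subst Bochner_Integration.integral_sum) (auto simp: space_Q intro!: sum.cong)
      moreover have "integrable Q (\<lambda>J. \<Sum>\<alpha>\<in>partitions n. \<phi> \<alpha> * indicator (counts_event n \<alpha>) J)" for n
        using i by (rule Bochner_Integration.integrable_sum)
      ultimately show ?thesis by (subst Bochner_Integration.integral_sum) auto
    qed
    also have "\<dots> = (\<Sum>n<N. ewens_mixture \<theta> \<epsilon> \<phi> n)"
      unfolding ewens_mixture_def by (intro sum.cong refl) (simp add: prob_counts_event sum_distrib_left mult_ac cong: sum.cong)
    finally show ?thesis .
  qed
  ultimately show ?s by (simp add: sums_def)
qed

end
end


section \<open>Convergence of the rescaled cell counts\<close>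

lemma good_points_summable_abs: "good_points J \<Longrightarrow> summable (\<lambda>k. \<bar>J k\<bar>)"
  by (simp add: good_points_def abs_of_pos)

lemma good_points_suminf_pos: "good_points J \<Longrightarrow> 0 < suminf J"
  by (auto simp: good_points_def intro: suminf_pos)

lemma norm_Abs_ell1:
  assumes "good_points J" shows "norm (Abs_ell1 J) = suminf J"
  using assms good_points_summable_abs[OF assms]
  by (simp add: norm_ell1.rep_eq Abs_ell1_inverse good_points_def abs_of_pos)

lemma normalise_good_points:
  assumes "good_points J" shows "normalise J = sgn (Abs_ell1 J)"
proof -
  have "ell1_nth (sgn (Abs_ell1 J)) k = J k / suminf J" for k
    using good_points_summable_abs[OF assms]
    by (simp add: sgn_ell1_def scaleR_ell1.rep_eq norm_Abs_ell1[OF assms] Abs_ell1_inverse divide_inverse mult.commute)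
  then have "ell1_nth (sgn (Abs_ell1 J)) = (\<lambda>k. J k / suminf J)" by blast
  then show ?thesis
    using good_points_summable_abs[OF assms] by (metis normalise_def ell1_nth_inverse)
qed

context
  fixes \<theta> :: real and e :: "nat \<Rightarrow> real" and \<tau> :: "nat \<Rightarrow> nat \<Rightarrow> real" and J
  assumes pos: "0 < \<theta>" "\<And>N. 0 < e N" and e: "e \<longlonglongrightarrow> 0"
    and th: "\<And>N. thresholds \<theta> (e N) (\<tau> N)" and J: "good_points J"
begin

text \<open>Tannery's theorem over the points. The k-th coordinate is off by at most the mesh and,
  uniformly in N, by at most 4 J k + J k.\<close>

lemma scaled_longest_parts_tendsto:
  "(\<lambda>N. e N *\<^sub>R longest_parts (cell_counts (\<tau> N) J)) \<longlonglongrightarrow> Abs_ell1 J"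
proof (subst tendsto_dist_iff)
  define d where "d k N = \<bar>e N * real (cell (\<tau> N) (J k)) - J k\<bar>" for k N
  have Jpos: "0 < J k" for k using J by (simp add: good_points_def)
  have "dist (e N *\<^sub>R longest_parts (cell_counts (\<tau> N) J)) (Abs_ell1 J) = (\<Sum>k. d k N)" for N
    using good_points_summable_abs[OF J]
    by (simp add: dist_norm norm_ell1.rep_eq minus_ell1.rep_eq scaleR_ell1.rep_eq Abs_ell1_inverse
        ell1_nth_cell_counts[OF th pos J] d_def)
  moreover have "(\<lambda>N. \<Sum>k. d k N) \<longlonglongrightarrow> (\<Sum>k. 0)"
  proof -
    have lim: "(\<lambda>N. d k N) \<longlonglongrightarrow> 0" for k
      by (rule Lim_null_comparison[OF _ e]) (use cell_approx(1)[OF th pos Jpos] in \<open>simp add: d_def\<close>)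
    have "norm (d k N) \<le> 5 * J k" for k N
    proof -
      have "0 \<le> e N * real (cell (\<tau> N) (J k))" using pos(2)[of N] by simp
      then show ?thesis
        using cell_approx(2)[OF th pos Jpos, of N k] Jpos[of k] unfolding d_def real_norm_def by linarith
    qed
    then have "\<forall>\<^sub>F (k, N) in sequentially \<times>\<^sub>F sequentially. norm (d k N) \<le> 5 * J k"
      by (intro always_eventually) (simp add: case_prod_beta)
    moreover have "summable (\<lambda>k. 5 * J k)" using J by (simp add: good_points_def summable_mult)
    ultimately show ?thesis
      using tannerys_theorem[where a = d and b = "\<lambda>_. 0" and M = "\<lambda>k. 5 * J k", OF lim] by simp
  qed
  ultimately show "(\<lambda>N. dist (e N *\<^sub>R longest_parts (cell_counts (\<tau> N) J)) (Abs_ell1 J)) \<longlonglongrightarrow> 0" by simp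
qed

lemma scaled_norm_tendsto: "(\<lambda>N. e N * norm (longest_parts (cell_counts (\<tau> N) J))) \<longlonglongrightarrow> suminf J"
  using tendsto_norm[OF scaled_longest_parts_tendsto] pos(2) by (simp add: norm_Abs_ell1[OF J] abs_of_pos)

lemma sgn_longest_parts_tendsto: "(\<lambda>N. sgn (longest_parts (cell_counts (\<tau> N) J))) \<longlonglongrightarrow> normalise J"
proof -
  have "Abs_ell1 J \<noteq> 0" using norm_Abs_ell1[OF J] good_points_suminf_pos[OF J] by auto
  then have "(\<lambda>N. sgn (e N *\<^sub>R longest_parts (cell_counts (\<tau> N) J))) \<longlonglongrightarrow> sgn (Abs_ell1 J)"
    by (intro tendsto_sgn scaled_longest_parts_tendsto)
  then show ?thesis using pos(2) by (simp add: sgn_scaleR normalise_good_points[OF J])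
qed

end

text \<open>Without second countability of \<^typ>\<open>ell1\<close> at hand, measurability is obtained by approximating with
  functions of countable range.\<close>

lemma borel_measurable_ell1I:
  fixes X :: "'a \<Rightarrow> ell1"
  assumes "\<And>k. (\<lambda>\<omega>. ell1_nth (X \<omega>) k) \<in> borel_measurable M"
  shows "X \<in> borel_measurable M"
proof -
  \<comment> \<open>Keeps K coordinates and rounds them down to multiples of 2^(-K). The
    approximation is coded by a list of integers, hence has countable range; its error is the tail
    of the series plus at most K / 2^K.\<close>
  define D where "D K xs = Abs_ell1 (\<lambda>k. if k < K then real_of_int (xs ! k) / 2 ^ K else 0)" for K :: nat and xs :: "int list"
  define I where "I K \<omega> = map (\<lambda>k. \<lfloor>2 ^ K * ell1_nth (X \<omega>) k\<rfloor>) [0..<K]" for K \<omega>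
  have sm: "summable (\<lambda>k. \<bar>if k < K then real_of_int (xs ! k) / 2 ^ K else 0\<bar>)" for K and xs :: "int list"
    by (rule summable_finite[of "{..<K}"]) auto
  have nth: "ell1_nth (D K (I K \<omega>)) k = (if k < K then real_of_int \<lfloor>2 ^ K * ell1_nth (X \<omega>) k\<rfloor> / 2 ^ K else 0)" for K \<omega> k
    unfolding D_def using sm[of K "I K \<omega>"] by (subst Abs_ell1_inverse) (auto simp: I_def)
  show ?thesis
  proof (rule borel_measurable_LIMSEQ_metric)
    fix K
    have "I K \<in> M \<rightarrow>\<^sub>M count_space UNIV"
    proof (subst measurable_count_space_eq2_countable, intro conjI ballI)
      fix xs :: "int list"
      show "I K -` {xs} \<inter> space M \<in> sets M"
      proof (cases "length xs = K")
        case True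
        have "I K \<omega> = xs \<longleftrightarrow> (\<forall>k\<in>{..<K}. \<lfloor>2 ^ K * ell1_nth (X \<omega>) k\<rfloor> = xs ! k)" for \<omega>
          unfolding list_eq_iff_nth_eq using True by (simp add: I_def Ball_def)
        then have "I K -` {xs} \<inter> space M = {\<omega>\<in>space M. \<forall>k\<in>{..<K}. \<lfloor>2 ^ K * ell1_nth (X \<omega>) k\<rfloor> = xs ! k}"
          by blast
        also have "\<dots> \<in> sets M"
        proof (rule sets.sets_Collect_finite_All)
          show "{\<omega>\<in>space M. \<lfloor>2 ^ K * ell1_nth (X \<omega>) k\<rfloor> = xs ! k} \<in> sets M" for k
            using assms[of k, measurable] by measurable
        qed simp
        finally show ?thesis .
      next
        case False
        then have "I K \<omega> \<noteq> xs" for \<omega> by (auto simp: I_def)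
        then have "I K -` {xs} = {}" by blast
        then show ?thesis by simp
      qed
    qed auto
    from measurable_compose[OF this, of "D K" borel]
    show "(\<lambda>\<omega>. D K (I K \<omega>)) \<in> borel_measurable M" by simp
  next
    fix \<omega>
    let ?x = "ell1_nth (X \<omega>)"
    have sx: "summable (\<lambda>k. \<bar>?x k\<bar>)" using ell1_nth[of "X \<omega>"] by simp
    have "(\<lambda>K. (\<Sum>k. \<bar>?x (k + K)\<bar>) + real K * (1/2) ^ K) \<longlonglongrightarrow> 0 + 0"
    proof (rule tendsto_add)
      show "(\<lambda>K. \<Sum>k. \<bar>?x (k + K)\<bar>) \<longlonglongrightarrow> 0" using suminf_exist_split2[OF sx] by simp
      show "(\<lambda>K. real K * (1/2) ^ K) \<longlonglongrightarrow> 0" using powser_times_n_limit_0[of "1/2 :: real"] by simp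
    qed
    moreover have "dist (D K (I K \<omega>)) (X \<omega>) \<le> (\<Sum>k. \<bar>?x (k + K)\<bar>) + real K * (1/2) ^ K" for K
    proof -
      let ?d = "\<lambda>k. \<bar>ell1_nth (D K (I K \<omega>)) k - ?x k\<bar>"
      have sd: "summable ?d" using ell1_nth[of "D K (I K \<omega>) - X \<omega>"] by (simp add: minus_ell1.rep_eq)
      have "dist (D K (I K \<omega>)) (X \<omega>) = suminf ?d" by (simp add: dist_norm norm_ell1.rep_eq minus_ell1.rep_eq)
      also have "\<dots> = (\<Sum>k. ?d (k + K)) + (\<Sum>k<K. ?d k)" using sd by (rule suminf_split_initial_segment)
      also have "(\<Sum>k. ?d (k + K)) = (\<Sum>k. \<bar>?x (k + K)\<bar>)" by (simp add: nth)
      also have "(\<Sum>k<K. ?d k) \<le> (\<Sum>k<K. (1/2) ^ K)"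
      proof (rule sum_mono)
        fix k assume "k \<in> {..<K}"
        have "\<bar>real_of_int \<lfloor>2 ^ K * ?x k\<rfloor> - 2 ^ K * ?x k\<bar> \<le> 1" by linarith
        then have "\<bar>real_of_int \<lfloor>2 ^ K * ?x k\<rfloor> - 2 ^ K * ?x k\<bar> / 2 ^ K \<le> 1 / 2 ^ K" by (intro divide_right_mono) auto
        also have "\<bar>real_of_int \<lfloor>2 ^ K * ?x k\<rfloor> - 2 ^ K * ?x k\<bar> / 2 ^ K = \<bar>(real_of_int \<lfloor>2 ^ K * ?x k\<rfloor> - 2 ^ K * ?x k) / 2 ^ K\<bar>" by simp
        finally show "?d k \<le> (1/2) ^ K" using \<open>k \<in> _\<close> by (simp add: nth diff_divide_distrib power_one_over)
      qed
      finally show ?thesis by simp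
    qed
    ultimately show "(\<lambda>K. D K (I K \<omega>)) \<longlonglongrightarrow> X \<omega>"
      unfolding tendsto_dist_iff[where l = "X \<omega>"]
      by (intro Lim_null_comparison[of "\<lambda>K. dist (D K (I K \<omega>)) (X \<omega>)"]) auto
  qed
qed

lemma measurable_normalise: "normalise \<in> borel_measurable (\<Pi>\<^sub>M k\<in>UNIV. borel)"
proof (rule borel_measurable_ell1I)
  fix k
  have s: "summable (\<lambda>k. \<bar>J k / c\<bar>)" if "summable (\<lambda>k. \<bar>J k\<bar>)" for J :: "nat \<Rightarrow> real" and c
    using summable_divide[OF that, of "\<bar>c\<bar>"] by simp
  \<comment> \<open>Summability is rewritten as finiteness of a nonnegative extended series, which
    is visibly measurable.\<close>
  have "ell1_nth (normalise J) k = (if (\<Sum>i. ennreal \<bar>J i\<bar>) < \<infinity> then J k / (\<Sum>i. J i) else 0)" for J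
  proof -
    have "summable (\<lambda>k. \<bar>J k\<bar>) \<longleftrightarrow> (\<Sum>i. ennreal \<bar>J i\<bar>) < \<infinity>"
    proof
      assume "summable (\<lambda>k. \<bar>J k\<bar>)"
      then have "(\<Sum>i. ennreal \<bar>J i\<bar>) = ennreal (\<Sum>i. \<bar>J i\<bar>)" by (intro suminf_ennreal2) auto
      then show "(\<Sum>i. ennreal \<bar>J i\<bar>) < \<infinity>" by simp
    qed (rule summable_suminf_not_top, auto)
    moreover have "ell1_nth (normalise J) k = (if summable (\<lambda>k. \<bar>J k\<bar>) then J k / (\<Sum>i. J i) else 0)"
    proof (cases "summable (\<lambda>k. \<bar>J k\<bar>)")
      case True
      then have "ell1_nth (Abs_ell1 (\<lambda>k. J k / (\<Sum>i. J i))) = (\<lambda>k. J k / (\<Sum>i. J i))"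
        by (intro Abs_ell1_inverse) (simp only: mem_Collect_eq, rule s)
      then show ?thesis using True by (simp add: normalise_def)
    qed (simp add: normalise_def zero_ell1.rep_eq)
    ultimately show ?thesis by simp
  qed
  then have eq: "(\<lambda>J. ell1_nth (normalise J) k) = (\<lambda>J. if (\<Sum>i. ennreal \<bar>J i\<bar>) < \<infinity> then J k / (\<Sum>i. J i) else 0)"
    by blast
  show "(\<lambda>J. ell1_nth (normalise J) k) \<in> borel_measurable (\<Pi>\<^sub>M k\<in>UNIV. borel)"
    unfolding eq by measurable
qed


section \<open>Poissonised expectations\<close>

definition partition_function :: "real \<Rightarrow> nat \<Rightarrow> real" where
  "partition_function \<theta> n = (\<Sum>\<alpha>\<in>partitions n. ewens_weight \<theta> n \<alpha>)"

text \<open>Read off from the sampling formula, since the Feller law has total mass one.\<close>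

lemma partition_function_eq:
  assumes "0 < \<theta>"
  shows "partition_function \<theta> n = pochhammer \<theta> n / fact n"
proof (cases "n = 0")
  case True
  then show ?thesis by (simp add: partition_function_def partitions_0 ewens_weight_def)
next
  case False
  interpret prob_space "feller_measure \<theta>" by (rule prob_space_feller_measure)
  have "(\<integral>\<xi>. (1::real) \<partial>feller_measure \<theta>) = fact n / pochhammer \<theta> n * partition_function \<theta> n"
    unfolding partition_function_def using False
    by (subst integral_runs[OF assms, of n "\<lambda>_. 1"]) simp_all
  moreover have "(\<integral>\<xi>. (1::real) \<partial>feller_measure \<theta>) = 1" by (simp add: prob_space)
  ultimately have 1: "fact n / pochhammer \<theta> n * partition_function \<theta> n = 1" by (simp only:)
  have "partition_function \<theta> n =
      (fact n / pochhammer \<theta> n * partition_function \<theta> n) * (pochhammer \<theta> n / fact n)"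
    using pochhammer_pos[OF assms, of n] by simp
  then show ?thesis by (simp only: 1 mult_1_left)
qed

definition ewens_mean :: "real \<Rightarrow> ((nat \<Rightarrow> nat) \<Rightarrow> real) \<Rightarrow> nat \<Rightarrow> real" where
  "ewens_mean \<theta> \<phi> n = (\<Sum>\<alpha>\<in>partitions n. \<phi> \<alpha> * ewens_weight \<theta> n \<alpha>) / partition_function \<theta> n"

lemma ewens_mean_eq_feller:
  assumes "0 < \<theta>" "1 \<le> n"
  shows "ewens_mean \<theta> \<phi> n = (\<integral>\<xi>. \<phi> (runs \<xi> n 0) \<partial>feller_measure \<theta>)"
  unfolding ewens_mean_def partition_function_eq[OF assms(1)] integral_runs[OF assms] by simp

text \<open>The total size under the Poisson cell counts is a negative binomial variable with these weights.\<close>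

definition size_weight :: "real \<Rightarrow> real \<Rightarrow> nat \<Rightarrow> real" where
  "size_weight \<theta> \<epsilon> n = exp (- cycle_rate_tail \<theta> \<epsilon> 0) * exp (- \<epsilon> * real n) * partition_function \<theta> n"

lemma partition_function_pos: "0 < \<theta> \<Longrightarrow> 0 < partition_function \<theta> n"
  by (simp add: partition_function_eq pochhammer_pos)

lemma size_weight_nonneg: "0 < \<theta> \<Longrightarrow> 0 \<le> size_weight \<theta> \<epsilon> n"
  using partition_function_pos[of \<theta> n] by (simp add: size_weight_def)

lemma ewens_mixture_eq:
  "0 < \<theta> \<Longrightarrow> ewens_mixture \<theta> \<epsilon> \<phi> n = size_weight \<theta> \<epsilon> n * ewens_mean \<theta> \<phi> n"
  using partition_function_pos[of \<theta> n] by (simp add: ewens_mixture_def ewens_mean_def size_weight_def)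

lemma ewens_mean_cong:
  "(\<And>\<alpha>. \<alpha> \<in> partitions n \<Longrightarrow> \<phi> \<alpha> = \<psi> \<alpha>) \<Longrightarrow> ewens_mean \<theta> \<phi> n = ewens_mean \<theta> \<psi> n"
  by (simp add: ewens_mean_def)

lemma ewens_mean_const: "0 < \<theta> \<Longrightarrow> ewens_mean \<theta> (\<lambda>_. c) n = c"
  using partition_function_pos[of \<theta> n] by (simp add: ewens_mean_def sum_distrib_left[symmetric] partition_function_def)

lemma ewens_mean_abs_le:
  assumes "0 < \<theta>" "\<And>\<alpha>. \<bar>\<phi> \<alpha>\<bar> \<le> B"
  shows "\<bar>ewens_mean \<theta> \<phi> n\<bar> \<le> B"
proof -
  have w: "0 \<le> ewens_weight \<theta> n \<alpha>" for \<alpha>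
    unfolding ewens_weight_def using assms(1) by (intro prod_nonneg) auto
  have "\<bar>\<Sum>\<alpha>\<in>partitions n. \<phi> \<alpha> * ewens_weight \<theta> n \<alpha>\<bar> \<le> (\<Sum>\<alpha>\<in>partitions n. \<bar>\<phi> \<alpha> * ewens_weight \<theta> n \<alpha>\<bar>)"
    by (rule sum_abs)
  also have "\<dots> \<le> (\<Sum>\<alpha>\<in>partitions n. B * ewens_weight \<theta> n \<alpha>)"
    unfolding abs_mult abs_of_nonneg[OF w] by (intro sum_mono mult_right_mono assms w)
  also have "\<dots> = B * partition_function \<theta> n"
    by (simp add: partition_function_def sum_distrib_left)
  finally show ?thesis
    using partition_function_pos[OF assms(1), of n] by (simp add: ewens_mean_def abs_divide field_simps)
qed

lemma ewens_mean_size: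
  assumes "0 < \<theta>"
  shows "ewens_mean \<theta> (\<lambda>\<alpha>. g (norm (longest_parts \<alpha>))) n = g (real n)"
proof -
  have "ewens_mean \<theta> (\<lambda>\<alpha>. g (norm (longest_parts \<alpha>))) n = ewens_mean \<theta> (\<lambda>_. g (real n)) n"
    by (rule ewens_mean_cong) (simp add: norm_longest_parts)
  then show ?thesis using assms by (simp add: ewens_mean_const)
qed

text \<open>Exponential tilting of the size law. Powers of exp (- \<epsilon> n) stay within the
  family of weights, which is what lets polynomial test functions be treated.\<close>

lemma size_weight_scale:
  "exp (- \<epsilon> * real n) ^ k * size_weight \<theta> \<epsilon> n =
    exp (cycle_rate_tail \<theta> (real (Suc k) * \<epsilon>) 0 - cycle_rate_tail \<theta> \<epsilon> 0) * size_weight \<theta> (real (Suc k) * \<epsilon>) n"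
proof -
  let ?X = "exp (- \<epsilon> * real n)" and ?R = "cycle_rate_tail \<theta> (real (Suc k) * \<epsilon>) 0"
  have 1: "?X ^ k * ?X = exp (- (real (Suc k) * \<epsilon>) * real n)"
    by (simp add: exp_of_nat_mult[symmetric] mult_exp_exp algebra_simps)
  have 2: "exp (?R - cycle_rate_tail \<theta> \<epsilon> 0) * exp (- ?R) = exp (- cycle_rate_tail \<theta> \<epsilon> 0)"
    by (simp add: mult_exp_exp)
  have "?X ^ k * size_weight \<theta> \<epsilon> n = exp (- cycle_rate_tail \<theta> \<epsilon> 0) * (?X ^ k * ?X) * partition_function \<theta> n"
    unfolding size_weight_def by (simp only: mult_ac)
  also have "\<dots> = exp (?R - cycle_rate_tail \<theta> \<epsilon> 0) * size_weight \<theta> (real (Suc k) * \<epsilon>) n"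
    unfolding 1 2[symmetric] size_weight_def by (simp only: mult.assoc)
  finally show ?thesis .
qed

context pd_points_good
begin

text \<open>Total probability of the cell counts, in place of the binomial series.\<close>

lemma size_weight_sums:
  assumes "0 < \<epsilon>" shows "size_weight \<theta> \<epsilon> sums 1"
proof -
  obtain \<tau> where th: "thresholds \<theta> \<epsilon> \<tau>" using thresholds_exist[OF theta_pos assms] by blast
  have "AE J in Q. indicator G J = (1::real)" using AE_G by eventually_elim simp
  then have "(\<integral>J. indicator G J * 1 \<partial>Q) = (\<integral>J. (1::real) \<partial>Q)" by (intro integral_cong_AE) (use events_G in auto)
  then have "(\<integral>J. indicator G J * 1 \<partial>Q) = (1::real)" by (simp add: prob_space)
  then have "ewens_mixture \<theta> \<epsilon> (\<lambda>_. 1) sums 1"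
    using integral_cell_counts[OF th assms, of "\<lambda>_. 1" 1] by simp
  moreover have "ewens_mixture \<theta> \<epsilon> (\<lambda>_. 1) = size_weight \<theta> \<epsilon>"
    by (intro ext) (simp only: ewens_mixture_eq[OF theta_pos] ewens_mean_const[OF theta_pos] mult_1_right)
  ultimately show ?thesis by simp
qed

lemma summable_size_weight_mult:
  assumes "0 < \<epsilon>" "\<And>n. \<bar>b n\<bar> \<le> (B::real)"
  shows "summable (\<lambda>n. size_weight \<theta> \<epsilon> n * b n)" "\<bar>\<Sum>n. size_weight \<theta> \<epsilon> n * b n\<bar> \<le> B"
proof -
  have le: "norm (size_weight \<theta> \<epsilon> n * b n) \<le> size_weight \<theta> \<epsilon> n * B" for n
    using assms(2)[of n] size_weight_nonneg[OF theta_pos, of \<epsilon> n] by (simp add: abs_mult mult_left_mono)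
  have s: "(\<lambda>n. size_weight \<theta> \<epsilon> n * B) sums (1 * B)"
    using size_weight_sums[OF assms(1)] by (rule sums_mult2)
  have n: "summable (\<lambda>n. norm (size_weight \<theta> \<epsilon> n * b n))"
    by (rule summable_comparison_test'[OF sums_summable[OF s], of 0]) (use le in auto)
  then show "summable (\<lambda>n. size_weight \<theta> \<epsilon> n * b n)" by (rule summable_norm_cancel)
  have "norm (\<Sum>n. size_weight \<theta> \<epsilon> n * b n) \<le> (\<Sum>n. norm (size_weight \<theta> \<epsilon> n * b n))"
    using n by (rule summable_norm)
  also have "\<dots> \<le> (\<Sum>n. size_weight \<theta> \<epsilon> n * B)"
    using le n sums_summable[OF s] by (intro suminf_le)
  also have "\<dots> = B" using s by (simp add: sums_iff)
  finally show "\<bar>\<Sum>n. size_weight \<theta> \<epsilon> n * b n\<bar> \<le> B" by simp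
qed

text \<open>A Wiener-type Tauberian argument in Karamata's form: polynomials in \<open>e\<^sup>-\<^sup>\<epsilon>\<^sup>n\<close> are admissible test
  functions because replacing \<open>\<epsilon>\<close> by a multiple only renormalises the weights, hence so are continuous functions of \<open>e\<^sup>-\<^sup>\<epsilon>\<^sup>n\<close>.\<close>

lemma size_weight_continuous_test:
  fixes b :: "nat \<Rightarrow> real"
  assumes lim: "\<And>e. (\<And>N. 0 < e N) \<Longrightarrow> e \<longlonglongrightarrow> 0 \<Longrightarrow> (\<lambda>N. \<Sum>n. size_weight \<theta> (e N) n * b n) \<longlonglongrightarrow> 0"
    and b: "\<And>n. \<bar>b n\<bar> \<le> B" and \<psi>: "continuous_on {0..1} \<psi>"
    and e: "\<And>N. 0 < e N" "e \<longlonglongrightarrow> 0"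
  shows "(\<lambda>N. \<Sum>n. size_weight \<theta> (e N) n * (\<psi> (exp (- e N * real n)) * b n)) \<longlonglongrightarrow> 0"
proof -
  have x: "exp (- e N * real n) \<in> {0..1}" for N n using e(1)[of N] by simp
  have B: "0 \<le> B" using b[of 0] by linarith
  have power: "(\<lambda>N. \<Sum>n. size_weight \<theta> (e N) n * (exp (- e N * real n) ^ k * b n)) \<longlonglongrightarrow> 0" for k
  proof (rule Lim_null_comparison)
    have "(\<lambda>N. real (Suc k) * e N) \<longlonglongrightarrow> 0" using tendsto_mult_right_zero[OF e(2)] by simp
    then have "(\<lambda>N. \<Sum>n. size_weight \<theta> (real (Suc k) * e N) n * b n) \<longlonglongrightarrow> 0"
      using e(1) by (intro lim) auto
    then show "(\<lambda>N. \<bar>\<Sum>n. size_weight \<theta> (real (Suc k) * e N) n * b n\<bar>) \<longlonglongrightarrow> 0"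
      by (rule tendsto_rabs_zero)
    have "\<bar>\<Sum>n. size_weight \<theta> (e N) n * (exp (- e N * real n) ^ k * b n)\<bar> \<le> \<bar>\<Sum>n. size_weight \<theta> (real (Suc k) * e N) n * b n\<bar>" for N
    proof -
      let ?r = "exp (cycle_rate_tail \<theta> (real (Suc k) * e N) 0 - cycle_rate_tail \<theta> (e N) 0)"
      have eq: "size_weight \<theta> (e N) n * (exp (- e N * real n) ^ k * b n) = ?r * (size_weight \<theta> (real (Suc k) * e N) n * b n)" for n
        unfolding mult.assoc[symmetric] size_weight_scale[of "e N" n k \<theta>, symmetric] by (simp only: mult_ac)
      have "summable (\<lambda>n. size_weight \<theta> (real (Suc k) * e N) n * b n)"
        using e(1)[of N] by (intro summable_size_weight_mult(1)[OF _ b]) auto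
      then have "(\<Sum>n. size_weight \<theta> (e N) n * (exp (- e N * real n) ^ k * b n)) =
          ?r * (\<Sum>n. size_weight \<theta> (real (Suc k) * e N) n * b n)"
        unfolding eq by (rule suminf_mult)
      \<comment> \<open>The tilted weights have the larger parameter and so the smaller total rate;
        the factor cannot spoil the convergence to 0.\<close>
      moreover have "?r \<le> 1"
      proof -
        have "e N \<le> real (Suc k) * e N" using e(1)[of N] by (simp add: algebra_simps)
        then show ?thesis using cycle_rate_tail_antimono[OF theta_pos e(1), of N "real (Suc k) * e N" 0] by simp
      qed
      ultimately show ?thesis by (simp add: abs_mult mult_left_le_one_le)
    qed
    then show "\<forall>\<^sub>F N in sequentially. norm (\<Sum>n. size_weight \<theta> (e N) n * (exp (- e N * real n) ^ k * b n)) \<le>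
        \<bar>\<Sum>n. size_weight \<theta> (real (Suc k) * e N) n * b n\<bar>" by simp
  qed
  have pow_sum: "summable (\<lambda>n. size_weight \<theta> (e N) n * (exp (- e N * real n) ^ k * b n))" for N k
  proof (rule summable_size_weight_mult(1)[OF e(1)])
    show "\<bar>exp (- e N * real n) ^ k * b n\<bar> \<le> B" for n
      using mult_mono[OF power_le_one[of "exp (- e N * real n)" k] b[of n]] x[of N n] by (simp add: abs_mult)
  qed
  show ?thesis
  proof (rule LIMSEQ_I)
    fix r :: real assume r: "0 < r"
    \<comment> \<open>Accuracy of the polynomial approximation: multiplied by the bound
      \<open>B\<close> it costs less than r / 2, with B + 1 allowing for B = 0.\<close>
    define d where "d = r / (2 * (B + 1))"
    have d: "0 < d" "d * B < r / 2"
    proof -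
      show "0 < d" using r B by (simp add: d_def)
      have "r * B < r * (B + 1)" using r by simp
      then show "d * B < r / 2" using B by (simp add: d_def field_simps)
    qed
    obtain g where g: "real_polynomial_function g" "\<And>x. x \<in> {0..1} \<Longrightarrow> \<bar>\<psi> x - g x\<bar> < d"
      using Stone_Weierstrass_real_polynomial_function[OF compact_Icc \<psi> d(1)] by blast
    then obtain c m where g_eq: "g = (\<lambda>x. \<Sum>k\<le>m. c k * x ^ k)"
      using real_polynomial_function_iff_sum by blast
    have "(\<lambda>N. \<Sum>k\<le>m. c k * (\<Sum>n. size_weight \<theta> (e N) n * (exp (- e N * real n) ^ k * b n))) \<longlonglongrightarrow> (\<Sum>k\<le>m. c k * 0)"
      by (intro tendsto_sum tendsto_mult_left power)
    moreover have gs: "(\<lambda>n. size_weight \<theta> (e N) n * (g (exp (- e N * real n)) * b n)) sums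
        (\<Sum>k\<le>m. c k * (\<Sum>n. size_weight \<theta> (e N) n * (exp (- e N * real n) ^ k * b n)))" for N
    proof -
      have "size_weight \<theta> (e N) n * (g (exp (- e N * real n)) * b n) =
          (\<Sum>k\<le>m. c k * (size_weight \<theta> (e N) n * (exp (- e N * real n) ^ k * b n)))" for n
        unfolding g_eq sum_distrib_right sum_distrib_left by (intro sum.cong) auto
      then show ?thesis by (simp only:) (intro sums_sum sums_mult summable_sums pow_sum)
    qed
    ultimately have lim_g: "(\<lambda>N. \<Sum>n. size_weight \<theta> (e N) n * (g (exp (- e N * real n)) * b n)) \<longlonglongrightarrow> 0"
      by (simp add: sums_iff)
    have "0 < r / 2" using r by simp
    from LIMSEQ_D[OF lim_g this] obtain N0 where N0: "\<And>N. N0 \<le> N \<Longrightarrow> \<bar>\<Sum>n. size_weight \<theta> (e N) n * (g (exp (- e N * real n)) * b n)\<bar> < r / 2"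
      unfolding diff_0_right real_norm_def by blast
    show "\<exists>N0. \<forall>N\<ge>N0. norm ((\<Sum>n. size_weight \<theta> (e N) n * (\<psi> (exp (- e N * real n)) * b n)) - 0) < r"
    proof (intro exI[of _ N0] allI impI)
      fix N assume "N0 \<le> N"
      let ?x = "\<lambda>n. exp (- e N * real n)"
      have le: "\<bar>(\<psi> (?x n) - g (?x n)) * b n\<bar> \<le> d * B" for n
        using mult_mono[OF less_imp_le[OF g(2)[OF x]] b[of n], of N n] d(1) by (simp add: abs_mult)
      note diff = summable_size_weight_mult[where b = "\<lambda>n. (\<psi> (?x n) - g (?x n)) * b n", OF e(1)[of N] le]
      have "(\<Sum>n. size_weight \<theta> (e N) n * (\<psi> (?x n) * b n)) =
          (\<Sum>n. size_weight \<theta> (e N) n * ((\<psi> (?x n) - g (?x n)) * b n) + size_weight \<theta> (e N) n * (g (?x n) * b n))"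
      proof (rule suminf_cong)
        have K: "w * (p * z) = w * ((p - q) * z) + w * (q * z)" for w p q z :: real by (simp add: algebra_simps)
        show "size_weight \<theta> (e N) n * (\<psi> (?x n) * b n) = size_weight \<theta> (e N) n * ((\<psi> (?x n) - g (?x n)) * b n) + size_weight \<theta> (e N) n * (g (?x n) * b n)" for n
          by (rule K)
      qed
      also have "\<dots> = (\<Sum>n. size_weight \<theta> (e N) n * ((\<psi> (?x n) - g (?x n)) * b n)) + (\<Sum>n. size_weight \<theta> (e N) n * (g (?x n) * b n))"
        by (intro suminf_add[symmetric] diff sums_summable[OF gs])
      finally show "norm ((\<Sum>n. size_weight \<theta> (e N) n * (\<psi> (?x n) * b n)) - 0) < r"
        using diff(2) d(2) N0[OF \<open>N0 \<le> N\<close>] unfolding diff_0_right real_norm_def by linarith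
    qed
  qed
qed

text \<open>Both limits below are the almost sure convergence of the rescaled cell counts, integrated.\<close>

lemma mixture_tendsto:
  fixes f :: "ell1 \<Rightarrow> real"
  assumes f: "continuous_on UNIV f" "\<And>x. \<bar>f x\<bar> \<le> B" and e: "\<And>N. 0 < e N" "e \<longlonglongrightarrow> 0"
  shows "(\<lambda>N. \<Sum>n. size_weight \<theta> (e N) n * ewens_mean \<theta> (\<lambda>\<alpha>. f (sgn (longest_parts \<alpha>))) n)
    \<longlonglongrightarrow> (\<integral>J. f (normalise J) \<partial>Q)"
proof -
  have "\<exists>\<tau>. thresholds \<theta> (e N) \<tau>" for N using thresholds_exist[OF theta_pos e(1)] by blast
  then obtain \<tau> where th: "\<And>N. thresholds \<theta> (e N) (\<tau> N)" by metis
  let ?\<phi> = "\<lambda>\<alpha>. f (sgn (longest_parts \<alpha>))"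
  have "(\<lambda>N. \<integral>J. indicator G J * ?\<phi> (cell_counts (\<tau> N) J) \<partial>Q) \<longlonglongrightarrow> (\<integral>J. f (normalise J) \<partial>Q)"
  proof (rule integral_dominated_convergence[where w = "\<lambda>_. B"])
    have "f \<in> borel_measurable borel" using f(1) by (rule borel_measurable_continuous_onI)
    moreover have "normalise \<in> borel_measurable Q"
      using measurable_normalise measurable_cong_sets[OF sets_Q refl] by blast
    ultimately show "(\<lambda>J. f (normalise J)) \<in> borel_measurable Q" by (rule measurable_compose[rotated])
    show "(\<lambda>J. indicator G J * ?\<phi> (cell_counts (\<tau> N) J)) \<in> borel_measurable Q" for N
      by (rule measurable_cell_counts[OF th e(1), where B = B]) (rule f(2))
    show "AE J in Q. (\<lambda>N. indicator G J * ?\<phi> (cell_counts (\<tau> N) J)) \<longlonglongrightarrow> f (normalise J)"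
      using AE_G
    proof eventually_elim
      case (elim J)
      have "isCont f (normalise J)" using f(1) by (simp add: continuous_on_eq_continuous_at)
      then show ?case
        using isCont_tendsto_compose sgn_longest_parts_tendsto[OF theta_pos e th good_G[OF elim]] elim by force
    qed
    have "\<bar>indicator G J * f x\<bar> \<le> B" for J x
      using f(2)[of x] by (cases "J \<in> G") auto
    then show "AE J in Q. norm (indicator G J * ?\<phi> (cell_counts (\<tau> N) J)) \<le> B" for N by simp
  qed simp
  moreover have "(\<integral>J. indicator G J * ?\<phi> (cell_counts (\<tau> N) J) \<partial>Q) = (\<Sum>n. size_weight \<theta> (e N) n * ewens_mean \<theta> ?\<phi> n)" for N
    using integral_cell_counts[OF th e(1), where \<phi> = ?\<phi> and B = B] f(2)
    by (simp add: sums_iff ewens_mixture_eq[OF theta_pos] cong: suminf_cong)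
  ultimately show ?thesis by simp
qed

lemma size_tendsto:
  fixes \<psi> :: "real \<Rightarrow> real"
  assumes \<psi>: "continuous_on UNIV \<psi>" "\<And>x. \<bar>\<psi> x\<bar> \<le> B" and e: "\<And>N. 0 < e N" "e \<longlonglongrightarrow> 0"
  shows "(\<lambda>J. indicator G J * \<psi> (exp (- suminf J))) \<in> borel_measurable Q" (is ?m)
    and "(\<lambda>N. \<Sum>n. size_weight \<theta> (e N) n * \<psi> (exp (- e N * real n))) \<longlonglongrightarrow>
    (\<integral>J. indicator G J * \<psi> (exp (- suminf J)) \<partial>Q)" (is ?l)
proof -
  have "\<exists>\<tau>. thresholds \<theta> (e N) \<tau>" for N using thresholds_exist[OF theta_pos e(1)] by blast
  then obtain \<tau> where th: "\<And>N. thresholds \<theta> (e N) (\<tau> N)" by metis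
  \<comment> \<open>A function of the partition only through its size, so its Ewens mean at n is its
    value at n, while along the points \<epsilon> times the size tends to S.\<close>
  let ?\<phi> = "\<lambda>N \<alpha>. \<psi> (exp (- e N * norm (longest_parts \<alpha>)))"
  have meas: "(\<lambda>J. indicator G J * ?\<phi> N (cell_counts (\<tau> N) J)) \<in> borel_measurable Q" for N
    by (rule measurable_cell_counts[OF th e(1), where B = B]) (rule \<psi>(2))
  have lim: "(\<lambda>N. indicator G J * ?\<phi> N (cell_counts (\<tau> N) J)) \<longlonglongrightarrow> indicator G J * \<psi> (exp (- suminf J))" for J
  proof (cases "J \<in> G")
    case True
    have "(\<lambda>N. exp (- (e N * norm (longest_parts (cell_counts (\<tau> N) J))))) \<longlonglongrightarrow> exp (- suminf J)"
      by (intro tendsto_exp tendsto_minus scaled_norm_tendsto[OF theta_pos e th good_G[OF True]])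
    moreover have "isCont \<psi> (exp (- suminf J))" using \<psi>(1) by (simp add: continuous_on_eq_continuous_at)
    ultimately show ?thesis using isCont_tendsto_compose True by fastforce
  qed simp
  show ?m by (rule borel_measurable_LIMSEQ_real[OF lim meas])
  have "(\<lambda>N. \<integral>J. indicator G J * ?\<phi> N (cell_counts (\<tau> N) J) \<partial>Q) \<longlonglongrightarrow> (\<integral>J. indicator G J * \<psi> (exp (- suminf J)) \<partial>Q)"
  proof (rule integral_dominated_convergence[where w = "\<lambda>_. B"])
    have "\<bar>indicator G J * \<psi> x\<bar> \<le> B" for J x
      using \<psi>(2)[of x] by (cases "J \<in> G") auto
    then show "AE J in Q. norm (indicator G J * ?\<phi> N (cell_counts (\<tau> N) J)) \<le> B" for N by simp
  qed (use \<open>?m\<close> lim meas in auto)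
  moreover have "(\<integral>J. indicator G J * ?\<phi> N (cell_counts (\<tau> N) J) \<partial>Q) = (\<Sum>n. size_weight \<theta> (e N) n * \<psi> (exp (- e N * real n)))" for N
    using integral_cell_counts[OF th e(1), where \<phi> = "?\<phi> N" and B = B] \<psi>(2)
      ewens_mean_size[OF theta_pos, of "\<lambda>x. \<psi> (exp (- e N * x))"]
    by (simp add: sums_iff ewens_mixture_eq[OF theta_pos] cong: suminf_cong)
  ultimately show ?l by simp
qed

end


section \<open>Removal of the Poissonisation\<close>

text \<open>Two equal contributions: at fixed scale m the sorted parts move by at most |n - m|
  boxes, and changing the scale from n to m moves a vector of norm n by |n - m| / m.\<close>

lemma dist_sgn_runs:
  assumes "1 \<le> n" "1 \<le> m"
  shows "dist (sgn (longest_parts (runs \<xi> n 0))) (sgn (longest_parts (runs \<xi> m 0)))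
    \<le> 2 * (\<bar>real n - real m\<bar> / real m)"
proof -
  let ?x = "\<lambda>n. longest_parts (runs \<xi> n 0)"
  have norm: "norm (?x n) = real n" for n
    using norm_longest_parts[OF runs_in_partitions[of \<xi> n 0]] by simp
  have "dist (?x n) (?x m) \<le> \<bar>real n - real m\<bar>"
  proof (cases "m \<le> n")
    case True
    then show ?thesis using dist_runs_append[of \<xi> m "n - m" 0] by (simp add: of_nat_diff)
  next
    case False
    then show ?thesis using dist_runs_append[of \<xi> n "m - n" 0] by (simp add: of_nat_diff dist_commute)
  qed
  then have 1: "dist (?x n /\<^sub>R real m) (?x m /\<^sub>R real m) \<le> \<bar>real n - real m\<bar> / real m"
    using assms by (simp add: dist_divideR divide_right_mono)
  have "?x n /\<^sub>R real n - ?x n /\<^sub>R real m = (1 / real n - 1 / real m) *\<^sub>R ?x n"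
    by (simp add: scaleR_diff_left divide_inverse)
  then have "dist (?x n /\<^sub>R real n) (?x n /\<^sub>R real m) = \<bar>1 / real n - 1 / real m\<bar> * real n"
    by (simp add: dist_norm norm)
  also have "\<dots> = \<bar>(1 / real n - 1 / real m) * real n\<bar>" by (simp add: abs_mult)
  also have "(1 / real n - 1 / real m) * real n = (real m - real n) / real m"
    using assms by (simp add: field_simps)
  finally have 2: "dist (?x n /\<^sub>R real n) (?x n /\<^sub>R real m) = \<bar>real n - real m\<bar> / real m"
    by (simp add: abs_minus_commute)
  have "dist (?x n /\<^sub>R real n) (?x m /\<^sub>R real m) \<le> 2 * (\<bar>real n - real m\<bar> / real m)"
    using dist_triangle[of "?x n /\<^sub>R real n" "?x m /\<^sub>R real m" "?x n /\<^sub>R real m"] 1 2 by linarith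
  then show ?thesis by (simp add: sgn_div_norm norm)
qed

context pd_points_good
begin

text \<open>Almost surely 0 < S < \<infinity>, so one of countably many windows of relative width
  \<delta> has positive probability. The bump is a function of exp (- x) because these are the
  available test functions.\<close>

lemma bump_near_total_mass:
  assumes "0 < \<delta>" "\<delta> < 1"
  obtains q \<psi> where "0 < q" "continuous_on UNIV \<psi>" "\<And>u. 0 \<le> \<psi> u" "\<And>u. \<psi> u \<le> \<delta> * q"
    "\<And>x. 0 < \<psi> (exp (- x)) \<Longrightarrow> \<bar>x - q\<bar> < \<delta> * q" "0 < (\<integral>J. indicator G J * \<psi> (exp (- suminf J)) \<partial>Q)"
proof -
  \<comment> \<open>A tent of height \<delta> q around x = q in the variable u = exp (- x). The
    maximum keeps the logarithm away from u = 0 and takes effect only where the tent is already 0,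
    so continuity extends to the whole line.\<close>
  define \<psi> where "\<psi> q u = max 0 (\<delta> * q - \<bar>ln (max u (exp (- q * (1 + \<delta>)))) + q\<bar>)" for q u :: real
  have cont: "continuous_on UNIV (\<psi> q)" for q
  proof -
    have "max u (exp (- q * (1 + \<delta>))) \<noteq> 0" for u by (metis exp_gt_zero less_irrefl max.strict_coboundedI2)
    then show ?thesis unfolding \<psi>_def by (intro continuous_intros) auto
  qed
  have nonneg: "0 \<le> \<psi> q u" for q u by (simp add: \<psi>_def)
  have le: "\<psi> q u \<le> \<delta> * q" if "0 < q" for q u using that assms by (simp add: \<psi>_def)
  have pos: "0 < \<psi> q (exp (- x)) \<longleftrightarrow> \<bar>x - q\<bar> < \<delta> * q" if "0 < q" for q x
  proof (cases "x \<le> q * (1 + \<delta>)")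
    case True
    then have "max (exp (- x)) (exp (- q * (1 + \<delta>))) = exp (- x)" by (intro max_absorb1) simp
    then show ?thesis by (auto simp: \<psi>_def)
  next
    case False
    then have "max (exp (- x)) (exp (- q * (1 + \<delta>))) = exp (- q * (1 + \<delta>))" by (intro max_absorb2) simp
    then have "\<psi> q (exp (- x)) = 0" using that assms by (simp add: \<psi>_def algebra_simps)
    moreover have "\<not> \<bar>x - q\<bar> < \<delta> * q" using False by (simp add: algebra_simps)
    ultimately show ?thesis by simp
  qed
  define E where "E q = (\<integral>J. indicator G J * \<psi> q (exp (- suminf J)) \<partial>Q)" for q
  have int: "integrable Q (\<lambda>J. indicator G J * \<psi> q (exp (- suminf J)))" if "0 < q" for q
  proof (rule integrable_const_bound[where B = "\<delta> * q"])
    have b: "\<bar>\<psi> q x\<bar> \<le> \<delta> * q" for x using nonneg[of q x] le[OF that, of x] by simp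
    show "(\<lambda>J. indicator G J * \<psi> q (exp (- suminf J))) \<in> borel_measurable Q"
      by (rule size_tendsto(1)[where e = "\<lambda>N. 1 / real (Suc N)", OF cont b _ LIMSEQ_Suc[OF lim_1_over_n]]) simp
    have "\<bar>indicator G J * \<psi> q x\<bar> \<le> \<delta> * q" for J x
      using b[of x] by (cases "J \<in> G") auto
    then show "AE J in Q. norm (indicator G J * \<psi> q (exp (- suminf J))) \<le> \<delta> * q" by simp
  qed
  \<comment> \<open>Otherwise the bumps at all positive rationals would vanish simultaneously almost
    surely, although any rational q between S / (1 + \<delta>) and S has a bump positive at
    S.\<close>
  have "\<exists>q\<in>\<rat>. 0 < q \<and> E q \<noteq> 0"
  proof (rule ccontr)
    assume "\<not> ?thesis"
    then have z: "E q = 0" if "q \<in> \<rat>" "0 < q" for q using that by blast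
    have ae: "AE J in Q. 0 < q \<longrightarrow> indicator G J * \<psi> q (exp (- suminf J)) = 0" if "q \<in> \<rat>" for q
    proof (cases "0 < q")
      case True
      then have "AE J in Q. indicator G J * \<psi> q (exp (- suminf J)) = 0"
        using z[OF that True] integral_nonneg_eq_0_iff_AE[OF int[OF True]] nonneg unfolding E_def by auto
      then show ?thesis by eventually_elim simp
    qed simp
    have "AE J in Q. \<forall>q\<in>\<rat>. 0 < q \<longrightarrow> indicator G J * \<psi> q (exp (- suminf J)) = 0"
      using ae countable_rat by (subst AE_ball_countable) auto
    then have "AE J in Q. False"
      using AE_G
    proof eventually_elim
      case (elim J)
      have S: "0 < suminf J" by (rule good_points_suminf_pos[OF good_G[OF elim(2)]])
      have "suminf J / (1 + \<delta>) < suminf J"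
      proof -
        have "suminf J * 1 < suminf J * (1 + \<delta>)" using S assms by (intro mult_strict_left_mono) auto
        then show ?thesis using assms by (simp add: field_simps)
      qed
      then obtain q where q: "q \<in> \<rat>" "suminf J / (1 + \<delta>) < q" "q < suminf J" using Rats_dense_in_real by blast
      have "0 < suminf J / (1 + \<delta>)" using S assms by simp
      then have "0 < q" using q(2) by linarith
      moreover have "suminf J < q * (1 + \<delta>)" using q(2) assms by (simp add: field_simps)
      then have "\<bar>suminf J - q\<bar> < \<delta> * q" using q(3) by (simp add: algebra_simps)
      ultimately have "0 < \<psi> q (exp (- suminf J))" using pos by blast
      then show False using elim q(1) \<open>0 < q\<close> by auto
    qed
    then show False by simp
  qed
  then obtain q where q: "0 < q" "E q \<noteq> 0" by blast
  moreover have "0 \<le> E q" unfolding E_def using nonneg by (intro integral_nonneg_AE) auto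
  ultimately have "0 < E q" by simp
  then show thesis
    using that[of q "\<psi> q"] q(1) cont nonneg le pos unfolding E_def by blast
qed

text \<open>With \<epsilon> = q / n the bump selects sizes m within a relative distance \<delta> of
  n. Its average of the deviations from the limit tends to 0, and slow variation makes the deviation
  at m nearly the one at n.\<close>

lemma ewens_mean_tendsto:
  fixes f :: "ell1 \<Rightarrow> real"
  assumes f: "\<And>x y. \<bar>f x - f y\<bar> \<le> C * dist x y" "\<And>x. \<bar>f x\<bar> \<le> B"
  shows "(\<lambda>n. ewens_mean \<theta> (\<lambda>\<alpha>. f (sgn (longest_parts \<alpha>))) n) \<longlonglongrightarrow> (\<integral>J. f (normalise J) \<partial>Q)"
proof -
  interpret F: prob_space "feller_measure \<theta>" by (rule prob_space_feller_measure)
  define C' where "C' = \<bar>C\<bar> + 1"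
  have C': "0 < C'" "\<bar>f x - f y\<bar> \<le> C' * dist x y" for x y
    using order_trans[OF f(1) mult_right_mono[of C C' "dist x y"]] by (auto simp: C'_def)
  have cont: "continuous_on UNIV f"
    by (rule lipschitz_on_continuous_on[of C']) (use C' in \<open>auto intro!: lipschitz_onI simp: dist_real_def\<close>)
  define A where "A = (\<integral>J. f (normalise J) \<partial>Q)"
  define a where "a n = ewens_mean \<theta> (\<lambda>\<alpha>. f (sgn (longest_parts \<alpha>))) n" for n
  have a_eq: "a n = (\<integral>\<xi>. f (sgn (longest_parts (runs \<xi> n 0))) \<partial>feller_measure \<theta>)" if "1 \<le> n" for n
    unfolding a_def by (rule ewens_mean_eq_feller[OF theta_pos that])
  have int: "integrable (feller_measure \<theta>) (\<lambda>\<xi>. f (sgn (longest_parts (runs \<xi> n 0))))" for n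
    by (rule integrable_depends_on[OF _ _ depends_on_runs]) auto
  have slow: "\<bar>a n - a m\<bar> \<le> 2 * C' * (\<bar>real n - real m\<bar> / real m)" if "1 \<le> n" "1 \<le> m" for n m
  proof -
    have "\<bar>a n - a m\<bar> \<le> (\<integral>\<xi>. \<bar>f (sgn (longest_parts (runs \<xi> n 0))) - f (sgn (longest_parts (runs \<xi> m 0)))\<bar> \<partial>feller_measure \<theta>)"
      unfolding a_eq[OF that(1)] a_eq[OF that(2)] Bochner_Integration.integral_diff[OF int int, symmetric]
      by (rule integral_abs_bound)
    also have "\<dots> \<le> (\<integral>\<xi>. C' * (2 * (\<bar>real n - real m\<bar> / real m)) \<partial>feller_measure \<theta>)"
    proof (rule integral_mono)
      show "\<bar>f (sgn (longest_parts (runs \<xi> n 0))) - f (sgn (longest_parts (runs \<xi> m 0)))\<bar> \<le> C' * (2 * (\<bar>real n - real m\<bar> / real m))" for \<xi>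
        using order_trans[OF C'(2) mult_left_mono[OF dist_sgn_runs[OF that] less_imp_le[OF C'(1)]]] .
    qed (use int in auto)
    also have "\<dots> = 2 * C' * (\<bar>real n - real m\<bar> / real m)" by (simp add: F.prob_space mult_ac)
    finally show ?thesis .
  qed
  have a_le: "\<bar>a n\<bar> \<le> B" for n
    unfolding a_def by (rule ewens_mean_abs_le[OF theta_pos f(2)])
  define b where "b n = a n - A" for n
  define B' where "B' = B + \<bar>A\<bar>"
  have b: "\<bar>b n\<bar> \<le> B'" for n using a_le[of n] by (simp add: b_def B'_def)
  have B': "0 \<le> B'" using b[of 0] by linarith
  have lim_b: "(\<lambda>N. \<Sum>n. size_weight \<theta> (e N) n * b n) \<longlonglongrightarrow> 0" if e: "\<And>N. 0 < e N" "e \<longlonglongrightarrow> 0" for e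
  proof -
    have "(\<Sum>n. size_weight \<theta> (e N) n * b n) = (\<Sum>n. size_weight \<theta> (e N) n * a n) - A" for N
    proof -
      have "(\<lambda>n. size_weight \<theta> (e N) n * a n - size_weight \<theta> (e N) n * A) sums ((\<Sum>n. size_weight \<theta> (e N) n * a n) - 1 * A)"
        by (intro sums_diff summable_sums summable_size_weight_mult(1)[OF e(1) a_le] sums_mult2 size_weight_sums e(1))
      then show ?thesis by (simp add: b_def right_diff_distrib sums_iff)
    qed
    then show ?thesis
      using tendsto_diff[OF mixture_tendsto[OF cont f(2) e] tendsto_const[of A]] unfolding A_def a_def by simp
  qed
  have "(\<lambda>N. b (Suc N)) \<longlonglongrightarrow> 0"
  proof (rule LIMSEQ_I)
    fix r :: real assume r: "0 < r"
    define \<delta> where "\<delta> = min (1 / 2) (r / (4 * C'))"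
    have \<delta>: "0 < \<delta>" "\<delta> < 1" "2 * C' * \<delta> \<le> r / 2"
    proof -
      show "0 < \<delta>" "\<delta> < 1" using r C' by (auto simp: \<delta>_def)
      have "2 * C' * \<delta> \<le> 2 * C' * (r / (4 * C'))" using C' by (intro mult_left_mono) (auto simp: \<delta>_def)
      then show "2 * C' * \<delta> \<le> r / 2" using C' by simp
    qed
    obtain q \<psi> where q: "0 < q" and \<psi>: "continuous_on UNIV \<psi>" "\<And>u. 0 \<le> \<psi> u" "\<And>u. \<psi> u \<le> \<delta> * q"
      and near: "\<And>x. 0 < \<psi> (exp (- x)) \<Longrightarrow> \<bar>x - q\<bar> < \<delta> * q"
      and mass: "0 < (\<integral>J. indicator G J * \<psi> (exp (- suminf J)) \<partial>Q)"
      by (rule bump_near_total_mass[OF \<delta>(1,2)]) (rule that)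
    have \<psi>_abs: "\<bar>\<psi> u\<bar> \<le> \<delta> * q" for u using \<psi>(2)[of u] \<psi>(3)[of u] by simp
    \<comment> \<open>Centres the window at the size N + 1 whose mean is to be estimated.\<close>
    define e where "e N = q / real (Suc N)" for N
    have e: "0 < e N" "e \<longlonglongrightarrow> 0" for N
      using q LIMSEQ_Suc[OF lim_const_over_n[of q]] by (auto simp: e_def[abs_def])
    define M where "M N = (\<Sum>n. size_weight \<theta> (e N) n * \<psi> (exp (- e N * real n)))" for N
    define W where "W N = (\<Sum>n. size_weight \<theta> (e N) n * (\<psi> (exp (- e N * real n)) * b n))" for N
    have M: "M \<longlonglongrightarrow> (\<integral>J. indicator G J * \<psi> (exp (- suminf J)) \<partial>Q)"
      unfolding M_def by (rule size_tendsto(2)[OF \<psi>(1) \<psi>_abs e])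
    have W: "W \<longlonglongrightarrow> 0"
      unfolding W_def by (rule size_weight_continuous_test[OF lim_b b continuous_on_subset[OF \<psi>(1)] e]) auto
    have "(\<lambda>N. W N / M N) \<longlonglongrightarrow> 0" using tendsto_divide[OF W M] mass by simp
    then have "\<forall>\<^sub>F N in sequentially. norm (W N / M N) < r / 2"
      using r by (intro order_tendstoD(2)[OF tendsto_norm]) auto
    moreover have "\<forall>\<^sub>F N in sequentially. 0 < M N" using M mass by (rule order_tendstoD)
    ultimately have "\<forall>\<^sub>F N in sequentially. norm (b (Suc N) - 0) < r"
    proof eventually_elim
      case (elim N)
      let ?\<psi> = "\<lambda>n. \<psi> (exp (- e N * real n))"
      \<comment> \<open>Where the bump is positive, n is within a relative distance \<delta> of N +
        1; elsewhere both sides vanish.\<close>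
      have close: "\<bar>?\<psi> n * (b (Suc N) - b n)\<bar> \<le> ?\<psi> n * (r / 2)" for n
      proof (cases "0 < ?\<psi> n")
        case True
        then have nq: "\<bar>e N * real n - q\<bar> < \<delta> * q" using near[of "e N * real n"] by simp
        have "n \<noteq> 0"
        proof
          assume "n = 0"
          then have "1 * q < \<delta> * q" using nq q by simp
          then show False using \<delta>(2) q by simp
        qed
        have "e N * real n - q = q * ((real n - real (Suc N)) / real (Suc N))"
          by (simp add: e_def field_simps)
        then have "q * \<bar>(real n - real (Suc N)) / real (Suc N)\<bar> < q * \<delta>"
          using nq q by (simp add: abs_mult mult.commute)
        then have "\<bar>real n - real (Suc N)\<bar> / real (Suc N) \<le> \<delta>"
          unfolding mult_less_cancel_left_pos[OF q] by (simp add: abs_divide)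
        then have "2 * C' * (\<bar>real n - real (Suc N)\<bar> / real (Suc N)) \<le> 2 * C' * \<delta>"
          using C' by (intro mult_left_mono) auto
        then have "\<bar>a n - a (Suc N)\<bar> \<le> r / 2"
          using slow[of n "Suc N"] \<open>n \<noteq> 0\<close> \<delta>(3) by linarith
        then have "\<bar>b (Suc N) - b n\<bar> \<le> r / 2" by (simp add: b_def abs_minus_commute)
        then show ?thesis unfolding abs_mult abs_of_nonneg[OF \<psi>(2)] by (intro mult_left_mono \<psi>(2))
      next
        case False
        then have "?\<psi> n = 0" using \<psi>(2)[of "exp (- e N * real n)"] by linarith
        then show ?thesis by simp
      qed
      have s\<psi>: "summable (\<lambda>n. size_weight \<theta> (e N) n * ?\<psi> n)"
        by (rule summable_size_weight_mult(1)[OF e(1) \<psi>_abs])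
      have sb: "summable (\<lambda>n. size_weight \<theta> (e N) n * (?\<psi> n * b n))"
      proof (rule summable_size_weight_mult(1)[OF e(1)])
        show "\<bar>?\<psi> n * b n\<bar> \<le> \<delta> * q * B'" for n
          unfolding abs_mult using \<psi>_abs b \<delta> q by (intro mult_mono) auto
      qed
      have d: "(\<lambda>n. size_weight \<theta> (e N) n * (?\<psi> n * (b (Suc N) - b n))) sums (b (Suc N) * M N - W N)"
      proof -
        have "(\<lambda>n. b (Suc N) * (size_weight \<theta> (e N) n * ?\<psi> n) - size_weight \<theta> (e N) n * (?\<psi> n * b n)) sums (b (Suc N) * M N - W N)"
          unfolding M_def W_def by (intro sums_diff sums_mult summable_sums s\<psi> sb)
        moreover have "w * (p * (y - z)) = y * (w * p) - w * (p * z)" for w p y z :: real by (simp add: algebra_simps)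
        ultimately show ?thesis by simp
      qed
      have le: "norm (size_weight \<theta> (e N) n * (?\<psi> n * (b (Suc N) - b n))) \<le> size_weight \<theta> (e N) n * ?\<psi> n * (r / 2)" for n
      proof -
        have "norm (size_weight \<theta> (e N) n * (?\<psi> n * (b (Suc N) - b n))) = size_weight \<theta> (e N) n * \<bar>?\<psi> n * (b (Suc N) - b n)\<bar>"
          using size_weight_nonneg[OF theta_pos, of "e N" n] by (simp add: abs_mult)
        also have "\<dots> \<le> size_weight \<theta> (e N) n * (?\<psi> n * (r / 2))"
          by (intro mult_left_mono close size_weight_nonneg theta_pos)
        finally show ?thesis by (simp only: mult.assoc)
      qed
      have sr: "summable (\<lambda>n. size_weight \<theta> (e N) n * ?\<psi> n * (r / 2))" by (intro summable_mult2 s\<psi>)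
      have "norm (b (Suc N) * M N - W N) \<le> (\<Sum>n. size_weight \<theta> (e N) n * ?\<psi> n * (r / 2))"
        using norm_suminf_le[OF le sr] sums_unique[OF d] by simp
      also have "\<dots> = M N * (r / 2)" unfolding M_def by (rule suminf_mult2[OF s\<psi>, symmetric])
      \<comment> \<open>After division by the positive mass M N, slow variation and the vanishing
        average W N / M N contribute at most r / 2 each, the latter strictly less.\<close>
      finally have "\<bar>b (Suc N) * M N\<bar> \<le> \<bar>W N\<bar> + M N * (r / 2)"
        unfolding real_norm_def by linarith
      moreover have "\<bar>W N\<bar> < r / 2 * M N" using elim by (simp add: field_simps)
      moreover have "\<bar>b (Suc N) * M N\<bar> = \<bar>b (Suc N)\<bar> * M N" using elim(2) by (simp add: abs_mult)
      moreover have "M N * (r / 2) + r / 2 * M N = r * M N" by (simp add: field_simps)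
      ultimately have "\<bar>b (Suc N)\<bar> * M N < r * M N" by linarith
      then show ?case using elim(2) by simp
    qed
    then show "\<exists>N0. \<forall>N\<ge>N0. norm (b (Suc N) - 0) < r" by (simp add: eventually_sequentially)
  qed
  then have "b \<longlonglongrightarrow> 0" by (rule LIMSEQ_imp_Suc)
  then have "(\<lambda>n. b n + A) \<longlonglongrightarrow> 0 + A" by (intro tendsto_add tendsto_const)
  then show ?thesis by (simp add: b_def a_def[abs_def] A_def)
qed

end


section \<open>Convergence in distribution\<close>

text \<open>The Lipschitz functions \<open>x \<mapsto> inf\<^sub>y (f y + k d(x, y))\<close> increase to \<open>f\<close> as \<open>k\<close> grows.\<close>

lemma converges_weakly_LipschitzI:
  fixes \<mu> :: "nat \<Rightarrow> 'a::metric_space measure"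
  assumes \<mu>: "\<And>n. prob_space (\<mu> n)" "\<And>n. sets (\<mu> n) = sets borel"
    and \<nu>: "prob_space \<nu>" "sets \<nu> = sets borel"
    and lim: "\<And>(f :: 'a \<Rightarrow> real) B C. (\<And>x y. \<bar>f x - f y\<bar> \<le> C * dist x y) \<Longrightarrow> (\<And>x. \<bar>f x\<bar> \<le> B) \<Longrightarrow>
      (\<lambda>n. \<integral>x. f x \<partial>\<mu> n) \<longlonglongrightarrow> (\<integral>x. f x \<partial>\<nu>)"
  shows "converges_weakly \<mu> \<nu>"
  unfolding converges_weakly_def
proof (intro allI impI)
  interpret N: prob_space \<nu> by (rule \<nu>)
  have meas: "g \<in> borel_measurable (\<mu> n)" "g \<in> borel_measurable \<nu>" if "continuous_on UNIV g" for g :: "'a \<Rightarrow> real" and n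
    using borel_measurable_continuous_onI[OF that] measurable_cong_sets[OF \<mu>(2)[of n] refl] measurable_cong_sets[OF \<nu>(2) refl]
    by auto
  \<comment> \<open>Approximation from below yields only a lower bound on the limit; the upper bound
    comes from applying it to - f.\<close>
  have lower: "\<forall>\<^sub>F n in sequentially. (\<integral>x. f x \<partial>\<nu>) - r < (\<integral>x. f x \<partial>\<mu> n)"
    if f: "continuous_on UNIV f" "\<And>x. \<bar>f x\<bar> \<le> B" and r: "0 < r" for f :: "'a \<Rightarrow> real" and B r
  proof -
    define g where "g k x = (INF y. f y + real k * dist x y)" for k x
    have bdd: "bdd_below (range (\<lambda>y. f y + real k * dist x y))" for k x
    proof (rule bdd_belowI2)
      show "- B \<le> f y + real k * dist x y" for y
        using f(2)[of y] by (simp add: abs_le_iff add_increasing2)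
    qed
    have g_le: "g k x \<le> f y + real k * dist x y" for k x y
      unfolding g_def by (rule cINF_lower[OF bdd]) simp
    have g_ge: "c \<le> g k x" if "\<And>y. c \<le> f y + real k * dist x y" for c k x
      unfolding g_def using that by (intro cINF_greatest) auto
    have g_upper: "g k x \<le> f x" for k x using g_le[of k x x] by simp
    have g_lower: "- B \<le> g k x" for k x
    proof (rule g_ge)
      show "- B \<le> f y + real k * dist x y" for y
        using f(2)[of y] by (simp add: abs_le_iff add_increasing2)
    qed
    have g_abs: "\<bar>g k x\<bar> \<le> B" for k x
      using g_upper[of k x] g_lower[of k x] f(2)[of x] by (simp add: abs_le_iff)
    have g_lip1: "g k x \<le> g k y + real k * dist x y" for k x y
    proof -
      have "g k x - real k * dist x y \<le> g k y"
      proof (rule g_ge)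
        fix z
        have "real k * dist x z \<le> real k * (dist x y + dist y z)" by (intro mult_left_mono dist_triangle) auto
        then show "g k x - real k * dist x y \<le> f z + real k * dist y z"
          using g_le[of k x z] by (simp add: distrib_left)
      qed
      then show ?thesis by simp
    qed
    have g_lip: "\<bar>g k x - g k y\<bar> \<le> real k * dist x y" for k x y
      using g_lip1[of k x y] g_lip1[of k y x] by (simp add: abs_le_iff dist_commute)
    have g_cont: "continuous_on UNIV (g k)" for k
      by (rule lipschitz_on_continuous_on[of "real k"]) (use g_lip in \<open>auto intro!: lipschitz_onI simp: dist_real_def\<close>)
    have g_lim: "(\<lambda>k. g k x) \<longlonglongrightarrow> f x" for x
    proof (rule LIMSEQ_I)
      fix s :: real assume s: "0 < s"
      have "isCont f x" using f(1) by (simp add: continuous_on_eq_continuous_at)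
      then obtain d where d: "0 < d" "\<And>y. dist y x < d \<Longrightarrow> \<bar>f y - f x\<bar> < s / 2"
        using s unfolding continuous_at_eps_delta dist_real_def by (metis half_gt_zero)
      \<comment> \<open>At distance at least d the penalty k d is then at least 2 B, which exceeds
        any possible drop of f; nearer points are handled by continuity.\<close>
      obtain K where K: "2 * B / d \<le> real K" using real_arch_simple by blast
      show "\<exists>K. \<forall>k\<ge>K. norm (g k x - f x) < s"
      proof (intro exI[of _ K] allI impI)
        fix k assume k: "K \<le> k"
        have "f x - s / 2 \<le> g k x"
        proof (rule g_ge)
          fix y
          show "f x - s / 2 \<le> f y + real k * dist x y"
          proof (cases "dist y x < d")
            case True
            have "f x - s / 2 \<le> f y" using d(2)[OF True] by linarith
            then show ?thesis by (simp add: add_increasing2)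
          next
            case False
            have "2 * B \<le> real K * d" using K d(1) by (simp add: field_simps)
            also have "\<dots> \<le> real k * dist x y"
              using False k d(1) by (intro mult_mono) (auto simp: dist_commute)
            finally show ?thesis using f(2)[of x] f(2)[of y] s unfolding abs_le_iff by linarith
          qed
        qed
        then show "norm (g k x - f x) < s" using g_upper[of k x] s by simp
      qed
    qed
    have "(\<lambda>k. \<integral>x. g k x \<partial>\<nu>) \<longlonglongrightarrow> (\<integral>x. f x \<partial>\<nu>)"
      by (rule integral_dominated_convergence[where w = "\<lambda>_. B"]) (use meas(2)[OF f(1)] meas(2)[OF g_cont] g_lim g_abs in auto)
    then have "\<forall>\<^sub>F k in sequentially. (\<integral>x. f x \<partial>\<nu>) - r < (\<integral>x. g k x \<partial>\<nu>)"
      using r by (intro order_tendstoD(1)) auto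
    then obtain k where k: "(\<integral>x. f x \<partial>\<nu>) - r < (\<integral>x. g k x \<partial>\<nu>)"
      using eventually_happens'[OF sequentially_bot] by blast
    have "\<forall>\<^sub>F n in sequentially. (\<integral>x. f x \<partial>\<nu>) - r < (\<integral>x. g k x \<partial>\<mu> n)"
      using lim[OF g_lip g_abs, of k] k by (rule order_tendstoD)
    then show ?thesis
    proof eventually_elim
      case (elim n)
      interpret M: prob_space "\<mu> n" by (rule \<mu>)
      have "(\<integral>x. g k x \<partial>\<mu> n) \<le> (\<integral>x. f x \<partial>\<mu> n)"
        by (intro integral_mono M.integrable_const_bound[where B = B] meas f(1) g_cont g_upper) (use f(2) g_abs in auto)
      with elim show ?case by simp
    qed
  qed
  fix f :: "'a \<Rightarrow> real" assume f: "continuous_on UNIV f" "bounded (range f)"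
  then obtain B where B: "\<And>x. \<bar>f x\<bar> \<le> B" by (auto simp: bounded_iff)
  show "(\<lambda>n. \<integral>x. f x \<partial>\<mu> n) \<longlonglongrightarrow> (\<integral>x. f x \<partial>\<nu>)"
  proof (rule tendstoI)
    fix r :: real assume "0 < r"
    have "continuous_on UNIV (\<lambda>x. - f x)" using f(1) by (rule continuous_on_minus)
    then have upper: "\<forall>\<^sub>F n in sequentially. (\<integral>x. - f x \<partial>\<nu>) - r < (\<integral>x. - f x \<partial>\<mu> n)"
      by (rule lower[of _ B]) (use B \<open>0 < r\<close> in auto)
    show "\<forall>\<^sub>F n in sequentially. dist (\<integral>x. f x \<partial>\<mu> n) (\<integral>x. f x \<partial>\<nu>) < r"
      using lower[OF f(1) B \<open>0 < r\<close>] upper by eventually_elim (simp add: dist_real_def abs_less_iff)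
  qed
qed

lemma feller_expectation_tendsto:
  fixes f :: "ell1 \<Rightarrow> real"
  assumes "0 < \<theta>" and f: "\<And>x y. \<bar>f x - f y\<bar> \<le> C * dist x y" "\<And>x. \<bar>f x\<bar> \<le> B"
    and PD: "poisson_dirichlet \<theta> PD"
  shows "(\<lambda>n. \<integral>\<xi>. f (longest_parts (runs \<xi> n 0) /\<^sub>R real n) \<partial>feller_measure \<theta>) \<longlonglongrightarrow> (\<integral>x. f x \<partial>PD)"
    and "prob_space PD" "sets PD = sets borel"
proof -
  obtain Q where Q: "sets Q = sets (\<Pi>\<^sub>M k\<in>UNIV. borel)" "poisson_points Q (pd_intensity \<theta>) (\<lambda>k J. J k)"
    "AE J in Q. \<forall>k. J (Suc k) < J k \<and> 0 < J k" "PD = distr Q borel normalise"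
    using PD unfolding poisson_dirichlet_def by blast
  interpret prob_space Q using Q(2) by (simp add: poisson_points_def)
  interpret pd_points Q \<theta> by unfold_locales (use assms(1) Q in auto)
  obtain N where N: "{J\<in>space Q. \<not> good_points J} \<subseteq> N" "emeasure Q N = 0" "N \<in> events"
    using AE_E[OF AE_good_points] by metis
  \<comment> \<open>The complement of a null set covering the bad sequences is the required
    measurable set.\<close>
  interpret pd_points_good Q \<theta> "space Q - N"
  proof unfold_locales
    show "AE J in Q. J \<in> space Q - N"
      using AE_not_in[of N Q] N(2,3) AE_space by (auto simp: null_sets_def elim: eventually_elim2)
  qed (use N in auto)
  have norm: "normalise \<in> borel_measurable Q"
    using measurable_normalise measurable_cong_sets[OF Q(1) refl] by blast
  show "prob_space PD" unfolding Q(4) by (rule prob_space_distr[OF norm])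
  show "sets PD = sets borel" by (simp add: Q(4))
  have cont: "continuous_on UNIV f"
    by (rule lipschitz_on_continuous_on[of "\<bar>C\<bar>"])
      (auto intro!: lipschitz_onI order_trans[OF f(1)] mult_right_mono simp: dist_real_def)
  have "(\<integral>x. f x \<partial>PD) = (\<integral>J. f (normalise J) \<partial>Q)"
    unfolding Q(4) using norm borel_measurable_continuous_onI[OF cont] by (rule integral_distr)
  moreover have "\<forall>\<^sub>F n in sequentially. ewens_mean \<theta> (\<lambda>\<alpha>. f (sgn (longest_parts \<alpha>))) n =
      (\<integral>\<xi>. f (longest_parts (runs \<xi> n 0) /\<^sub>R real n) \<partial>feller_measure \<theta>)"
    using eventually_ge_at_top[of 1]
  proof eventually_elim
    case (elim n)
    have "norm (longest_parts (runs \<xi> n 0)) = real n" for \<xi>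
      using norm_longest_parts[OF runs_in_partitions[of \<xi> n 0]] by simp
    then show ?case by (simp add: ewens_mean_eq_feller[OF assms(1) elim] sgn_div_norm)
  qed
  ultimately show "(\<lambda>n. \<integral>\<xi>. f (longest_parts (runs \<xi> n 0) /\<^sub>R real n) \<partial>feller_measure \<theta>) \<longlonglongrightarrow> (\<integral>x. f x \<partial>PD)"
    using Lim_transform_eventually[OF ewens_mean_tendsto[OF f]] by simp
qed

section \<open>From the Feller coupling to the perturbed measures\<close>

lemma perturbed_ewens_expectation:
  fixes F :: "(nat \<Rightarrow> nat) \<Rightarrow> real"
  assumes "0 < \<theta>" "1 \<le> n" and p: "\<And>\<alpha>. pmf p \<alpha> = perturbed_ewens \<theta> \<eta> n \<alpha>"
  shows "(\<integral>\<alpha>. F \<alpha> \<partial>measure_pmf p) =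
    (\<integral>\<xi>. \<eta> (runs \<xi> n 0) * F (runs \<xi> n 0) \<partial>feller_measure \<theta>) / (\<integral>\<xi>. \<eta> (runs \<xi> n 0) \<partial>feller_measure \<theta>)"
proof -
  have "(\<integral>\<alpha>. F \<alpha> \<partial>measure_pmf p) = (\<Sum>\<alpha>\<in>partitions n. F \<alpha> * pmf p \<alpha>)"
    by (rule integral_measure_pmf_real[OF finite_partitions])
      (auto simp: set_pmf_iff p perturbed_ewens_def split: if_splits)
  also have "\<dots> = (\<Sum>\<alpha>\<in>partitions n. \<eta> \<alpha> * F \<alpha> * ewens_weight \<theta> n \<alpha>) / ewens_Z \<theta> \<eta> n"
    unfolding sum_divide_distrib by (intro sum.cong) (auto simp: p perturbed_ewens_def)
  also have "\<dots> = (fact n / pochhammer \<theta> n * (\<Sum>\<alpha>\<in>partitions n. \<eta> \<alpha> * F \<alpha> * ewens_weight \<theta> n \<alpha>)) /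
      (fact n / pochhammer \<theta> n * ewens_Z \<theta> \<eta> n)"
    using pochhammer_pos[OF assms(1), of n] by (intro mult_divide_mult_cancel_left[symmetric]) auto
  finally show ?thesis
    unfolding ewens_Z_def integral_runs[OF assms(1,2), of \<eta>, symmetric]
      integral_runs[OF assms(1,2), of "\<lambda>\<alpha>. \<eta> \<alpha> * F \<alpha>", symmetric] .
qed

lemma eta_trunc_eq_runs:
  assumes "\<xi> 1" shows "eta_trunc \<eta> n n \<xi> = \<eta> (runs \<xi> n 0)"
proof -
  have "(\<lambda>i. if i \<le> n then feller_count n \<xi> i else 0) = feller_count n \<xi>"
    by (auto simp: feller_count_def)
  then show ?thesis by (simp add: eta_trunc_def feller_count_eq_runs[where \<xi> = \<xi>, OF assms])
qed

theorem corollary1p2: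
  fixes \<theta> :: real and P :: "nat \<Rightarrow> (nat \<Rightarrow> nat) pmf" and PD :: "ell1 measure"
  assumes "\<theta> > 0"
    and "asymptotically_ewens \<theta> P"
    and "poisson_dirichlet \<theta> PD"
  shows "converges_weakly
           (\<lambda>n. distr (measure_pmf (P n)) borel (\<lambda>\<alpha>. longest_parts \<alpha> /\<^sub>R real n)) PD"
proof (rule converges_weakly_LipschitzI)
  show "prob_space (distr (measure_pmf (P n)) borel (\<lambda>\<alpha>. longest_parts \<alpha> /\<^sub>R real n))" for n
    by (rule measure_pmf.prob_space_distr) simp
  show "prob_space PD" "sets PD = sets borel"
    using feller_expectation_tendsto(2,3)[OF assms(1) _ _ assms(3), of "\<lambda>_. 0" 0 0] by simp_all
  fix f :: "ell1 \<Rightarrow> real" and B C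
  assume f: "\<And>x y. \<bar>f x - f y\<bar> \<le> C * dist x y" "\<And>x. \<bar>f x\<bar> \<le> B"
  let ?\<F> = "feller_measure \<theta>"
  obtain \<eta> h where P: "\<And>n \<alpha>. 1 \<le> n \<Longrightarrow> pmf (P n) \<alpha> = perturbed_ewens \<theta> \<eta> n \<alpha>"
    and L1: "tendsto_L1 ?\<F> (\<lambda>n. eta_trunc \<eta> n n) h" and h_pos: "0 < (\<integral>\<xi>. h \<xi> \<partial>?\<F>)"
    using assms(2) unfolding asymptotically_ewens_def by blast
  have h: "integrable ?\<F> h" using L1 by (simp add: tendsto_L1_def)
  define H where "H n \<xi> = \<eta> (runs \<xi> n 0)" for n \<xi>
  define F where "F n \<xi> = f (longest_parts (runs \<xi> n 0) /\<^sub>R real n)" for n \<xi>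
  have dep: "depends_on {1..n} (H n)" "depends_on {1..n} (F n)" for n
    unfolding H_def F_def by (rule depends_on_runs)+
  have H: "integrable ?\<F> (H n)" for n by (rule integrable_depends_on[OF _ _ dep(1)]) auto
  have F: "F n \<in> borel_measurable ?\<F>" "\<bar>F n \<xi>\<bar> \<le> B" for n \<xi>
    using measurable_depends_on[OF _ _ dep(2)] f(2) by (auto simp: F_def)
  \<comment> \<open>The explicit Feller counts agree with \<open>runs\<close> only when the first
    bit is one, hence almost surely.\<close>
  have H_lim: "(\<lambda>n. \<integral>\<xi>. \<bar>H n \<xi> - h \<xi>\<bar> \<partial>?\<F>) \<longlonglongrightarrow> 0"
  proof (rule Lim_transform_eventually)
    show "(\<lambda>n. \<integral>\<xi>. \<bar>eta_trunc \<eta> n n \<xi> - h \<xi>\<bar> \<partial>?\<F>) \<longlonglongrightarrow> 0" using L1 by (simp add: tendsto_L1_def)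
    have "\<forall>\<^sub>F n in sequentially. integrable ?\<F> (eta_trunc \<eta> n n)" using L1 by (simp add: tendsto_L1_def)
    then show "\<forall>\<^sub>F n in sequentially. (\<integral>\<xi>. \<bar>eta_trunc \<eta> n n \<xi> - h \<xi>\<bar> \<partial>?\<F>) = (\<integral>\<xi>. \<bar>H n \<xi> - h \<xi>\<bar> \<partial>?\<F>)"
    proof eventually_elim
      case (elim n)
      show ?case
      proof (rule integral_cong_AE)
        show "AE \<xi> in ?\<F>. \<bar>eta_trunc \<eta> n n \<xi> - h \<xi>\<bar> = \<bar>H n \<xi> - h \<xi>\<bar>"
          using AE_feller_first[OF assms(1)] by eventually_elim (simp add: H_def eta_trunc_eq_runs)
      qed (use elim h H[of n] in auto)
    qed
  qed
  \<comment> \<open>Against uniformly bounded functions the density at stage n may be replaced by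
    its limit h. It is used with \<open>F\<close> for the numerator and with the constant 1 for the
    denominator.\<close>
  have diff: "(\<lambda>n. (\<integral>\<xi>. H n \<xi> * G n \<xi> \<partial>?\<F>) - (\<integral>\<xi>. h \<xi> * G n \<xi> \<partial>?\<F>)) \<longlonglongrightarrow> 0"
    if G: "\<And>n. G n \<in> borel_measurable ?\<F>" "\<And>n \<xi>. \<bar>G n \<xi>\<bar> \<le> c" for G :: "nat \<Rightarrow> (nat \<Rightarrow> bool) \<Rightarrow> real" and c
  proof (rule Lim_null_comparison)
    show "(\<lambda>n. (\<integral>\<xi>. \<bar>H n \<xi> - h \<xi>\<bar> \<partial>?\<F>) * c) \<longlonglongrightarrow> 0" using H_lim by (rule tendsto_mult_left_zero)
    have "norm ((\<integral>\<xi>. H n \<xi> * G n \<xi> \<partial>?\<F>) - (\<integral>\<xi>. h \<xi> * G n \<xi> \<partial>?\<F>)) \<le> (\<integral>\<xi>. \<bar>H n \<xi> - h \<xi>\<bar> \<partial>?\<F>) * c" for n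
    proof -
      have int: "integrable ?\<F> (\<lambda>\<xi>. H n \<xi> * G n \<xi>)" "integrable ?\<F> (\<lambda>\<xi>. h \<xi> * G n \<xi>)"
        using integrable_mult_bounded[OF _ G] H h by auto
      have "norm ((\<integral>\<xi>. H n \<xi> * G n \<xi> \<partial>?\<F>) - (\<integral>\<xi>. h \<xi> * G n \<xi> \<partial>?\<F>)) \<le> (\<integral>\<xi>. \<bar>H n \<xi> * G n \<xi> - h \<xi> * G n \<xi>\<bar> \<partial>?\<F>)"
        unfolding Bochner_Integration.integral_diff[OF int, symmetric] real_norm_def by (rule integral_abs_bound)
      also have "\<dots> \<le> (\<integral>\<xi>. \<bar>H n \<xi> - h \<xi>\<bar> * c \<partial>?\<F>)"
      proof (rule integral_mono)
        show "\<bar>H n \<xi> * G n \<xi> - h \<xi> * G n \<xi>\<bar> \<le> \<bar>H n \<xi> - h \<xi>\<bar> * c" for \<xi>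
          unfolding left_diff_distrib[symmetric] abs_mult by (intro mult_left_mono G) auto
      qed (use int H h in auto)
      finally show ?thesis by simp
    qed
    then show "\<forall>\<^sub>F n in sequentially. norm ((\<integral>\<xi>. H n \<xi> * G n \<xi> \<partial>?\<F>) - (\<integral>\<xi>. h \<xi> * G n \<xi> \<partial>?\<F>)) \<le>
        (\<integral>\<xi>. \<bar>H n \<xi> - h \<xi>\<bar> \<partial>?\<F>) * c" by simp
  qed
  have "(\<lambda>n. \<integral>\<xi>. F n \<xi> \<partial>?\<F>) \<longlonglongrightarrow> (\<integral>x. f x \<partial>PD)"
    unfolding F_def by (rule feller_expectation_tendsto(1)[OF assms(1) f assms(3)])
  then have "(\<lambda>n. \<integral>\<xi>. h \<xi> * F n \<xi> \<partial>?\<F>) \<longlonglongrightarrow> (\<integral>\<xi>. h \<xi> \<partial>?\<F>) * (\<integral>x. f x \<partial>PD)"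
    unfolding F_def by (rule mixing_feller[OF assms(1) f _ h])
  from tendsto_add[OF diff[of F, OF F] this]
  have num: "(\<lambda>n. \<integral>\<xi>. H n \<xi> * F n \<xi> \<partial>?\<F>) \<longlonglongrightarrow> (\<integral>\<xi>. h \<xi> \<partial>?\<F>) * (\<integral>x. f x \<partial>PD)" by simp
  from tendsto_add[OF diff[of "\<lambda>_ _. 1" 1] tendsto_const[of "\<integral>\<xi>. h \<xi> \<partial>?\<F>"]]
  have den: "(\<lambda>n. \<integral>\<xi>. H n \<xi> \<partial>?\<F>) \<longlonglongrightarrow> (\<integral>\<xi>. h \<xi> \<partial>?\<F>)" by simp
  \<comment> \<open>Mixing makes the numerator factorise in the limit, and the positive mean of h
    cancels.\<close>
  have "(\<lambda>n. (\<integral>\<xi>. H n \<xi> * F n \<xi> \<partial>?\<F>) / (\<integral>\<xi>. H n \<xi> \<partial>?\<F>)) \<longlonglongrightarrow>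
      (\<integral>\<xi>. h \<xi> \<partial>?\<F>) * (\<integral>x. f x \<partial>PD) / (\<integral>\<xi>. h \<xi> \<partial>?\<F>)"
    using h_pos by (intro tendsto_divide num den) auto
  then have lim: "(\<lambda>n. (\<integral>\<xi>. H n \<xi> * F n \<xi> \<partial>?\<F>) / (\<integral>\<xi>. H n \<xi> \<partial>?\<F>)) \<longlonglongrightarrow> (\<integral>x. f x \<partial>PD)"
    using h_pos by simp
  have cont: "continuous_on UNIV f"
    by (rule lipschitz_on_continuous_on[of "\<bar>C\<bar>"])
      (auto intro!: lipschitz_onI order_trans[OF f(1)] mult_right_mono simp: dist_real_def)
  \<comment> \<open>The ratio represents the expectation for n \<ge> 1 only, as \<open>P 0\<close>
    is arbitrary; this suffices for the limit.\<close>
  show "(\<lambda>n. \<integral>x. f x \<partial>distr (measure_pmf (P n)) borel (\<lambda>\<alpha>. longest_parts \<alpha> /\<^sub>R real n)) \<longlonglongrightarrow> (\<integral>x. f x \<partial>PD)"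
  proof (rule Lim_transform_eventually[OF lim])
    show "\<forall>\<^sub>F n in sequentially. (\<integral>\<xi>. H n \<xi> * F n \<xi> \<partial>?\<F>) / (\<integral>\<xi>. H n \<xi> \<partial>?\<F>) =
        (\<integral>x. f x \<partial>distr (measure_pmf (P n)) borel (\<lambda>\<alpha>. longest_parts \<alpha> /\<^sub>R real n))"
      using eventually_ge_at_top[of 1]
    proof eventually_elim
      case (elim n)
      show ?case
        using perturbed_ewens_expectation[OF assms(1) elim P[OF elim], of "\<lambda>\<alpha>. f (longest_parts \<alpha> /\<^sub>R real n)"]
          borel_measurable_continuous_onI[OF cont]
        by (subst integral_distr) (simp_all add: H_def[abs_def] F_def)
    qed
  qed
qed simp

end
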